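(* Let $E$ be an arbitrary directed graph, $K$ a field, and $L=L_K(E)$ the Leavitt path algebra. For a proper ideal $I$ of $L$ the following are equivalent: (1) $I$ is a strongly irreducible ideal of $L$; (2) $I$ is an irreducible ideal of $L$; (3) $I=P^n$ for some prime ideal $P$ of $L$ and some integer $n\ge 1$.
   Context: A directed graph $E=(E^0,E^1,r,s)$ consists of sets $E^0$ (vertices), $E^1$ (edges) and maps $r,s:E^1\to E^0$; no finiteness or countability is assumed. A vertex is regular if it emits a nonempty finite set of edges. $L_K(E)$ is the (not necessarily unital) $K$-algebra generated by pairwise orthogonal idempotents $v\in E^0$ and elements $e,e^*$ ($e\in E^1$) subject to: $s(e)e=e=er(e)$; $r(e)e^*=e^*=e^*s(e)$; $e^*e=r(e)$ and $e^*f=0$ for edges $e\neq f$; $v=\sum_{s(e)=v}ee^*$ for every regular vertex $v$. "Ideal" means two-sided ideal; prime ideals are proper. An ideal $I$ of a ring $R$ is irreducible if for all ideals $A,B$ of $R$, $A\cap B=I$ implies $A=I$ or $B=I$; it is strongly irreducible if for all ideals $A,B$ of $R$, $A\cap B\subseteq I$ implies $A\subseteq I$ or $B\subseteq I$. *)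

theory Defs
  imports
    "Graph_Theory.Digraph"
    "HOL-Algebra.QuotRing"
    "HOL-Algebra.Ideal_Product"
    "HOL-Library.Poly_Mapping"
begin

section \<open>Ideals of rings without unit\<close>

text \<open>
  Leavitt path algebras are in general neither unital nor commutative, so the locales
  \<^locale>\<open>ideal\<close> (which demands a unital ring) and \<^locale>\<open>primeideal\<close> (which demands a
  commutative one) do not apply. The notions below never look at the field \<open>one\<close> of the ring record.
\<close>

locale two_sided_ideal = additive_subgroup I R for I and R (structure) +
  assumes l_closed: "a \<in> I \<Longrightarrow> x \<in> carrier R \<Longrightarrow> x \<otimes> a \<in> I"
    and r_closed: "a \<in> I \<Longrightarrow> x \<in> carrier R \<Longrightarrow> a \<otimes> x \<in> I"

definition proper_ideal :: "'a set \<Rightarrow> ('a, 'm) ring_scheme \<Rightarrow> bool" where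
  "proper_ideal I R \<longleftrightarrow> two_sided_ideal I R \<and> I \<noteq> carrier R"

definition prime_ideal :: "'a set \<Rightarrow> ('a, 'm) ring_scheme \<Rightarrow> bool" where
  "prime_ideal P R \<longleftrightarrow> proper_ideal P R \<and>
     (\<forall>A B. two_sided_ideal A R \<longrightarrow> two_sided_ideal B R \<longrightarrow>
        A \<cdot>\<^bsub>R\<^esub> B \<subseteq> P \<longrightarrow> A \<subseteq> P \<or> B \<subseteq> P)"

definition irreducible_ideal :: "'a set \<Rightarrow> ('a, 'm) ring_scheme \<Rightarrow> bool" where
  "irreducible_ideal I R \<longleftrightarrow> two_sided_ideal I R \<and>
     (\<forall>A B. two_sided_ideal A R \<longrightarrow> two_sided_ideal B R \<longrightarrow>
        A \<inter> B = I \<longrightarrow> A = I \<or> B = I)"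

definition strongly_irreducible_ideal :: "'a set \<Rightarrow> ('a, 'm) ring_scheme \<Rightarrow> bool" where
  "strongly_irreducible_ideal I R \<longleftrightarrow> two_sided_ideal I R \<and>
     (\<forall>A B. two_sided_ideal A R \<longrightarrow> two_sided_ideal B R \<longrightarrow>
        A \<inter> B \<subseteq> I \<longrightarrow> A \<subseteq> I \<or> B \<subseteq> I)"

text \<open>Only exponents \<open>n \<ge> 1\<close> are of interest; the value at \<open>0\<close> is the usual convention.\<close>

fun ideal_power :: "('a, 'm) ring_scheme \<Rightarrow> 'a set \<Rightarrow> nat \<Rightarrow> 'a set" where
  "ideal_power R P 0 = carrier R"
| "ideal_power R P (Suc 0) = P"
| "ideal_power R P (Suc (Suc n)) = ideal_power R P (Suc n) \<cdot>\<^bsub>R\<^esub> P"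


section \<open>Free algebras\<close>

text \<open>
  A wrapper around lists which carries the monoid structure of concatenation, so that
  \<open>'a word \<Rightarrow>\<^sub>0 'k\<close> with its convolution product is the free unital algebra on \<open>'a\<close>.
\<close>

datatype 'a word = Word (letters: "'a list")

instantiation word :: (type) monoid_add
begin

definition zero_word :: "'a word" where
  "0 = Word []"

definition plus_word :: "'a word \<Rightarrow> 'a word \<Rightarrow> 'a word" where
  "u + w = Word (letters u @ letters w)"

instance
  by standard (simp_all add: zero_word_def plus_word_def)

end

definition gen :: "'a \<Rightarrow> 'a word \<Rightarrow>\<^sub>0 'k::field" where
  "gen x = Poly_Mapping.single (Word [x]) 1"

definition scale :: "'k::field \<Rightarrow> ('a word \<Rightarrow>\<^sub>0 'k) \<Rightarrow> ('a word \<Rightarrow>\<^sub>0 'k)" where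
  "scale c p = Poly_Mapping.single 0 c * p"

text \<open>
  The free non-unital algebra on a set \<open>X\<close>: combinations of nonempty words with letters in \<open>X\<close>.
  It has no unit, so the field \<open>one\<close> is a dummy.
\<close>

definition free_algebra :: "'k::field itself \<Rightarrow> 'a set \<Rightarrow> ('a word \<Rightarrow>\<^sub>0 'k) ring" where
  "free_algebra K X =
     \<lparr>carrier = {p. \<forall>w \<in> Poly_Mapping.keys p. letters w \<noteq> [] \<and> set (letters w) \<subseteq> X},
      mult = (*), one = undefined, zero = 0, add = (+)\<rparr>"

text \<open>
  Ideals generated by relations are ideals of algebras, i.e. closed under scalars. In the
  absence of a unit this is not implied by being an ideal of the underlying ring.
\<close>

definition relation_ideal ::
    "'k::field itself \<Rightarrow> 'a set \<Rightarrow> ('a word \<Rightarrow>\<^sub>0 'k) set \<Rightarrow> ('a word \<Rightarrow>\<^sub>0 'k) set" where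
  "relation_ideal K X S =
     \<Inter>{J. two_sided_ideal J (free_algebra K X) \<and> (\<forall>c. \<forall>p\<in>J. scale c p \<in> J) \<and> S \<subseteq> J}"

definition presented_algebra ::
    "'k::field itself \<Rightarrow> 'a set \<Rightarrow> ('a word \<Rightarrow>\<^sub>0 'k) set \<Rightarrow> ('a word \<Rightarrow>\<^sub>0 'k) set ring" where
  "presented_algebra K X S = free_algebra K X Quot relation_ideal K X S"


section \<open>Leavitt path algebras\<close>

text \<open>
  The source and range maps of a graph are the maps \<^const>\<open>tail\<close> and \<^const>\<open>head\<close>.
\<close>

definition regular_vertex :: "('v, 'e) pre_digraph \<Rightarrow> 'v \<Rightarrow> bool" where
  "regular_vertex E v \<longleftrightarrow> v \<in> verts E \<and> finite (out_arcs E v) \<and> out_arcs E v \<noteq> {}"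

datatype ('v, 'e) lpa_gen = Vertex 'v | Edge 'e | Ghost 'e

definition lpa_gens :: "('v, 'e) pre_digraph \<Rightarrow> ('v, 'e) lpa_gen set" where
  "lpa_gens E = Vertex ` verts E \<union> Edge ` arcs E \<union> Ghost ` arcs E"

definition lpa_rels ::
    "('v, 'e) pre_digraph \<Rightarrow> (('v, 'e) lpa_gen word \<Rightarrow>\<^sub>0 'k::field) set" where
  "lpa_rels E =
     {gen (Vertex v) * gen (Vertex v) - gen (Vertex v) | v. v \<in> verts E}
   \<union> {gen (Vertex v) * gen (Vertex w) | v w. v \<in> verts E \<and> w \<in> verts E \<and> v \<noteq> w}
   \<union> {gen (Vertex (tail E e)) * gen (Edge e) - gen (Edge e) | e. e \<in> arcs E}
   \<union> {gen (Edge e) * gen (Vertex (head E e)) - gen (Edge e) | e. e \<in> arcs E}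
   \<union> {gen (Vertex (head E e)) * gen (Ghost e) - gen (Ghost e) | e. e \<in> arcs E}
   \<union> {gen (Ghost e) * gen (Vertex (tail E e)) - gen (Ghost e) | e. e \<in> arcs E}
   \<union> {gen (Ghost e) * gen (Edge e) - gen (Vertex (head E e)) | e. e \<in> arcs E}
   \<union> {gen (Ghost e) * gen (Edge f) | e f. e \<in> arcs E \<and> f \<in> arcs E \<and> e \<noteq> f}
   \<union> {gen (Vertex v) - (\<Sum>e \<in> out_arcs E v. gen (Edge e) * gen (Ghost e)) | v. regular_vertex E v}"

definition leavitt_path_algebra ::
    "'k::field itself \<Rightarrow> ('v, 'e) pre_digraph \<Rightarrow> (('v, 'e) lpa_gen word \<Rightarrow>\<^sub>0 'k) set ring" where
  "leavitt_path_algebra K E = presented_algebra K (lpa_gens E) (lpa_rels E)"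

end

theory Submission
  imports Defs "Graph_Theory.Arc_Walk" "HOL-Library.Sublist"
    "HOL-Computational_Algebra.Polynomial_Factorial"
begin

text \<open>
  Write \<open>D\<close> for the span of the elements \<open>p p*\<close>, a commutative subalgebra. An ideal generated by
  idempotents of \<open>D\<close> has local units, so if \<open>I\<close> is irreducible then no idempotent of \<open>D\<close> outside
  \<open>I\<close> can be separated from any other element outside \<open>I\<close>. If \<open>I\<close> is properly contained in an ideal
  with the same idempotents of \<open>D\<close>, then a reduction argument produces a closed walk at some \<open>v\<close> that
  has no exit modulo \<open>I\<close>, together with a new element in the corner at \<open>v\<close>. Modulo the ideal generated
  by its idempotents, that corner is a ring of Laurent polynomials in the shortest closed walk \<open>c\<close>,
  and \<open>I\<close> is determined by the polynomial \<open>f\<close> generating \<open>{g. g(c) \<in> I}\<close>. Irreducibility forces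
  \<open>f = p^n\<close> with \<open>p\<close> prime, and then \<open>I = P^n\<close> for the prime ideal \<open>P\<close> belonging to \<open>p\<close>.
  Conversely, ideals containing the idempotents of a prime \<open>P\<close> are compared with \<open>P^n\<close> either through
  \<open>D\<close> or through divisibility by \<open>p^n\<close> in the corner, which gives strong irreducibility.

  To keep the calculations in a unital ring type, ideals of the Leavitt path algebra \<open>L = F/N\<close> are
  replaced by their preimages in the full free unital algebra, enlarged by all words with a letter
  outside the generators. These are the two-sided ideals between \<open>T\<close> (which comes from \<open>N\<close>) and
  \<open>M\<close> (which comes from \<open>F\<close>).
\<close>

section \<open>Congruences modulo ideals of a ring type\<close>

text \<open>Irreducibility speaks of intersections and primeness of products. Local units bridge the
  two: if \<open>u x = x\<close> with \<open>u\<close> in the first ideal, then \<open>x\<close> in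
  the intersection is already a product. This is how an irreducible ideal behaves like a prime one
  against diagonal idempotents. A nonprime irreducible \<open>I\<close> lies properly in an ideal
  whose square is inside \<open>I\<close>. Idempotents of that ideal lie in its square, hence in
  \<open>I\<close>, and so the reduction to a cycle applies to this pair. The graph is arbitrary, so
  a vertex may emit infinitely many edges and is then no sum of elements \<open>e e*\<close>.
  Therefore the bookkeeping uses all idempotents of \<open>D\<close>, among them \<open>v\<close>
  minus finitely many \<open>e e*\<close>, and not only vertices. Laurent polynomials are not built
  as a type. The cycle is invertible in its corner, so a power of it clears all ghosts and leaves an
  ordinary polynomial. In exchange \<open>X\<close> must be known not to be divisible by the prime
  \<open>p\<close>. This holds because an invertible factor \<open>X\<close> could be cancelled from
  the generator \<open>f\<close>, lowering its degree.\<close>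

definition two_sided :: "'r::ring_1 set \<Rightarrow> bool" where
  "two_sided I \<longleftrightarrow> 0 \<in> I \<and> (\<forall>x\<in>I. \<forall>y\<in>I. x + y \<in> I) \<and> (\<forall>x\<in>I. \<forall>a. a * x \<in> I \<and> x * a \<in> I)"

lemma two_sidedI:
  assumes "0 \<in> I" "\<And>x y. x \<in> I \<Longrightarrow> y \<in> I \<Longrightarrow> x + y \<in> I"
    "\<And>a x. x \<in> I \<Longrightarrow> a * x \<in> I" "\<And>a x. x \<in> I \<Longrightarrow> x * a \<in> I"
  shows "two_sided I"
  using assms by (auto simp: two_sided_def)

lemma
  assumes "two_sided I"
  shows ts_zero: "0 \<in> I"
    and ts_add: "x \<in> I \<Longrightarrow> y \<in> I \<Longrightarrow> x + y \<in> I"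
    and ts_lmult: "x \<in> I \<Longrightarrow> a * x \<in> I"
    and ts_rmult: "x \<in> I \<Longrightarrow> x * a \<in> I"
  using assms by (auto simp: two_sided_def)

lemma ts_mid: "two_sided I \<Longrightarrow> x \<in> I \<Longrightarrow> a * x * b \<in> I"
  by (blast intro: ts_lmult ts_rmult)

lemma ts_uminus: "two_sided I \<Longrightarrow> x \<in> I \<Longrightarrow> - x \<in> I"
  using ts_lmult[of I x "-1"] by simp

lemma ts_diff: "two_sided I \<Longrightarrow> x \<in> I \<Longrightarrow> y \<in> I \<Longrightarrow> x - y \<in> I"
  using ts_add[of I x "- y"] ts_uminus[of I y] by simp

lemma ts_sum: "two_sided I \<Longrightarrow> (\<And>i. i \<in> S \<Longrightarrow> f i \<in> I) \<Longrightarrow> sum f S \<in> I"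
  by (induction S rule: infinite_finite_induct) (auto intro: ts_zero ts_add)

text \<open>The index is an implicit structure argument: in the locales below \<open>T\<close> is
  the structure, so a plain \<open>\<approx>\<close> means congruence modulo
  \<open>T\<close>.\<close>

definition cg :: "'r::ring_1 set \<Rightarrow> 'r \<Rightarrow> 'r \<Rightarrow> bool" (infix \<open>\<approx>\<index>\<close> 50) where
  "x \<approx>\<^bsub>I\<^esub> y \<longleftrightarrow> x - y \<in> I"

lemma cg_refl: "two_sided I \<Longrightarrow> x \<approx>\<^bsub>I\<^esub> x"
  by (simp add: cg_def ts_zero)

lemma cg_sym: "two_sided I \<Longrightarrow> x \<approx>\<^bsub>I\<^esub> y \<Longrightarrow> y \<approx>\<^bsub>I\<^esub> x"
  using ts_uminus[of I "x - y"] by (simp add: cg_def)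

lemma cg_trans: "two_sided I \<Longrightarrow> x \<approx>\<^bsub>I\<^esub> y \<Longrightarrow> y \<approx>\<^bsub>I\<^esub> z \<Longrightarrow> x \<approx>\<^bsub>I\<^esub> z"
  using ts_add[of I "x - y" "y - z"] by (simp add: cg_def)

lemma cg_add: "two_sided I \<Longrightarrow> x \<approx>\<^bsub>I\<^esub> x' \<Longrightarrow> y \<approx>\<^bsub>I\<^esub> y' \<Longrightarrow> x + y \<approx>\<^bsub>I\<^esub> x' + y'"
  using ts_add[of I "x - x'" "y - y'"] by (simp add: cg_def algebra_simps)

lemma cg_diff: "two_sided I \<Longrightarrow> x \<approx>\<^bsub>I\<^esub> x' \<Longrightarrow> y \<approx>\<^bsub>I\<^esub> y' \<Longrightarrow> x - y \<approx>\<^bsub>I\<^esub> x' - y'"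
  using ts_diff[of I "x - x'" "y - y'"] by (simp add: cg_def algebra_simps)

lemma cg_mid: "two_sided I \<Longrightarrow> x \<approx>\<^bsub>I\<^esub> y \<Longrightarrow> a * x * b \<approx>\<^bsub>I\<^esub> a * y * b"
  using ts_mid[of I "x - y" a b] by (simp add: cg_def algebra_simps)

lemma cg_lmult: "two_sided I \<Longrightarrow> x \<approx>\<^bsub>I\<^esub> y \<Longrightarrow> a * x \<approx>\<^bsub>I\<^esub> a * y"
  using cg_mid[of I x y a 1] by simp

lemma cg_rmult: "two_sided I \<Longrightarrow> x \<approx>\<^bsub>I\<^esub> y \<Longrightarrow> x * b \<approx>\<^bsub>I\<^esub> y * b"
  using cg_mid[of I x y 1 b] by simp

lemma cg_mult: "two_sided I \<Longrightarrow> x \<approx>\<^bsub>I\<^esub> x' \<Longrightarrow> y \<approx>\<^bsub>I\<^esub> y' \<Longrightarrow> x * y \<approx>\<^bsub>I\<^esub> x' * y'"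
  by (rule cg_trans[OF _ cg_rmult cg_lmult])

lemma cg_sum:
  "two_sided I \<Longrightarrow> (\<And>i. i \<in> S \<Longrightarrow> f i \<approx>\<^bsub>I\<^esub> g i) \<Longrightarrow> sum f S \<approx>\<^bsub>I\<^esub> sum g S"
  by (induction S rule: infinite_finite_induct) (auto intro: cg_refl cg_add)

lemma cg_mem: "two_sided I \<Longrightarrow> x \<approx>\<^bsub>I\<^esub> y \<Longrightarrow> x \<in> I \<longleftrightarrow> y \<in> I"
  using ts_add[of I "x - y" y] ts_diff[of I x "x - y"] by (auto simp: cg_def)

lemma cg_zero: "x \<approx>\<^bsub>I\<^esub> 0 \<longleftrightarrow> x \<in> I"
  by (simp add: cg_def)

lemma cg_mono: "x \<approx>\<^bsub>I\<^esub> y \<Longrightarrow> I \<subseteq> J \<Longrightarrow> x \<approx>\<^bsub>J\<^esub> y"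
  by (auto simp: cg_def)

text \<open>Negatives come for free whenever \<open>S\<close> is stable under multiplication by -1,
  so inductions have only an additive step.\<close>

inductive_set asp :: "'r::ring_1 set \<Rightarrow> 'r set" for S where
  zero: "0 \<in> asp S"
| step: "x \<in> S \<Longrightarrow> y \<in> asp S \<Longrightarrow> x + y \<in> asp S"

lemma asp_base: "x \<in> S \<Longrightarrow> x \<in> asp S"
  using asp.step[OF _ asp.zero] by force

lemma asp_add: "x \<in> asp S \<Longrightarrow> y \<in> asp S \<Longrightarrow> x + y \<in> asp S"
  by (induction x rule: asp.induct) (auto simp: add.assoc intro: asp.intros)

lemma asp_least:
  assumes "x \<in> asp S" "0 \<in> I" "\<And>x y. x \<in> I \<Longrightarrow> y \<in> I \<Longrightarrow> x + y \<in> I" "S \<subseteq> I"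
  shows "x \<in> I"
  using assms(1) by induction (use assms in auto)

lemma asp_mono: "S \<subseteq> S' \<Longrightarrow> asp S \<subseteq> asp S'"
  by (rule subsetI, erule asp_least) (auto intro: asp.zero asp_add asp_base)

lemma asp_lmult: "x \<in> asp S \<Longrightarrow> (\<And>y. y \<in> S \<Longrightarrow> a * y \<in> asp S') \<Longrightarrow> a * x \<in> asp S'"
  by (induction x rule: asp.induct) (auto simp: distrib_left intro: asp.zero asp_add)

lemma asp_rmult: "x \<in> asp S \<Longrightarrow> (\<And>y. y \<in> S \<Longrightarrow> y * a \<in> asp S') \<Longrightarrow> x * a \<in> asp S'"
  by (induction x rule: asp.induct) (auto simp: distrib_right intro: asp.zero asp_add)

lemma asp_sum: "(\<And>i. i \<in> A \<Longrightarrow> f i \<in> asp S) \<Longrightarrow> sum f A \<in> asp S"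
  by (induction A rule: infinite_finite_induct) (auto intro: asp.zero asp_add)

text \<open>The ambient ring is unital, so the products \<open>a * x * b\<close> already cover
  \<open>x\<close>, its one-sided multiples and its negative.\<close>

definition gen_ideal :: "'r::ring_1 set \<Rightarrow> 'r set" where
  "gen_ideal S = asp {a * x * b | a x b. x \<in> S}"

lemma gen_base: "x \<in> S \<Longrightarrow> x \<in> gen_ideal S"
  unfolding gen_ideal_def by (rule asp_base) (metis (mono_tags, lifting) mem_Collect_eq mult_1 mult_1_right)

lemma two_sided_gen: "two_sided (gen_ideal S)"
  unfolding gen_ideal_def
proof (rule two_sidedI, goal_cases)
  case (3 a x)
  then show ?case
  proof (rule asp_lmult)
    fix y assume "y \<in> {a * x * b | a x b. x \<in> S}"
    then obtain c x b where "y = c * x * b" "x \<in> S" by blast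
    then have "a * y = (a * c) * x * b" by (simp add: mult.assoc)
    with \<open>x \<in> S\<close> show "a * y \<in> asp {a * x * b | a x b. x \<in> S}"
      by (intro asp_base) blast
  qed
next
  case (4 a x)
  then show ?case
  proof (rule asp_rmult)
    fix y assume "y \<in> {a * x * b | a x b. x \<in> S}"
    then obtain c x b where "y = c * x * b" "x \<in> S" by blast
    then have "y * a = c * x * (b * a)" by (simp add: mult.assoc)
    with \<open>x \<in> S\<close> show "y * a \<in> asp {a * x * b | a x b. x \<in> S}"
      by (intro asp_base) blast
  qed
qed (auto intro: asp.zero asp_add)

lemma gen_least: "two_sided I \<Longrightarrow> S \<subseteq> I \<Longrightarrow> gen_ideal S \<subseteq> I"
  unfolding gen_ideal_def by (rule subsetI, erule asp_least) (auto intro: ts_zero ts_add ts_mid)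

lemma gen_mono: "S \<subseteq> S' \<Longrightarrow> gen_ideal S \<subseteq> gen_ideal S'"
  by (rule gen_least[OF two_sided_gen]) (auto intro: gen_base)

definition ideal_sum :: "'r::ring_1 set \<Rightarrow> 'r set \<Rightarrow> 'r set" where
  "ideal_sum A B = {a + b | a b. a \<in> A \<and> b \<in> B}"

lemma two_sided_ideal_sum:
  assumes "two_sided A" "two_sided B" shows "two_sided (ideal_sum A B)"
proof (rule two_sidedI, goal_cases)
  case 1
  have "(0::'a) = 0 + 0" by simp
  then show ?case unfolding ideal_sum_def using ts_zero[OF assms(1)] ts_zero[OF assms(2)] by blast
next
  case (2 x y)
  then obtain a b a' b' where "x = a + b" "y = a' + b'" "a \<in> A" "b \<in> B" "a' \<in> A" "b' \<in> B"
    by (auto simp: ideal_sum_def)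
  then have "x + y = (a + a') + (b + b')" "a + a' \<in> A" "b + b' \<in> B"
    by (simp_all add: algebra_simps ts_add assms)
  then show ?case unfolding ideal_sum_def by blast
next
  case (3 a x)
  then obtain b c where "x = b + c" "b \<in> A" "c \<in> B" by (auto simp: ideal_sum_def)
  then have "a * x = a * b + a * c" "a * b \<in> A" "a * c \<in> B"
    using assms by (simp_all add: distrib_left ts_lmult)
  then show ?case unfolding ideal_sum_def by blast
next
  case (4 a x)
  then obtain b c where "x = b + c" "b \<in> A" "c \<in> B" by (auto simp: ideal_sum_def)
  then have "x * a = b * a + c * a" "b * a \<in> A" "c * a \<in> B"
    using assms by (simp_all add: distrib_right ts_rmult)
  then show ?case unfolding ideal_sum_def by blast
qed

lemma ideal_sum_left: "two_sided B \<Longrightarrow> A \<subseteq> ideal_sum A B"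
  unfolding ideal_sum_def using ts_zero[of B] by force

lemma ideal_sum_right: "two_sided A \<Longrightarrow> B \<subseteq> ideal_sum A B"
  unfolding ideal_sum_def using ts_zero[of A] by force

lemma ideal_sum_least: "two_sided I \<Longrightarrow> A \<subseteq> I \<Longrightarrow> B \<subseteq> I \<Longrightarrow> ideal_sum A B \<subseteq> I"
  unfolding ideal_sum_def by (auto intro: ts_add)

lemma two_sided_Int: "two_sided A \<Longrightarrow> two_sided B \<Longrightarrow> two_sided (A \<inter> B)"
  by (auto simp: two_sided_def)


section \<open>Leavitt families\<close>

text \<open>The generators live in a unital ambient ring and satisfy the relations only modulo
  \<open>T\<close>; \<open>sc\<close> is a central image of the field. Calculations in the algebra
  thus become congruences in a ring type.\<close>

locale leavitt_relations = wf_digraph E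
  for E :: "('v, 'e) pre_digraph" +
  fixes V :: "'v \<Rightarrow> 'r::ring_1" and ed gh :: "'e \<Rightarrow> 'r"
    and sc :: "'k::field \<Rightarrow> 'r" and T :: "'r set" (structure)
  assumes sc_one: "sc 1 = 1" and sc_add: "sc (a + b) = sc a + sc b"
    and sc_mult: "sc (a * b) = sc a * sc b" and sc_central: "sc k * x = x * sc k"
    and T: "two_sided T"
    and rel_VV: "v \<in> verts E \<Longrightarrow> V v * V v \<approx>\<^bsub>T\<^esub> V v"
    and rel_VV0: "v \<in> verts E \<Longrightarrow> w \<in> verts E \<Longrightarrow> v \<noteq> w \<Longrightarrow> V v * V w \<in> T"
    and rel_Ve: "e \<in> arcs E \<Longrightarrow> V (tail E e) * ed e \<approx>\<^bsub>T\<^esub> ed e"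
    and rel_eV: "e \<in> arcs E \<Longrightarrow> ed e * V (head E e) \<approx>\<^bsub>T\<^esub> ed e"
    and rel_Vg: "e \<in> arcs E \<Longrightarrow> V (head E e) * gh e \<approx>\<^bsub>T\<^esub> gh e"
    and rel_gV: "e \<in> arcs E \<Longrightarrow> gh e * V (tail E e) \<approx>\<^bsub>T\<^esub> gh e"
    and rel_ge: "e \<in> arcs E \<Longrightarrow> gh e * ed e \<approx>\<^bsub>T\<^esub> V (head E e)"
    and rel_ge0: "e \<in> arcs E \<Longrightarrow> f \<in> arcs E \<Longrightarrow> e \<noteq> f \<Longrightarrow> gh e * ed f \<in> T"
begin

text \<open>A path, its ghost read backwards, and the monomial \<open>p q*\<close>. The factor
  \<open>V w\<close> is kept because the empty word gives the ambient unit 1 instead of a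
  vertex.\<close>

definition "re p = prod_list (map ed p)"
definition "gho p = prod_list (map gh (rev p))"
definition "mnl p w q = re p * V w * gho q"

lemma re_simps [simp]: "re [] = 1" "re (e # p) = ed e * re p" "re (p @ q) = re p * re q"
  by (simp_all add: re_def)

lemma gho_simps [simp]: "gho [] = 1" "gho (e # p) = gho p * gh e" "gho (p @ q) = gho q * gho p"
  by (simp_all add: gho_def)

declare T [simp]
lemmas cT_refl [simp] = cg_refl[OF T]
  and cT_sym = cg_sym[OF T]
  and cT_trans [trans] = cg_trans[OF T]
  and cT_add = cg_add[OF T]
  and cT_mid = cg_mid[OF T]
  and cT_lmult = cg_lmult[OF T]
  and cT_rmult = cg_rmult[OF T]
  and cT_mult = cg_mult[OF T]
  and cT_mem = cg_mem[OF T]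

lemma V_re: "awalk u p w \<Longrightarrow> V u * re p * V w \<approx> re p * V w"
proof (induction p arbitrary: u)
  case Nil
  then show ?case by (auto simp: awalk_Nil_iff rel_VV)
next
  case (Cons e p)
  then have "e \<in> arcs E" "u = tail E e" by (auto simp: awalk_Cons_iff)
  with cT_mid[OF rel_Ve, of e 1 "re p * V w"] show ?case by (simp add: mult.assoc)
qed

lemma gho_V: "awalk u p w \<Longrightarrow> V w * gho p * V u \<approx> V w * gho p"
proof (induction p arbitrary: u)
  case Nil
  then show ?case by (auto simp: awalk_Nil_iff rel_VV)
next
  case (Cons e p)
  then have "e \<in> arcs E" "u = tail E e" by (auto simp: awalk_Cons_iff)
  with cT_mid[OF rel_gV, of e "V w * gho p" 1] show ?case by (simp add: mult.assoc)
qed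

lemma V_re0:
  assumes "awalk u p w" "v \<in> verts E" "v \<noteq> u"
  shows "V v * re p * V w \<in> T"
proof -
  have "u \<in> verts E" using assms(1) by (simp add: awalk_def)
  have "V v * V u * re p * V w \<in> T"
    using ts_rmult[OF T rel_VV0[OF assms(2) \<open>u \<in> verts E\<close> assms(3)], of "re p * V w"] by (simp add: mult.assoc)
  moreover have "V v * V u * re p * V w \<approx> V v * re p * V w"
    using cT_lmult[OF V_re[OF assms(1)], of "V v"] by (simp add: mult.assoc)
  ultimately show ?thesis using cT_mem by blast
qed

lemma gho_V0:
  assumes "awalk u p w" "v \<in> verts E" "v \<noteq> u"
  shows "V w * gho p * V v \<in> T"
proof -
  have "u \<in> verts E" using assms(1) by (simp add: awalk_def)
  have "V w * gho p * V u * V v \<in> T"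
    using ts_lmult[OF T rel_VV0[OF \<open>u \<in> verts E\<close> assms(2) assms(3)[symmetric]], of "V w * gho p"] by (simp add: mult.assoc)
  moreover have "V w * gho p * V u * V v \<approx> V w * gho p * V v"
    using cT_rmult[OF gho_V[OF assms(1)], of "V v"] by (simp add: mult.assoc)
  ultimately show ?thesis using cT_mem by blast
qed

lemma gho_re: "awalk u p w \<Longrightarrow> gho p * re p * V w \<approx> V w"
proof (induction p arbitrary: u)
  case Nil
  then show ?case by (auto simp: awalk_Nil_iff rel_VV)
next
  case (Cons e p)
  then have e: "e \<in> arcs E" and p: "awalk (head E e) p w" by (auto simp: awalk_Cons_iff)
  have "gho (e # p) * re (e # p) * V w \<approx> gho p * (V (head E e) * re p * V w)"
    using cT_mid[OF rel_ge[OF e], of "gho p" "re p * V w"] by (simp add: mult.assoc)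
  also have "\<dots> \<approx> gho p * (re p * V w)" by (rule cT_lmult[OF V_re[OF p]])
  also have "\<dots> \<approx> V w" using Cons.IH[OF p] by (simp add: mult.assoc)
  finally show ?case .
qed

lemma walk_app: "awalk u (p @ q) w \<longleftrightarrow> (\<exists>v. awalk u p v \<and> awalk v q w)"
proof (induction p arbitrary: u)
  case Nil
  then show ?case by (auto simp: awalk_Nil_iff dest: awalk_hd_in_verts)
qed (auto simp: awalk_Cons_iff)

lemma V_gho_re: "awalk u p w \<Longrightarrow> V w * gho p * re p * V w \<approx> V w"
  using cT_trans[OF cT_lmult[OF gho_re, of u p w "V w"] rel_VV[of w]]
  by (auto simp: mult.assoc dest: awalk_last_in_verts)

lemma gho_re_app:
  assumes "awalk u p w" "awalk w r z"
  shows "gho p * re (p @ r) * V z \<approx> re r * V z"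
proof -
  have "gho p * re (p @ r) * V z = gho p * re p * (re r * V z)" by (simp add: mult.assoc)
  also have "\<dots> \<approx> gho p * re p * (V w * re r * V z)"
    by (rule cT_lmult[OF cT_sym[OF V_re[OF assms(2)]]])
  also have "\<dots> = (gho p * re p * V w) * (re r * V z)" by (simp add: mult.assoc)
  also have "\<dots> \<approx> V w * (re r * V z)" by (rule cT_rmult[OF gho_re[OF assms(1)]])
  also have "\<dots> \<approx> re r * V z" using V_re[OF assms(2)] by (simp add: mult.assoc)
  finally show ?thesis .
qed

lemma gho_app_re:
  assumes "awalk u p w" "awalk w r z"
  shows "V z * gho (p @ r) * re p * V w \<approx> V z * gho r"
proof -
  have "V z * gho (p @ r) * re p * V w = V z * gho r * (gho p * re p * V w)" by (simp add: mult.assoc)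
  also have "\<dots> \<approx> V z * gho r * V w" by (rule cT_lmult[OF gho_re[OF assms(1)]])
  also have "\<dots> \<approx> V z * gho r" by (rule gho_V[OF assms(2)])
  finally show ?thesis .
qed

text \<open>Behind their longest common prefix the two paths continue with different edges
  \<open>e\<close> and \<open>f\<close>, and \<open>e* f\<close> is zero.\<close>

lemma gho_re_parallel:
  assumes "awalk u p w" "awalk u' q z" "p \<parallel> q"
  shows "V w * gho p * re q * V z \<in> T"
proof -
  obtain as e p' f q' where *: "e \<noteq> f" "p = as @ e # p'" "q = as @ f # q'"
    using parallel_decomp[OF assms(3)] by blast
  obtain v where v: "awalk u as v" "awalk v (e # p') w" using assms(1) * by (auto simp: walk_app)
  obtain v' where v': "awalk u' as v'" "awalk v' (f # q') z" using assms(2) * by (auto simp: walk_app)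
  have ef: "e \<in> arcs E" "f \<in> arcs E" "v' = tail E f" using v v' by (auto simp: awalk_Cons_iff)
  have "V w * gho p * re q * V z = V w * gho p' * gh e * (gho as * re as) * (ed f * re q' * V z)"
    by (simp add: * mult.assoc)
  \<comment> \<open>The vertex \<open>v'\<close> is inserted so that the common prefix
    \<open>as\<close> can be cancelled against its ghost.\<close>
  also have "\<dots> \<approx> V w * gho p' * gh e * (gho as * re as) * (V v' * ed f * re q' * V z)"
    using cT_lmult[OF cT_sym[OF V_re[OF v'(2)]], of "V w * gho p' * gh e * (gho as * re as)"] by (simp add: mult.assoc)
  also have "\<dots> = V w * gho p' * gh e * (gho as * re as * V v') * (ed f * re q' * V z)"
    by (simp add: mult.assoc)
  also have "\<dots> \<approx> V w * gho p' * gh e * V v' * (ed f * re q' * V z)"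
    by (rule cT_mid[OF gho_re[OF v'(1)]])
  also have "\<dots> = V w * gho p' * gh e * (V (tail E f) * ed f) * (re q' * V z)"
    by (simp add: mult.assoc ef)
  also have "\<dots> \<approx> V w * gho p' * gh e * (ed f) * (re q' * V z)"
    by (rule cT_mid[OF rel_Ve[OF ef(2)]])
  also have "\<dots> = (V w * gho p') * (gh e * ed f) * (re q' * V z)" by (simp add: mult.assoc)
  finally show ?thesis
    using ts_mid[OF T rel_ge0[OF ef(1,2) *(1)]] cT_mem by blast
qed

text \<open>A monomial records only the common range of its two paths; their sources are recovered
  when needed.\<close>

definition "wlk p w \<longleftrightarrow> (\<exists>u. awalk u p w)"

definition "Mons = {sc k * mnl p w q | k p w q. wlk p w \<and> wlk q w}"

end

text \<open>\<open>M\<close> stands for the algebra itself: it is spanned modulo \<open>T\<close> by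
  the monomials, and the ambient unit need not lie in it.\<close>

locale leavitt_family = leavitt_relations E V ed gh sc T
  for E :: "('v, 'e) pre_digraph" and V :: "'v \<Rightarrow> 'r::ring_1" and ed gh :: "'e \<Rightarrow> 'r"
    and sc :: "'k::field \<Rightarrow> 'r" and T :: "'r set" (structure) +
  fixes M :: "'r set"
  assumes M: "two_sided M" and T_le_M: "T \<subseteq> M" and M_eq: "M = asp (T \<union> Mons)"
begin

declare M [simp]

end

text \<open>The ring is not commutative, so the generators have to be tested with an arbitrary
  factor \<open>c\<close> between them.\<close>

lemma gen_mult:
  assumes "two_sided I" "\<And>x y c. x \<in> S \<Longrightarrow> y \<in> S' \<Longrightarrow> x * c * y \<in> I"
    "a \<in> gen_ideal S" "b \<in> gen_ideal S'"
  shows "a * b \<in> I"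
proof -
  have 1: "c * x * d * b \<in> I" if "x \<in> S" for c x d
    using assms(4) unfolding gen_ideal_def
  proof (induction rule: asp.induct)
    case zero
    then show ?case by (simp add: ts_zero assms(1))
  next
    case (step z y)
    then obtain a' z' b' where "z = a' * z' * b'" "z' \<in> S'" by blast
    then have "c * x * d * z = c * (x * (d * a') * z') * b'" by (simp add: mult.assoc)
    also have "\<dots> \<in> I" by (intro ts_mid[OF assms(1)] assms(2) that \<open>z' \<in> S'\<close>)
    finally show ?case using step.IH by (simp add: distrib_left ts_add assms(1))
  qed
  show ?thesis
    using assms(3) unfolding gen_ideal_def
  proof (induction rule: asp.induct)
    case zero
    then show ?case by (simp add: ts_zero assms(1))
  next
    case (step z y)
    then have "z * b \<in> I" using 1 by blast
    with step.IH show ?case by (simp add: distrib_right ts_add assms(1))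
  qed
qed

section \<open>Diagonal idempotents and local units\<close>

context leavitt_family
begin

lemma wlk_verts: "wlk p w \<Longrightarrow> w \<in> verts E"
  by (auto simp: wlk_def)

lemma wlk_Nil [simp]: "wlk [] w \<longleftrightarrow> w \<in> verts E"
  by (auto simp: wlk_def awalk_Nil_iff)

lemma wlk_app: "wlk p w \<Longrightarrow> awalk w r z \<Longrightarrow> wlk (p @ r) z"
  by (auto simp: wlk_def walk_app)

lemma awalk_wlk: "awalk u p w \<Longrightarrow> wlk p w"
  by (auto simp: wlk_def)

text \<open>Nonemptiness matters: the empty word is a walk at every vertex.\<close>

lemma awalk_end_unique: "awalk u p w \<Longrightarrow> awalk u' p w' \<Longrightarrow> p \<noteq> [] \<Longrightarrow> w = w'"
  by (induction p arbitrary: u u') (fastforce simp: awalk_Cons_iff awalk_Nil_iff)+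

lemma sc_zero [simp]: "sc 0 = 0"
  using sc_add[of 0 0] by simp

lemma sc_left: "a * (sc k * b) = sc k * (a * b)"
  by (metis mult.assoc sc_central)

lemma sc_uminus: "sc (- k) = - sc k"
  using sc_add[of k "- k"] by (simp add: eq_neg_iff_add_eq_0 add.commute)

lemma sc_inverse: "k \<noteq> 0 \<Longrightarrow> sc (inverse k) * sc k = 1"
  by (metis left_inverse sc_mult sc_one)

lemma sc_mem: assumes "two_sided I" "k \<noteq> 0" "sc k * x \<in> I" shows "x \<in> I"
  using ts_lmult[OF assms(1,3), of "sc (inverse k)"] sc_inverse[OF assms(2)]
  by (simp add: mult.assoc[symmetric])

text \<open>The zero case absorbs two situations: incomparable words, and an empty word sitting at a
  vertex other than the source of the other walk. Comparability of words alone does not exclude the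
  second.\<close>

lemma walk_cases:
  assumes "wlk p w" "wlk q z"
  obtains (zero) "V w * gho p * re q * V z \<in> T" "V z * gho q * re p * V w \<in> T"
  | (pre) r where "q = p @ r" "awalk w r z"
  | (ext) r where "p = q @ r" "awalk z r w"
proof -
  obtain u u' where u: "awalk u p w" "awalk u' q z" using assms by (auto simp: wlk_def)
  have pre: thesis if pre: "awalk u p w" "awalk u' (p @ r) z" "q = p @ r"
    and zero: "V w * gho p * re q * V z \<in> T \<Longrightarrow> V z * gho q * re p * V w \<in> T \<Longrightarrow> thesis"
    and c: "\<And>r. q = p @ r \<Longrightarrow> awalk w r z \<Longrightarrow> thesis"
    for thesis p q u w u' z r
  proof -
    obtain x where x: "awalk u' p x" "awalk x r z" using pre by (auto simp: walk_app)
    show thesis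
    proof (cases "x = w")
      case True
      then show ?thesis using c x pre by blast
    next
      case False
      then have [simp]: "p = []" using awalk_end_unique[OF x(1) pre(1)] by blast
      have "w \<in> verts E" using pre by auto
      then show ?thesis using zero[unfolded pre] V_re0[OF x(2)] gho_V0[OF x(2)] False by auto
    qed
  qed
  consider "p \<parallel> q" | r where "q = p @ r" | r where "p = q @ r"
    by (metis parallel_def prefix_def)
  then show ?thesis
  proof cases
    case 1
    then show ?thesis using that(1) gho_re_parallel[OF u] gho_re_parallel[OF u(2,1)] parallel_commute by blast
  next
    case (2 r)
    show ?thesis by (rule pre[of u p w u' r z q]) (use 2 u that in auto)
  next
    case (3 r)
    show ?thesis by (rule pre[of u' q z u r w p]) (use 3 u that in auto)
  qed
qed

lemma gho_re_pre: "wlk p w \<Longrightarrow> awalk w r z \<Longrightarrow> V w * gho p * re (p @ r) * V z \<approx> re r * V z"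
  using cT_trans[OF cT_lmult[OF gho_re_app, of _ p w r z "V w"] V_re[of w r z, folded mult.assoc, unfolded mult.assoc]]
  by (auto simp: mult.assoc wlk_def)

lemma gho_re_ext: "wlk p w \<Longrightarrow> awalk w r z \<Longrightarrow> V z * gho (p @ r) * re p * V w \<approx> V z * gho r"
  using gho_app_re by (fastforce simp: wlk_def simp del: gho_simps)

lemma mnl_mult_same:
  assumes "wlk q w" shows "mnl p w q * mnl q w r \<approx> mnl p w r"
proof -
  have "mnl p w q * mnl q w r = re p * (V w * gho q * re (q @ []) * V w) * gho r"
    by (simp add: mnl_def mult.assoc)
  also have "\<dots> \<approx> re p * (re [] * V w) * gho r"
    by (rule cT_mid[OF gho_re_pre[OF assms]]) (use assms in \<open>auto simp: awalk_Nil_iff wlk_verts\<close>)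
  finally show ?thesis by (simp add: mnl_def)
qed

lemma mnl_mult_pre:
  assumes "wlk q w" "awalk w r w'" shows "mnl p w q * mnl (q @ r) w' s \<approx> mnl (p @ r) w' s"
proof -
  have *: "V w * V w \<approx> V w" using assms by (auto simp: rel_VV wlk_verts)
  have "mnl p w q * mnl (q @ r) w' s = re p * (V w * gho q * re (q @ r) * V w') * gho s"
    by (simp add: mnl_def mult.assoc)
  also have "\<dots> \<approx> re p * (re r * V w') * gho s" by (rule cT_mid[OF gho_re_pre[OF assms]])
  finally show ?thesis by (simp add: mnl_def mult.assoc)
qed

lemma mnl_mult_ext:
  assumes "wlk p w" "awalk w r w'" shows "mnl s w' (p @ r) * mnl p w q \<approx> mnl s w' (q @ r)"
proof -
  have "mnl s w' (p @ r) * mnl p w q = re s * (V w' * gho (p @ r) * re p * V w) * gho q"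
    by (simp add: mnl_def mult.assoc)
  also have "\<dots> \<approx> re s * (V w' * gho r) * gho q" by (rule cT_mid[OF gho_re_ext[OF assms]])
  finally show ?thesis by (simp add: mnl_def mult.assoc)
qed

lemma mnl_mult_zero: "V w * gho q * re p * V z \<in> T \<Longrightarrow> mnl s w q * mnl p z r \<in> T"
  using ts_mid[OF T, of "V w * gho q * re p * V z" "re s" "gho r"] by (simp add: mnl_def mult.assoc)

lemma mnl_M: "wlk p w \<Longrightarrow> wlk q w \<Longrightarrow> mnl p w q \<in> M"
  unfolding M_eq Mons_def by (intro asp_base UnI2 CollectI exI[of _ 1] exI[of _ p] exI[of _ w] exI[of _ q]) (simp add: sc_one)

lemma V_M: "v \<in> verts E \<Longrightarrow> V v \<in> M"
  using mnl_M[of "[]" v "[]"] by (simp add: mnl_def)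

text \<open>Including \<open>T\<close> makes \<open>D\<close> closed under congruence modulo
  \<open>T\<close>.\<close>

definition "D = asp (T \<union> {sc k * mnl p w p | k p w. wlk p w})"

lemma T_D: "T \<subseteq> D" unfolding D_def using asp_base by blast

lemma D_add: "x \<in> D \<Longrightarrow> y \<in> D \<Longrightarrow> x + y \<in> D" unfolding D_def by (rule asp_add)

lemma D_sc: "x \<in> D \<Longrightarrow> sc k * x \<in> D" unfolding D_def
proof (erule asp_lmult, elim UnE)
  fix y assume "y \<in> T"
  then show "sc k * y \<in> asp (T \<union> {sc k * mnl p w p |k p w. wlk p w})"
    by (intro asp_base) (simp add: ts_lmult)
next
  fix y assume "y \<in> {sc k * mnl p w p |k p w. wlk p w}"
  then obtain k' p w where "y = sc k' * mnl p w p" "wlk p w" by blast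
  then have "sc k * y = sc (k * k') * mnl p w p" "wlk p w" by (simp_all add: sc_mult mult.assoc)
  then show "sc k * y \<in> asp (T \<union> {sc k * mnl p w p |k p w. wlk p w})"
    by (intro asp_base) blast
qed

lemma D_uminus: "x \<in> D \<Longrightarrow> - x \<in> D"
  using D_sc[of x "-1"] by (simp add: sc_uminus sc_one)

lemma D_diff: "x \<in> D \<Longrightarrow> y \<in> D \<Longrightarrow> x - y \<in> D"
  using D_add[of x "- y"] D_uminus[of y] by simp

lemma D_sum: "(\<And>i. i \<in> S \<Longrightarrow> f i \<in> D) \<Longrightarrow> sum f S \<in> D"
  unfolding D_def by (rule asp_sum)

lemma D_cg: "x \<approx> y \<Longrightarrow> y \<in> D \<Longrightarrow> x \<in> D"
  using D_add[of "x - y" y] T_D by (auto simp: cg_def)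

lemma mnl_D: "wlk p w \<Longrightarrow> mnl p w p \<in> D"
  unfolding D_def by (intro asp_base UnI2 CollectI exI[of _ 1] exI[of _ p] exI[of _ w]) (simp add: sc_one)

lemma D_induct [consumes 1, case_names rel mnl add]:
  assumes "x \<in> D" "\<And>t. t \<in> T \<Longrightarrow> P t" "\<And>k p w. wlk p w \<Longrightarrow> P (sc k * mnl p w p)"
    "\<And>x y. x \<in> D \<Longrightarrow> y \<in> D \<Longrightarrow> P x \<Longrightarrow> P y \<Longrightarrow> P (x + y)"
  shows "P x"
proof -
  have "x \<in> D \<and> P x"
    using assms(1) unfolding D_def
  proof (rule asp_least[of _ _ "{x \<in> D. P x}", unfolded mem_Collect_eq D_def])
    show "0 \<in> asp (T \<union> {sc k * mnl p w p |k p w. wlk p w}) \<and> P 0"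
      using assms(2) ts_zero[OF T] by (auto intro: asp.zero)
    show "T \<union> {sc k * mnl p w p |k p w. wlk p w}
      \<subseteq> {x \<in> asp (T \<union> {sc k * mnl p w p |k p w. wlk p w}). P x}"
      using assms(2,3) by (auto intro!: asp_base)
  qed (use assms(4) asp_add in \<open>auto simp: D_def\<close>)
  then show ?thesis ..
qed

lemma D_M: "D \<subseteq> M"
proof
  fix x assume "x \<in> D" then show "x \<in> M"
    by (induction rule: D_induct) (use T_le_M in \<open>auto intro: ts_lmult mnl_M ts_add\<close>)
qed

text \<open>For comparable paths the product of \<open>p p*\<close> and \<open>q q*\<close> is, in
  either order, the monomial of the longer path; otherwise it is zero.\<close>

lemma mnl_commute:
  assumes "wlk p w" "wlk q z"
  shows "mnl p w p * mnl q z q \<in> D" "mnl p w p * mnl q z q \<approx> mnl q z q * mnl p w p"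
  using assms
proof (atomize (full), cases rule: walk_cases)
  case zero
  then show "mnl p w p * mnl q z q \<in> D \<and> mnl p w p * mnl q z q \<approx> mnl q z q * mnl p w p"
    using mnl_mult_zero T_D by (auto simp: cg_def intro!: ts_diff)
next
  case (pre r)
  then show "mnl p w p * mnl q z q \<in> D \<and> mnl p w p * mnl q z q \<approx> mnl q z q * mnl p w p"
    using mnl_mult_pre[OF assms(1), of r z p q] mnl_mult_ext[OF assms(1), of r z q p] mnl_D[OF assms(2)]
    by (auto intro: D_cg cT_trans[OF _ cT_sym])
next
  case (ext r)
  then show "mnl p w p * mnl q z q \<in> D \<and> mnl p w p * mnl q z q \<approx> mnl q z q * mnl p w p"
    using mnl_mult_pre[OF assms(2), of r w q p] mnl_mult_ext[OF assms(2), of r w p q] mnl_D[OF assms(1)]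
    by (auto intro: D_cg cT_trans[OF _ cT_sym])
qed

lemma D_mult_commute:
  assumes "x \<in> D" "y \<in> D" shows "x * y \<in> D \<and> x * y \<approx> y * x"
  using assms(1)
proof (induction rule: D_induct)
  case (rel t)
  then show ?case using T_D by (auto simp: cg_def ts_diff[OF T] ts_lmult[OF T] ts_rmult[OF T])
next
  case (mnl k p w)
  have "mnl p w p * y \<in> D \<and> mnl p w p * y \<approx> y * mnl p w p"
    using assms(2)
  proof (induction rule: D_induct)
    case (rel t)
    then show ?case using T_D by (auto simp: cg_def ts_diff[OF T] ts_lmult[OF T] ts_rmult[OF T])
  next
    case (mnl j q z)
    then have "sc j * (mnl p w p * mnl q z q) \<in> D"
      "sc j * (mnl p w p * mnl q z q) \<approx> sc j * (mnl q z q * mnl p w p)"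
      using mnl_commute \<open>wlk p w\<close> by (blast intro: D_sc cT_lmult)+
    then show ?case by (simp add: sc_left mult.assoc)
  qed (auto simp: distrib_left distrib_right intro: D_add cT_add)
  then have "sc k * (mnl p w p * y) \<in> D" "sc k * (mnl p w p * y) \<approx> sc k * (y * mnl p w p)"
    by (blast intro: D_sc cT_lmult)+
  then show ?case by (simp add: sc_left mult.assoc)
qed (auto simp: distrib_left distrib_right intro: D_add cT_add)

lemmas D_mult = D_mult_commute[THEN conjunct1] and D_commute = D_mult_commute[THEN conjunct2]

text \<open>Monomials normalize the diagonal: \<open>p q*\<close> carries \<open>r r*\<close> to
  another diagonal monomial or to zero. This keeps the local units constructed below inside the
  commutative part.\<close>

lemma D_conj:
  assumes "x \<in> D" "wlk p w" "wlk q w"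
  shows "mnl p w q * x * mnl q w p \<in> D"
  using assms(1)
proof (induction rule: D_induct)
  case (rel t)
  then show ?case using T_D ts_mid[OF T] by blast
next
  case (mnl k r z)
  have "mnl p w q * mnl r z r * mnl q w p \<in> D"
    using assms(3) mnl
  proof (cases rule: walk_cases)
    case zero
    then show ?thesis using mnl_mult_zero[of w q r z p r] T_D ts_rmult[OF T] by blast
  next
    case (pre s)
    have "mnl p w q * mnl r z r * mnl q w p \<approx> mnl (p @ s) z r * mnl q w p"
      using cT_rmult[OF mnl_mult_pre[OF assms(3), of s z p r]] pre by simp
    also have "\<dots> \<approx> mnl (p @ s) z (p @ s)"
      using mnl_mult_ext[OF assms(3), of s z "p @ s" p] pre by simp
    finally show ?thesis
      by (rule D_cg) (intro mnl_D wlk_app[OF assms(2) pre(2)])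
  next
    case (ext s)
    have "mnl p w q * mnl r z r * mnl q w p \<approx> mnl p w q * mnl q w p"
      using cT_rmult[OF mnl_mult_ext[OF mnl, of s w p r]] ext by simp
    also have "\<dots> \<approx> mnl p w p" by (rule mnl_mult_same[OF assms(3)])
    finally show ?thesis by (rule D_cg) (intro mnl_D assms)
  qed
  then show ?case using D_sc by (metis sc_left mult.assoc)
qed (auto simp: distrib_left distrib_right intro: D_add)

definition "DId = {d \<in> D. d * d \<approx> d}"

lemma mnl_DId: "wlk p w \<Longrightarrow> mnl p w p \<in> DId"
  unfolding DId_def using mnl_D mnl_mult_same by blast

lemma V_DId: "v \<in> verts E \<Longrightarrow> V v \<in> DId"
  using mnl_DId[of "[]" v] by (simp add: mnl_def)

lemma DId_D: "d \<in> DId \<Longrightarrow> d \<in> D" and DId_idem: "d \<in> DId \<Longrightarrow> d * d \<approx> d"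
  by (auto simp: DId_def)

lemma DId_M: "d \<in> DId \<Longrightarrow> d \<in> M"
  using DId_D D_M by blast

text \<open>\<open>q q*\<close> lies in \<open>D\<close> and so commutes with \<open>d\<close>.
  Hence the conjugate \<open>p q* d q p*\<close> is a diagonal left unit for every element of the
  form \<open>p q* d b\<close>.\<close>

lemma DId_left_unit:
  assumes "d \<in> DId" "wlk p w" "wlk q w"
  shows "(mnl p w q * d * mnl q w p) * (mnl p w q * d) \<approx> mnl p w q * d"
proof -
  have "(mnl p w q * d * mnl q w p) * (mnl p w q * d) = mnl p w q * d * (mnl q w p * mnl p w q) * d"
    by (simp add: mult.assoc)
  also have "\<dots> \<approx> mnl p w q * d * mnl q w q * d"
    by (rule cT_mid[OF mnl_mult_same[OF assms(2)]])
  also have "\<dots> = mnl p w q * (d * mnl q w q) * d" by (simp add: mult.assoc)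
  also have "\<dots> \<approx> mnl p w q * (mnl q w q * d) * d"
    by (rule cT_mid[OF D_commute[OF DId_D[OF assms(1)] mnl_D[OF assms(3)]]])
  also have "\<dots> = (mnl p w q * mnl q w q) * (d * d)" by (simp add: mult.assoc)
  also have "\<dots> \<approx> mnl p w q * d"
    by (rule cT_mult[OF mnl_mult_same[OF assms(3)] DId_idem[OF assms(1)]])
  finally show ?thesis .
qed

lemma DId_right_unit:
  assumes "d \<in> DId" "wlk p w" "wlk q w"
  shows "(d * mnl q w p) * (mnl p w q * d * mnl q w p) \<approx> d * mnl q w p"
proof -
  have "(d * mnl q w p) * (mnl p w q * d * mnl q w p) = d * (mnl q w p * mnl p w q) * (d * mnl q w p)"
    by (simp add: mult.assoc)
  also have "\<dots> \<approx> d * mnl q w q * (d * mnl q w p)"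
    by (rule cT_mid[OF mnl_mult_same[OF assms(2)]])
  also have "\<dots> = d * (mnl q w q * d) * mnl q w p" by (simp add: mult.assoc)
  also have "\<dots> \<approx> d * (d * mnl q w q) * mnl q w p"
    by (rule cT_mid[OF D_commute[OF mnl_D[OF assms(3)] DId_D[OF assms(1)]]])
  also have "\<dots> = (d * d) * (mnl q w q * mnl q w p)" by (simp add: mult.assoc)
  also have "\<dots> \<approx> d * mnl q w p"
    by (rule cT_mult[OF DId_idem[OF assms(1)] mnl_mult_same[OF assms(3)]])
  finally show ?thesis .
qed

text \<open>\<open>x + y - x * y\<close> is \<open>1 - (1 - x) * (1 - y)\<close>; as
  \<open>x\<close> and \<open>y\<close> commute modulo \<open>T\<close>, it fixes whatever one of
  them fixes.\<close>

lemma join_left: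
  assumes "x \<in> D" "y \<in> D" "x * z \<approx> z \<or> y * z \<approx> z"
  shows "(x + y - x * y) * z \<approx> z"
  using assms(3)
proof
  assume xz: "x * z \<approx> z"
  have "x * y * z \<approx> y * x * z" by (rule cT_rmult[OF D_commute[OF assms(1,2)]])
  also have "\<dots> \<approx> y * z" using cT_lmult[OF xz, of y] by (simp add: mult.assoc)
  finally have "x * z + y * z - x * y * z \<approx> z + y * z - y * z"
    by (intro cg_diff cT_add xz) auto
  then show ?thesis by (simp add: algebra_simps)
next
  assume yz: "y * z \<approx> z"
  then have "x * y * z \<approx> x * z" using cT_lmult[OF yz, of x] by (simp add: mult.assoc)
  then have "x * z + y * z - x * y * z \<approx> x * z + z - x * z"
    by (intro cg_diff cT_add yz) auto
  then show ?thesis by (simp add: algebra_simps)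
qed

lemma join_right:
  assumes "x \<in> D" "y \<in> D" "z * x \<approx> z \<or> z * y \<approx> z"
  shows "z * (x + y - x * y) \<approx> z"
  using assms(3)
proof
  assume zx: "z * x \<approx> z"
  then have "z * x * y \<approx> z * y" by (rule cT_rmult)
  then have "z * x + z * y - z * x * y \<approx> z + z * y - z * y"
    by (intro cg_diff cT_add zx) auto
  then show ?thesis by (simp add: algebra_simps)
next
  assume zy: "z * y \<approx> z"
  have "z * (x * y) \<approx> z * (y * x)" by (rule cT_lmult[OF D_commute[OF assms(1,2)]])
  also have "\<dots> \<approx> z * x" using cT_rmult[OF zy, of x] by (simp add: mult.assoc)
  finally have "z * x + z * y - z * (x * y) \<approx> z * x + z - z * x"
    by (intro cg_diff cT_add zy) auto
  then show ?thesis by (simp add: algebra_simps)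
qed

text \<open>Idempotency gives \<open>a x b = (a x) (x b)\<close>, and \<open>a x\<close> lies in
  \<open>M\<close> even if \<open>a\<close> does not. Expanding \<open>a x\<close> into monomials
  leaves a factor \<open>x\<close> to the right of each of them.\<close>

lemma D_ideal_left:
  assumes "W \<subseteq> DId" "a \<in> gen_ideal (T \<union> W)"
  shows "a \<in> asp (T \<union> {mnl p w q * d * b | p w q d b. wlk p w \<and> wlk q w \<and> d \<in> W})" (is "_ \<in> asp ?S")
  using assms(2) unfolding gen_ideal_def
proof (rule asp_least)
  have "a * x * b \<in> asp ?S" if x: "x \<in> W" for a x b
  proof -
    have *: "x \<in> M" "x * x \<approx> x" using x assms(1) DId_M DId_idem by auto
    have "a * x \<in> asp (T \<union> Mons)" using * by (simp add: M_eq[symmetric] ts_lmult)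
    then have "a * x * (x * b) \<in> asp ?S"
    proof (rule asp_rmult, elim UnE)
      fix y assume "y \<in> T" then show "y * (x * b) \<in> asp ?S" by (intro asp_base) (simp add: ts_rmult)
    next
      fix y assume "y \<in> Mons"
      then obtain k p w q where y: "y = sc k * mnl p w q" "wlk p w" "wlk q w" by (auto simp: Mons_def)
      have "y * (x * b) = mnl p w q * x * (sc k * b)" by (simp add: y sc_left mult.assoc)
      then show "y * (x * b) \<in> asp ?S" using x y by (intro asp_base) blast
    qed
    moreover have "a * x * b - a * x * (x * b) \<in> asp ?S"
      using cT_mid[OF cT_sym[OF *(2)], of a b] by (intro asp_base) (simp add: cg_def mult.assoc)
    ultimately have "a * x * b - a * x * (x * b) + a * x * (x * b) \<in> asp ?S" by (intro asp_add)
    then show "a * x * b \<in> asp ?S" by simp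
  qed
  moreover have "a * x * b \<in> asp ?S" if "x \<in> T" for a x b
    using that by (intro asp_base) (simp add: ts_mid)
  ultimately show "{a * x * b |a x b. x \<in> T \<union> W} \<subseteq> asp ?S" by blast
qed (auto intro: asp.zero asp_add)

lemma D_ideal_right:
  assumes "W \<subseteq> DId" "a \<in> gen_ideal (T \<union> W)"
  shows "a \<in> asp (T \<union> {b * d * mnl q w p | p w q d b. wlk p w \<and> wlk q w \<and> d \<in> W})" (is "_ \<in> asp ?S")
  using assms(2) unfolding gen_ideal_def
proof (rule asp_least)
  have "a * x * b \<in> asp ?S" if x: "x \<in> W" for a x b
  proof -
    have *: "x \<in> M" "x * x \<approx> x" using x assms(1) DId_M DId_idem by auto
    have "x * b \<in> asp (T \<union> Mons)" using * by (simp add: M_eq[symmetric] ts_rmult)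
    then have "(a * x) * (x * b) \<in> asp ?S"
    proof (rule asp_lmult, elim UnE)
      fix y assume "y \<in> T" then show "(a * x) * y \<in> asp ?S" by (intro asp_base) (simp add: ts_lmult)
    next
      fix y assume "y \<in> Mons"
      then obtain k p w q where y: "y = sc k * mnl q w p" "wlk p w" "wlk q w" by (auto simp: Mons_def)
      have "(a * x) * y = (sc k * a) * x * mnl q w p" by (simp add: y sc_left mult.assoc)
      then show "(a * x) * y \<in> asp ?S" using x y by (intro asp_base) blast
    qed
    moreover have "a * x * b - a * x * (x * b) \<in> asp ?S"
      using cT_mid[OF cT_sym[OF *(2)], of a b] by (intro asp_base) (simp add: cg_def mult.assoc)
    ultimately have "a * x * b - a * x * (x * b) + a * x * (x * b) \<in> asp ?S" by (intro asp_add)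
    then show "a * x * b \<in> asp ?S" by simp
  qed
  moreover have "a * x * b \<in> asp ?S" if "x \<in> T" for a x b
    using that by (intro asp_base) (simp add: ts_mid)
  ultimately show "{a * x * b |a x b. x \<in> T \<union> W} \<subseteq> asp ?S" by blast
qed (auto intro: asp.zero asp_add)

text \<open>One diagonal unit per summand is joined to the unit found so far. The starting element
  \<open>u0\<close> is carried along with everything it fixes, which later gives a common unit for
  two elements.\<close>

lemma s_unital_left_aux:
  assumes "W \<subseteq> DId" "x \<in> gen_ideal (T \<union> W)" "u0 \<in> D \<inter> gen_ideal (T \<union> W)"
  shows "\<exists>u \<in> D \<inter> gen_ideal (T \<union> W). (\<forall>z. u0 * z \<approx> z \<longrightarrow> u * z \<approx> z) \<and> u * x \<approx> x"
  using D_ideal_left[OF assms(1,2)] assms(3)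
proof (induction arbitrary: u0 rule: asp.induct)
  case zero
  then show ?case by (auto simp: ts_zero cg_zero)
next
  case (step y x)
  let ?J = "gen_ideal (T \<union> W)"
  obtain d where d: "d \<in> D \<inter> ?J" "d * y \<approx> y"
    using step.hyps(1)
  proof (elim UnE, goal_cases)
    case 1
    moreover have "0 \<in> D \<inter> ?J" using T_D ts_zero[OF T] by (auto simp: ts_zero[OF two_sided_gen])
    ultimately show ?case using 1(1)[of 0] by (simp add: cg_def ts_uminus)
  next
    case 2
    then obtain p w q d b where y: "y = mnl p w q * d * b" "wlk p w" "wlk q w" "d \<in> W" by blast
    let ?d = "mnl p w q * d * mnl q w p"
    have dI: "d \<in> DId" using y assms(1) by blast
    have "?d \<in> D \<inter> ?J" using y dI by (simp add: D_conj DId_D ts_mid[OF two_sided_gen] gen_base)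
    moreover have "?d * y \<approx> y" unfolding y(1) using cT_rmult[OF DId_left_unit[OF dI y(2,3)], of b] by (simp add: mult.assoc)
    ultimately show ?case using 2(1) by blast
  qed
  let ?u1 = "u0 + d - u0 * d"
  have u1: "?u1 \<in> D \<inter> ?J" using d step.prems
    by (simp add: D_diff D_add D_mult ts_diff ts_add ts_lmult two_sided_gen)
  obtain u where u: "u \<in> D \<inter> ?J" "\<forall>z. ?u1 * z \<approx> z \<longrightarrow> u * z \<approx> z" "u * x \<approx> x"
    using step.IH[OF u1] by blast
  have "u * y \<approx> y" using u(2) join_left[of u0 d y] d step.prems by blast
  then have "u * (y + x) \<approx> y + x" using u(3) by (simp add: distrib_left cT_add)
  moreover have "u * z \<approx> z" if "u0 * z \<approx> z" for z
    using u(2) join_left[of u0 d z] d step.prems that by blast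
  ultimately show ?case using u(1) by blast
qed

lemma s_unital_right_aux:
  assumes "W \<subseteq> DId" "x \<in> gen_ideal (T \<union> W)" "u0 \<in> D \<inter> gen_ideal (T \<union> W)"
  shows "\<exists>u \<in> D \<inter> gen_ideal (T \<union> W). (\<forall>z. z * u0 \<approx> z \<longrightarrow> z * u \<approx> z) \<and> x * u \<approx> x"
  using D_ideal_right[OF assms(1,2)] assms(3)
proof (induction arbitrary: u0 rule: asp.induct)
  case zero
  then show ?case by (auto simp: ts_zero cg_zero)
next
  case (step y x)
  let ?J = "gen_ideal (T \<union> W)"
  obtain d where d: "d \<in> D \<inter> ?J" "y * d \<approx> y"
    using step.hyps(1)
  proof (elim UnE, goal_cases)
    case 1
    moreover have "0 \<in> D \<inter> ?J" using T_D ts_zero[OF T] by (auto simp: ts_zero[OF two_sided_gen])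
    ultimately show ?case using 1(1)[of 0] by (simp add: cg_def ts_uminus)
  next
    case 2
    then obtain p w q d b where y: "y = b * d * mnl q w p" "wlk p w" "wlk q w" "d \<in> W" by blast
    let ?d = "mnl p w q * d * mnl q w p"
    have dI: "d \<in> DId" using y assms(1) by blast
    have "?d \<in> D \<inter> ?J" using y dI by (simp add: D_conj DId_D ts_mid[OF two_sided_gen] gen_base)
    moreover have "y * ?d \<approx> y" unfolding y(1) using cT_lmult[OF DId_right_unit[OF dI y(2,3)], of b] by (simp add: mult.assoc)
    ultimately show ?case using 2(1) by blast
  qed
  let ?u1 = "u0 + d - u0 * d"
  have u1: "?u1 \<in> D \<inter> ?J" using d step.prems
    by (simp add: D_diff D_add D_mult ts_diff ts_add ts_lmult two_sided_gen)
  obtain u where u: "u \<in> D \<inter> ?J" "\<forall>z. z * ?u1 \<approx> z \<longrightarrow> z * u \<approx> z" "x * u \<approx> x"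
    using step.IH[OF u1] by blast
  have "y * u \<approx> y" using u(2) join_right[of u0 d y] d step.prems by blast
  then have "(y + x) * u \<approx> y + x" using u(3) by (simp add: distrib_right cT_add)
  moreover have "z * u \<approx> z" if "z * u0 \<approx> z" for z
    using u(2) join_right[of u0 d z] d step.prems that by blast
  ultimately show ?case using u(1) by blast
qed

lemma zero_D_gen: "0 \<in> D \<inter> gen_ideal S"
  using T_D ts_zero[OF T] by (auto simp: ts_zero[OF two_sided_gen])

lemma s_unital_left:
  assumes "W \<subseteq> DId" "x \<in> gen_ideal (T \<union> W)" "y \<in> gen_ideal (T \<union> W)"
  obtains u where "u \<in> gen_ideal (T \<union> W)" "u * x \<approx> x" "u * y \<approx> y"
  using s_unital_left_aux[OF assms(1,2) zero_D_gen] s_unital_left_aux[OF assms(1,3)] by blast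

lemma s_unital_right:
  assumes "W \<subseteq> DId" "x \<in> gen_ideal (T \<union> W)"
  obtains u where "u \<in> gen_ideal (T \<union> W)" "x * u \<approx> x"
  using s_unital_right_aux[OF assms(1,2) zero_D_gen] by blast

section \<open>Admissible ideals, and how irreducible ones treat diagonal idempotents\<close>

definition "adm I \<longleftrightarrow> two_sided I \<and> T \<subseteq> I \<and> I \<subseteq> M"

definition "irr I \<longleftrightarrow> adm I \<and> (\<forall>A B. adm A \<longrightarrow> adm B \<longrightarrow> A \<inter> B = I \<longrightarrow> A = I \<or> B = I)"

lemma adm_gen: "T \<subseteq> S \<Longrightarrow> S \<subseteq> M \<Longrightarrow> adm (gen_ideal S)"
  by (auto simp: adm_def two_sided_gen gen_base dest: gen_least[OF M])

lemma adm_sum: "adm A \<Longrightarrow> adm B \<Longrightarrow> adm (ideal_sum A B)"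
  unfolding adm_def using two_sided_ideal_sum ideal_sum_left[of B A] ideal_sum_least[OF M] by blast

text \<open>If \<open>d a z\<close> were in \<open>I\<close> for all \<open>a\<close>, the ideal of
  \<open>d\<close> would multiply \<open>I + (z)\<close> into \<open>I\<close>. Its local units turn
  this product into the intersection of \<open>I + (d)\<close> with \<open>I + (z)\<close>, which
  would then be \<open>I\<close>, against irreducibility.\<close>

lemma irr_corner:
  assumes "irr I" "d \<in> DId" "d \<notin> I" "z \<in> M" "z \<notin> I"
  shows "\<exists>a. d * a * z \<notin> I" "\<exists>a. z * a * d \<notin> I"
proof -
  have I: "two_sided I" "T \<subseteq> I" "I \<subseteq> M" using assms(1) by (auto simp: irr_def adm_def)
  let ?G = "gen_ideal (T \<union> {d})"
  let ?A = "ideal_sum I ?G" and ?B = "gen_ideal (I \<union> {z})"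
  have G: "adm ?G" using DId_M[OF assms(2)] T_le_M by (intro adm_gen) auto
  have A: "adm ?A" using G assms(1) by (intro adm_sum) (auto simp: irr_def)
  have B: "adm ?B" using I assms(4) by (intro adm_gen) auto
  have dA: "d \<in> ?A" using ideal_sum_right[OF I(1), of ?G] gen_base[of d "T \<union> {d}"] by blast
  have zB: "z \<in> ?B" "I \<subseteq> ?B" by (auto intro: gen_base)
  have IA: "I \<subseteq> ?A" using ideal_sum_left[of ?G I] G by (auto simp: adm_def)
  have neq: "\<not> ?A \<inter> ?B \<subseteq> I"
  proof
    assume "?A \<inter> ?B \<subseteq> I"
    then have "?A \<inter> ?B = I" using zB(2) IA by blast
    then have "?A = I \<or> ?B = I" using assms(1) A B unfolding irr_def by blast
    then show False using dA zB assms by blast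
  qed
  show "\<exists>a. d * a * z \<notin> I"
  proof (rule ccontr)
    assume "\<nexists>a. d * a * z \<notin> I"
    then have *: "d * a * z \<in> I" for a by blast
    have GB: "u * x \<in> I" if "u \<in> ?G" "x \<in> ?B" for u x
      by (rule gen_mult[OF I(1) _ that]) (use * I in \<open>auto intro: ts_mid ts_lmult ts_rmult\<close>)
    have "?A \<inter> ?B \<subseteq> I"
    proof
      fix x assume x: "x \<in> ?A \<inter> ?B"
      then obtain i y where iy: "x = i + y" "i \<in> I" "y \<in> ?G" by (auto simp: ideal_sum_def)
      obtain u where u: "u \<in> ?G" "u * y \<approx> y" using s_unital_left[of "{d}" y y] iy assms(2) by blast
      \<comment> \<open>\<open>u\<close> is a unit only for the part \<open>y\<close> of
        \<open>x\<close>, but the rest differs from \<open>u * x\<close> by elements of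
        \<open>I\<close>.\<close>
      have "u * x \<in> I" using GB u x by blast
      moreover have "u * y - y \<in> I" using u I by (auto simp: cg_def)
      then have "u * x + (i - u * i - (u * y - y)) \<in> I" if "u * x \<in> I"
        using that iy by (simp add: ts_diff ts_lmult ts_add I(1))
      moreover have "u * x + (i - u * i - (u * y - y)) = x" using iy by (simp add: algebra_simps)
      ultimately show "x \<in> I" by simp
    qed
    with neq show False by simp
  qed
  show "\<exists>a. z * a * d \<notin> I"
  proof (rule ccontr)
    assume "\<nexists>a. z * a * d \<notin> I"
    then have *: "z * a * d \<in> I" for a by blast
    have BG: "x * u \<in> I" if "u \<in> ?G" "x \<in> ?B" for u x
      by (rule gen_mult[OF I(1) _ that(2,1)]) (use * I in \<open>auto intro: ts_mid ts_lmult ts_rmult\<close>)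
    have "?A \<inter> ?B \<subseteq> I"
    proof
      fix x assume x: "x \<in> ?A \<inter> ?B"
      then obtain i y where iy: "x = i + y" "i \<in> I" "y \<in> ?G" by (auto simp: ideal_sum_def)
      obtain u where u: "u \<in> ?G" "y * u \<approx> y" using s_unital_right[of "{d}" y] iy assms(2) by blast
      have "x * u \<in> I" using BG u x by blast
      moreover have "y * u - y \<in> I" using u I by (auto simp: cg_def)
      then have "x * u + (i - i * u - (y * u - y)) \<in> I" if "x * u \<in> I"
        using that iy by (simp add: ts_diff ts_rmult ts_add I(1))
      moreover have "x * u + (i - i * u - (y * u - y)) = x" using iy by (simp add: algebra_simps)
      ultimately show "x \<in> I" by simp
    qed
    with neq show False by simp
  qed
qed

end

section \<open>Finite expansions, vertices with edges removed, and cycles without exits\<close>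

lemma asp_cg:
  assumes "two_sided I" "x \<approx>\<^bsub>I\<^esub> y" "y \<in> asp (I \<union> S)"
  shows "x \<in> asp (I \<union> S)"
proof -
  have "x - y \<in> asp (I \<union> S)"
    using assms(2) by (simp add: cg_def asp_base)
  then have "(x - y) + y \<in> asp (I \<union> S)" using assms(3) by (rule asp_add)
  then show ?thesis by simp
qed

context leavitt_family
begin

text \<open>Equal indices are collected and zero coefficients dropped. That no
  \<open>\<kappa> a\<close> vanishes is what allows a chosen term to be isolated and divided by its
  coefficient.\<close>

lemma asp_finite_sum:
  assumes I: "two_sided I" and "x \<in> asp (I \<union> {sc k * g a | k a. a \<in> A})"
  shows "\<exists>S \<kappa>. finite S \<and> S \<subseteq> A \<and> (\<forall>a\<in>S. \<kappa> a \<noteq> 0) \<and> x \<approx>\<^bsub>I\<^esub> (\<Sum>a\<in>S. sc (\<kappa> a) * g a)"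
proof -
  have "\<exists>S \<kappa>. finite S \<and> S \<subseteq> A \<and> x \<approx>\<^bsub>I\<^esub> (\<Sum>a\<in>S. sc (\<kappa> a) * g a)"
    using assms(2)
  proof (induction rule: asp.induct)
    case zero
    then show ?case by (intro exI[of _ "{}"]) (simp add: cg_refl[OF I])
  next
    case (step x y)
    then obtain S \<kappa> where *: "finite S" "S \<subseteq> A" "y \<approx>\<^bsub>I\<^esub> (\<Sum>a\<in>S. sc (\<kappa> a) * g a)" by blast
    from step.hyps(1) show ?case
    proof
      assume "x \<in> I"
      then have "x + y \<approx>\<^bsub>I\<^esub> 0 + (\<Sum>a\<in>S. sc (\<kappa> a) * g a)"
        using * by (intro cg_add[OF I]) (auto simp: cg_def)
      then show ?thesis using * by auto
    next
      assume "x \<in> {sc k * g a | k a. a \<in> A}"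
      then obtain k a where x: "x = sc k * g a" "a \<in> A" by blast
      \<comment> \<open>The new coefficient is added to an old one if the index \<open>a\<close>
        already occurs in \<open>S\<close>; outside \<open>S\<close> the old coefficient counts as
        0.\<close>
      define \<kappa>' where "\<kappa>' b = (if b \<in> S then \<kappa> b else 0) + (if b = a then k else 0)" for b
      have "(\<Sum>b\<in>insert a S. sc (\<kappa>' b) * g b) =
          (\<Sum>b\<in>insert a S. if b \<in> S then sc (\<kappa> b) * g b else 0) + (\<Sum>b\<in>insert a S. if b = a then sc k * g b else 0)"
        by (subst sum.distrib[symmetric], rule sum.cong) (auto simp: \<kappa>'_def sc_add distrib_right)
      also have "(\<Sum>b\<in>insert a S. if b \<in> S then sc (\<kappa> b) * g b else 0) = (\<Sum>b\<in>S. sc (\<kappa> b) * g b)"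
        using *(1) by (intro sum.mono_neutral_cong_right) auto
      also have "(\<Sum>b\<in>insert a S. if b = a then sc k * g b else 0) = x"
        using *(1) by (simp add: x)
      finally have "x + y \<approx>\<^bsub>I\<^esub> (\<Sum>b\<in>insert a S. sc (\<kappa>' b) * g b)"
        using cg_add[OF I cg_refl[OF I, of x] *(3)] by (simp add: add.commute)
      moreover have "finite (insert a S)" "insert a S \<subseteq> A" using * x by auto
      ultimately show ?thesis by blast
    qed
  qed
  then obtain S \<kappa> where *: "finite S" "S \<subseteq> A" "x \<approx>\<^bsub>I\<^esub> (\<Sum>a\<in>S. sc (\<kappa> a) * g a)" by blast
  have "(\<Sum>a\<in>S. sc (\<kappa> a) * g a) = (\<Sum>a\<in>{a\<in>S. \<kappa> a \<noteq> 0}. sc (\<kappa> a) * g a)"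
    using *(1) by (intro sum.mono_neutral_right) auto
  with * show ?thesis by (intro exI[of _ "{a\<in>S. \<kappa> a \<noteq> 0}"] exI[of _ \<kappa>]) auto
qed

text \<open>Here \<open>u\<close> projects \<open>v\<close> away from the edges in \<open>F\<close>.
  As \<open>v\<close> may emit infinitely many edges, these idempotents replace the decomposition of
  a vertex into its outgoing edges.\<close>

lemma V_minus_edges:
  assumes "finite F" "F \<subseteq> out_arcs E v" "v \<in> verts E"
  defines "u \<equiv> V v - (\<Sum>f\<in>F. ed f * gh f)"
  shows "u \<in> DId" "V v * u \<approx> u" "u * V v \<approx> u"
    "\<And>f. f \<in> F \<Longrightarrow> gh f * u \<in> T" "\<And>f. f \<in> F \<Longrightarrow> u * ed f \<in> T"
    "\<And>f. f \<in> out_arcs E v \<Longrightarrow> f \<notin> F \<Longrightarrow> u * ed f \<approx> ed f"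
proof -
  have F: "f \<in> arcs E" "tail E f = v" if "f \<in> F" for f using that assms by (auto simp: out_arcs_def)
  have "V v * u = V v * V v - (\<Sum>f\<in>F. (V v * ed f) * gh f)"
    by (simp add: u_def right_diff_distrib sum_distrib_left mult.assoc)
  also have "\<dots> \<approx> V v - (\<Sum>f\<in>F. ed f * gh f)"
    using F rel_Ve by (intro cg_diff[OF T] cg_sum[OF T] cT_rmult rel_VV assms) metis
  finally show Vu: "V v * u \<approx> u" by (simp add: u_def)
  have "u * V v = V v * V v - (\<Sum>f\<in>F. ed f * (gh f * V v))"
    by (simp add: u_def left_diff_distrib sum_distrib_right mult.assoc)
  also have "\<dots> \<approx> V v - (\<Sum>f\<in>F. ed f * gh f)"
    using F rel_gV by (intro cg_diff[OF T] cg_sum[OF T] cT_lmult rel_VV assms) metis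
  finally show "u * V v \<approx> u" by (simp add: u_def)
  have sum_gh: "(\<Sum>f\<in>F. gh g * ed f * gh f) \<approx> (if g \<in> F then gh g else 0)" if "g \<in> out_arcs E v" for g
  proof -
    have "(\<Sum>f\<in>F. gh g * ed f * gh f) \<approx> (\<Sum>f\<in>F. if f = g then gh f else 0)"
    proof (rule cg_sum[OF T])
      fix f assume "f \<in> F"
      show "gh g * ed f * gh f \<approx> (if f = g then gh f else 0)"
      proof (cases "f = g")
        case True
        then show ?thesis using cT_trans[OF cT_rmult[OF rel_ge[of f], of "gh f"] rel_Vg[of f]] F[OF \<open>f \<in> F\<close>] by simp
      next
        case False
        then show ?thesis using ts_rmult[OF T rel_ge0[of g f]] F[OF \<open>f \<in> F\<close>] that by (auto simp: cg_def)
      qed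
    qed
    then show ?thesis using assms(1) by simp
  qed
  have sum_ed: "(\<Sum>f\<in>F. ed f * (gh f * ed g)) \<approx> (if g \<in> F then ed g else 0)" if "g \<in> out_arcs E v" for g
  proof -
    have "(\<Sum>f\<in>F. ed f * (gh f * ed g)) \<approx> (\<Sum>f\<in>F. if f = g then ed f else 0)"
    proof (rule cg_sum[OF T])
      fix f assume "f \<in> F"
      show "ed f * (gh f * ed g) \<approx> (if f = g then ed f else 0)"
      proof (cases "f = g")
        case True
        then show ?thesis using cT_trans[OF cT_lmult[OF rel_ge[of f], of "ed f"] rel_eV[of f]] F[OF \<open>f \<in> F\<close>] by simp
      next
        case False
        then show ?thesis using ts_lmult[OF T rel_ge0[of f g]] F[OF \<open>f \<in> F\<close>] that by (auto simp: cg_def)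
      qed
    qed
    then show ?thesis using assms(1) by simp
  qed
  show gu: "gh g * u \<in> T" if "g \<in> F" for g
  proof -
    have "gh g * u = gh g * V v - (\<Sum>f\<in>F. gh g * ed f * gh f)"
      by (simp add: u_def right_diff_distrib sum_distrib_left mult.assoc)
    also have "\<dots> \<approx> gh g - gh g"
      using sum_gh[of g] that assms(2) F[OF that] rel_gV[of g] by (intro cg_diff[OF T]) auto
    finally show ?thesis by (simp add: cg_def)
  qed
  have u_ed: "u * ed g \<approx> ed g - (if g \<in> F then ed g else 0)" if "g \<in> out_arcs E v" for g
  proof -
    have "u * ed g = V v * ed g - (\<Sum>f\<in>F. ed f * (gh f * ed g))"
      by (simp add: u_def left_diff_distrib sum_distrib_right mult.assoc)
    also have "\<dots> \<approx> ed g - (if g \<in> F then ed g else 0)"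
      using sum_ed[OF that] that rel_Ve[of g] by (intro cg_diff[OF T]) auto
    finally show ?thesis .
  qed
  show "u * ed f \<in> T" if "f \<in> F" for f
    using u_ed[of f] that assms(2) by (auto simp: cg_def)
  show "u * ed f \<approx> ed f" if "f \<in> out_arcs E v" "f \<notin> F" for f
    using u_ed[of f] that by auto
  have "ed f * gh f \<in> D" if "f \<in> F" for f
  proof -
    have "ed f * gh f \<approx> mnl [f] (head E f) [f]"
      using cT_rmult[OF cT_sym[OF rel_eV[of f]], of "gh f"] F[OF that] by (simp add: mnl_def)
    moreover have "wlk [f] (head E f)" using F[OF that] by (auto simp: wlk_def awalk_simps)
    ultimately show ?thesis using D_cg mnl_D by blast
  qed
  moreover have "V v \<in> D" using V_DId assms(3) DId_D by blast
  ultimately have "u \<in> D" unfolding u_def by (intro D_diff D_sum) auto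
  moreover have "u * u \<approx> u"
  proof -
    have "u * u = V v * u - (\<Sum>f\<in>F. ed f * (gh f * u))"
      by (subst (1) u_def) (simp add: left_diff_distrib sum_distrib_right mult.assoc)
    also have "\<dots> \<approx> u - 0"
      using ts_sum[OF T, of F "\<lambda>f. ed f * (gh f * u)"] ts_lmult[OF T gu]
      by (intro cg_diff[OF T] Vu) (simp add: cg_zero)
    finally show ?thesis by simp
  qed
  ultimately show "u \<in> DId" by (simp add: DId_def)
qed

text \<open>Modulo \<open>I\<close>, the relation \<open>V u - ed e * gh e \<in> I\<close> says that \<open>e\<close> is the only edge leaving \<open>u\<close>.\<close>

definition "exitless I v \<longleftrightarrow> v \<in> verts E \<and> V v \<notin> I \<and> (\<exists>c. awalk v c v \<and> c \<noteq> []) \<and>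
  (\<forall>p u. awalk v p u \<longrightarrow> V u \<notin> I \<longrightarrow> (\<exists>e\<in>out_arcs E u. V u - ed e * gh e \<in> I))"

text \<open>The bound \<open>N\<close> on the ghost parts is the measure for removing ghost edges by
  multiplication from the right.\<close>

definition gspan where
  "gspan I N v = asp (I \<union> {sc k * mnl p w q | k p w q. wlk p w \<and> awalk v q w \<and> length q \<le> N})"

end

locale leavitt_ideal = leavitt_family +
  fixes I
  assumes I: "two_sided I" and TI: "T \<subseteq> I"
begin

lemma cgI: "x \<approx> y \<Longrightarrow> x \<approx>\<^bsub>I\<^esub> y"
  by (rule cg_mono[OF _ TI])

lemmas cgI_trans [trans] = cg_trans[OF I]

lemma dead_ed: "e \<in> arcs E \<Longrightarrow> V (head E e) \<in> I \<Longrightarrow> ed e \<in> I"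
  using cg_mem[OF I cgI[OF rel_eV, of e]] ts_lmult[OF I, of "V (head E e)" "ed e"] by simp

text \<open>A ghost path starting with \<open>f\<close> loses this edge, one starting with another
  edge is killed, and a monomial without ghosts only gets a longer real part.\<close>

lemma gspan_ed:
  assumes "x \<in> gspan I (Suc N) v" "f \<in> arcs E" "tail E f = v"
  shows "x * ed f \<in> gspan I N (head E f)"
  using assms(1) unfolding gspan_def
proof (rule asp_rmult)
  let ?S = "{sc k * mnl p w q | k p w q. wlk p w \<and> awalk (head E f) q w \<and> length q \<le> N}"
  fix y assume "y \<in> I \<union> {sc k * mnl p w q |k p w q. wlk p w \<and> awalk v q w \<and> length q \<le> Suc N}"
  then consider "y \<in> I" | k p w q where "y = sc k * mnl p w q" "wlk p w" "awalk v q w" "length q \<le> Suc N" by blast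
  then show "y * ed f \<in> asp (I \<union> ?S)"
  proof cases
    case 1
    then show ?thesis by (intro asp_base) (simp add: ts_rmult[OF I])
  next
    case (2 k p w q)
    show ?thesis
    proof (cases q)
      case Nil
      then have [simp]: "w = v" using 2 by (simp add: awalk_Nil_iff)
      have "y * ed f = sc k * re p * (V v * ed f) * 1" by (simp add: 2 Nil mnl_def mult.assoc)
      also have "\<dots> \<approx> sc k * re p * ed f * 1" using rel_Ve[of f] assms by (intro cT_mid) auto
      also have "\<dots> \<approx> sc k * re p * (ed f * V (head E f)) * 1"
        by (intro cT_mid cT_sym[OF rel_eV] assms(2))
      also have "\<dots> = sc k * mnl (p @ [f]) (head E f) []" by (simp add: mnl_def mult.assoc)
      finally have *: "y * ed f \<approx>\<^bsub>I\<^esub> sc k * mnl (p @ [f]) (head E f) []" by (rule cgI)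
      have "wlk (p @ [f]) (head E f)" using 2 assms by (intro wlk_app[of p w]) (auto simp: awalk_simps)
      then show ?thesis using assms(2)
        by (intro asp_cg[OF I *] asp_base UnI2 CollectI exI[of _ k] exI[of _ "p @ [f]"] exI[of _ "head E f"] exI[of _ "[]"])
          (auto simp: awalk_Nil_iff)
    next
      case (Cons e q')
      then have e: "e \<in> arcs E" "awalk (head E e) q' w" "length q' \<le> N" using 2 by (auto simp: awalk_Cons_iff)
      have y: "y * ed f = sc k * re p * V w * gho q' * (gh e * ed f)" by (simp add: 2 Cons mnl_def mult.assoc)
      show ?thesis
      proof (cases "e = f")
        case True
        have "y * ed f \<approx> sc k * re p * V w * gho q' * V (head E f)"
          unfolding y using e rel_ge[of f] True by (intro cT_lmult) auto
        also have "\<dots> = sc k * re p * (V w * gho q' * V (head E f)) * 1" by (simp add: mult.assoc)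
        also have "\<dots> \<approx> sc k * re p * (V w * gho q') * 1" using e True by (intro cT_mid gho_V) auto
        also have "\<dots> = sc k * mnl p w q'" by (simp add: mnl_def mult.assoc)
        finally have *: "y * ed f \<approx>\<^bsub>I\<^esub> sc k * mnl p w q'" by (rule cgI)
        show ?thesis using 2 e True by (intro asp_cg[OF I *] asp_base UnI2) blast
      next
        case False
        then have "y * ed f \<in> T" unfolding y by (intro ts_lmult[OF T rel_ge0] e assms)
        then show ?thesis using TI by (intro asp_base) auto
      qed
    qed
  qed
qed

end

section \<open>The reduction theorem\<close>

text \<open>By \<open>nd\<close>, passing from \<open>I\<close> to \<open>X\<close> adds no diagonal
  idempotent. The contradictions below arise from producing one.\<close>

locale leavitt_reduction = leavitt_ideal +
  fixes X
  assumes X: "two_sided X" and IX: "I \<subseteq> X" and XM: "X \<subseteq> M"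
    and nd: "\<And>d. d \<in> DId \<Longrightarrow> d \<in> X \<Longrightarrow> d \<in> I"
begin

lemma X_cg: "x \<approx>\<^bsub>I\<^esub> y \<Longrightarrow> x \<in> X \<longleftrightarrow> y \<in> X"
  using cg_mem[OF X cg_mono[OF _ IX]] by blast

text \<open>This would be immediate if \<open>v\<close> were a finite sum of elements
  \<open>f f*\<close>. In general \<open>x\<close> agrees with \<open>x u\<close>, where
  \<open>u\<close> is \<open>v\<close> with finitely many edges removed so that no ghosts survive.
  The shortest remaining path then isolates a diagonal idempotent of \<open>X\<close>.\<close>

lemma no_kernel:
  assumes x: "x \<in> X" "x \<in> gspan I (Suc N) v" "v \<in> verts E"
    and kill: "\<And>f. f \<in> out_arcs E v \<Longrightarrow> x * ed f \<in> I"
  shows "x \<in> I"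
proof (rule ccontr)
  assume "x \<notin> I"
  let ?A = "{(p, w, q). wlk p w \<and> awalk v q w}"
  have "x \<in> asp (I \<union> {sc k * (\<lambda>(p, w, q). mnl p w q) a | k a. a \<in> ?A})"
    using x(2) unfolding gspan_def by (rule subsetD[OF asp_mono, rotated]) auto
  from asp_finite_sum[OF I this] obtain S \<kappa> where S: "finite S" "S \<subseteq> ?A"
      and xS: "x \<approx>\<^bsub>I\<^esub> (\<Sum>a\<in>S. sc (\<kappa> a) * (\<lambda>(p, w, q). mnl p w q) a)"
    by blast
  define LF where "LF = {f \<in> out_arcs E v. V (head E f) \<notin> I}"
  \<comment> \<open>The first edges of the ghost parts of \<open>x\<close>, so that \<open>u\<close>
    kills those parts. If only finitely many edges have a live range, that is, one outside
    \<open>I\<close>, these are included and \<open>u\<close> kills every edge at \<open>v\<close>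
    modulo \<open>I\<close>.\<close>
  define F where "F = (\<lambda>(p, w, q). hd q) ` {(p, w, q) \<in> S. q \<noteq> []} \<union> (if finite LF then LF else {})"
  have "finite {(p, w, q) \<in> S. q \<noteq> []}" by (rule finite_subset[OF _ S(1)]) auto
  then have "finite F" by (simp add: F_def)
  have "hd q \<in> out_arcs E v" if "(p, w, q) \<in> S" "q \<noteq> []" for p w q
    using S(2) that by (cases q) (auto simp: awalk_Cons_iff)
  then have "F \<subseteq> out_arcs E v" by (auto simp: F_def LF_def split: if_splits)
  define u where "u = V v - (\<Sum>f\<in>F. ed f * gh f)"
  note u = V_minus_edges[OF \<open>finite F\<close> \<open>F \<subseteq> out_arcs E v\<close> \<open>v \<in> verts E\<close>, folded u_def]
  have xV: "x * V v \<approx>\<^bsub>I\<^esub> x"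
  proof -
    have "x * V v \<approx>\<^bsub>I\<^esub> (\<Sum>a\<in>S. sc (\<kappa> a) * ((\<lambda>(p, w, q). mnl p w q) a * V v))"
      using cg_rmult[OF I xS, of "V v"] by (simp add: sum_distrib_right mult.assoc)
    also have "(\<Sum>a\<in>S. sc (\<kappa> a) * ((\<lambda>(p, w, q). mnl p w q) a * V v)) \<approx>\<^bsub>I\<^esub> (\<Sum>a\<in>S. sc (\<kappa> a) * (\<lambda>(p, w, q). mnl p w q) a)"
    proof (intro cg_sum[OF I] cg_lmult[OF I])
      fix a assume "a \<in> S"
      then obtain p w q where a: "a = (p, w, q)" "awalk v q w" using S(2) by blast
      show "(\<lambda>(p, w, q). mnl p w q) a * V v \<approx>\<^bsub>I\<^esub> (\<lambda>(p, w, q). mnl p w q) a"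
        using cgI[OF cT_lmult[OF gho_V[OF a(2)], of "re p"]] by (simp add: a mnl_def mult.assoc)
    qed
    also note cg_sym[OF I xS]
    finally show ?thesis .
  qed
  have xu: "x * u \<approx>\<^bsub>I\<^esub> x"
  proof -
    have "(\<Sum>f\<in>F. x * ed f * gh f) \<in> I"
      using kill \<open>F \<subseteq> out_arcs E v\<close> by (intro ts_sum[OF I]) (rule ts_rmult[OF I], blast)
    then have "x * V v - (\<Sum>f\<in>F. x * ed f * gh f) \<approx>\<^bsub>I\<^esub> x - 0"
      by (intro cg_diff[OF I] xV) (simp add: cg_zero)
    then show ?thesis by (simp add: u_def right_diff_distrib sum_distrib_left mult.assoc)
  qed
  \<comment> \<open>Multiplication by \<open>u\<close> leaves only terms without ghost
    edges.\<close>
  have "x * u \<in> asp (I \<union> {sc k * (re p * u) | k p. p \<in> {p. wlk p v}})"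
  proof (rule asp_cg[OF I])
    show "x * u \<approx>\<^bsub>I\<^esub> (\<Sum>a\<in>S. sc (\<kappa> a) * ((\<lambda>(p, w, q). mnl p w q) a * u))"
      using cg_rmult[OF I xS, of u] by (simp add: sum_distrib_right mult.assoc)
    show "(\<Sum>a\<in>S. sc (\<kappa> a) * ((\<lambda>(p, w, q). mnl p w q) a * u)) \<in> asp (I \<union> {sc k * (re p * u) | k p. p \<in> {p. wlk p v}})"
    proof (rule asp_sum)
      fix a assume "a \<in> S"
      then obtain p w q where a: "a = (p, w, q)" "awalk v q w" "wlk p w" using S(2) by blast
      show "sc (\<kappa> a) * ((\<lambda>(p, w, q). mnl p w q) a * u) \<in> asp (I \<union> {sc k * (re p * u) | k p. p \<in> {p. wlk p v}})"
      proof (cases q)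
        case Nil
        then have w: "w = v" using a by (simp add: awalk_Nil_iff)
        have *: "sc (\<kappa> a) * ((\<lambda>(p, w, q). mnl p w q) a * u) \<approx>\<^bsub>I\<^esub> sc (\<kappa> a) * (re p * u)"
          using cgI[OF cT_lmult[OF u(2), of "sc (\<kappa> a) * re p"]] by (simp add: a mnl_def mult.assoc w Nil)
        show ?thesis using a w by (intro asp_cg[OF I *] asp_base) blast
      next
        case (Cons f q')
        then have "f \<in> F" using \<open>a \<in> S\<close> a by (force simp: F_def)
        then have "sc (\<kappa> a) * re p * V w * gho q' * (gh f * u) \<in> I"
          using u(4)[of f] TI by (intro ts_lmult[OF I, of "gh f * u"]) auto
        then show ?thesis by (intro asp_base) (simp add: a mnl_def mult.assoc Cons)
      qed
    qed
  qed
  then have "x \<in> asp (I \<union> {sc k * (re p * u) | k p. p \<in> {p. wlk p v}})"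
    by (rule asp_cg[OF I cg_sym[OF I xu]])
  from asp_finite_sum[OF I this] obtain S' \<kappa>'
    where S': "finite S'" "S' \<subseteq> {p. wlk p v}" "\<And>p. p \<in> S' \<Longrightarrow> \<kappa>' p \<noteq> 0"
      and xS': "x \<approx>\<^bsub>I\<^esub> (\<Sum>p\<in>S'. sc (\<kappa>' p) * (re p * u))"
    by blast
  have "S' \<noteq> {}" using xS' \<open>x \<notin> I\<close> by (auto simp: cg_zero)
  \<comment> \<open>By minimal length, \<open>\<alpha>* p\<close> is zero or a nonempty real path
    for every other \<open>p\<close>, and never a ghost path.\<close>
  then obtain \<alpha> where \<alpha>: "\<alpha> \<in> S'" "\<And>p. p \<in> S' \<Longrightarrow> length \<alpha> \<le> length p"
    using arg_min_if_finite[OF S'(1), of length] by (metis not_less)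
  have w\<alpha>: "wlk \<alpha> v" using \<alpha> S' by blast
  have cases: "V v * gho \<alpha> * re p * V v \<in> T \<or>
      (\<exists>r. p = \<alpha> @ r \<and> r \<noteq> [] \<and> awalk v r v \<and> V v * gho \<alpha> * re p * V v \<approx> re r * V v)"
    if p: "p \<in> S'" "p \<noteq> \<alpha>" for p
  proof -
    have "wlk p v" using p S' by blast
    with w\<alpha> show ?thesis
    proof (cases rule: walk_cases)
      case (pre r)
      then show ?thesis using gho_re_pre[OF w\<alpha> pre(2)] p by auto
    next
      case (ext r)
      then show ?thesis using \<alpha>(2)[OF p(1)] p by auto
    qed auto
  qed
  have same: "V v * gho \<alpha> * re \<alpha> * V v \<approx> V v"
    using w\<alpha> V_gho_re by (auto simp: wlk_def)
  have coeff_at: "a * x * b \<approx>\<^bsub>I\<^esub> sc (\<kappa>' \<alpha>) * c"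
    if *: "\<And>p. p \<in> S' \<Longrightarrow> p \<noteq> \<alpha> \<Longrightarrow> a * (re p * u) * b \<in> I" "a * (re \<alpha> * u) * b \<approx>\<^bsub>I\<^esub> c" for a b c
  proof -
    have "a * x * b \<approx>\<^bsub>I\<^esub> (\<Sum>p\<in>S'. sc (\<kappa>' p) * (a * (re p * u) * b))"
      using cg_mid[OF I xS', of a b] by (simp add: sum_distrib_left sum_distrib_right mult.assoc sc_left)
    also have "(\<Sum>p\<in>S'. sc (\<kappa>' p) * (a * (re p * u) * b)) \<approx>\<^bsub>I\<^esub> (\<Sum>p\<in>S'. if p = \<alpha> then sc (\<kappa>' p) * c else 0)"
    proof (rule cg_sum[OF I])
      fix p assume "p \<in> S'"
      then show "sc (\<kappa>' p) * (a * (re p * u) * b) \<approx>\<^bsub>I\<^esub> (if p = \<alpha> then sc (\<kappa>' p) * c else 0)"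
        using ts_lmult[OF I *(1), of p "sc (\<kappa>' p)"] cg_lmult[OF I *(2), of "sc (\<kappa>' \<alpha>)"]
        by (simp add: cg_zero)
    qed
    also have "(\<Sum>p\<in>S'. if p = \<alpha> then sc (\<kappa>' p) * c else 0) = sc (\<kappa>' \<alpha>) * c"
      using \<alpha>(1) S'(1) by simp
    finally show ?thesis .
  qed
  have conclude: "c \<in> I" if "c \<in> DId" "a * x * b \<approx>\<^bsub>I\<^esub> sc (\<kappa>' \<alpha>) * c" for a b c
  proof -
    have "sc (\<kappa>' \<alpha>) * c \<in> X" using X_cg[OF that(2)] ts_mid[OF X x(1), of a b] by simp
    then have "c \<in> X" by (rule sc_mem[OF X S'(3)[OF \<alpha>(1)]])
    then show ?thesis by (rule nd[OF that(1)])
  qed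
  show False
  \<comment> \<open>With finitely many live edges \<open>u\<close> itself is isolated. Otherwise
    some live edge is untouched by the finite data, and its range is isolated.\<close>
  proof (cases "finite LF")
    case True
    have u_ed: "u * ed e \<in> I" if "e \<in> out_arcs E v" for e
    proof (cases "e \<in> F")
      case False
      then have "V (head E e) \<in> I" using True that by (auto simp: F_def LF_def)
      then have "ed e \<in> I" using dead_ed that by auto
      then show ?thesis by (rule ts_lmult[OF I])
    qed (use u(5) TI in blast)
    have mid: "(u * gho \<alpha>) * (re p * u) * 1 \<approx>\<^bsub>I\<^esub> u * (V v * gho \<alpha> * re p * V v) * u" for p
    proof -
      have "u * (gho \<alpha> * re p) * u \<approx> (u * V v) * (gho \<alpha> * re p) * (V v * u)"
        by (intro cT_mult cT_sym[OF u(2)] cT_sym[OF u(3)]) auto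
      then show ?thesis using cgI by (simp add: mult.assoc)
    qed
    have "(u * gho \<alpha>) * x * 1 \<approx>\<^bsub>I\<^esub> sc (\<kappa>' \<alpha>) * u"
    proof (rule coeff_at)
      fix p assume "p \<in> S'" "p \<noteq> \<alpha>"
      from cases[OF this] have "u * (V v * gho \<alpha> * re p * V v) * u \<in> I"
      proof (elim disjE exE conjE)
        assume "V v * gho \<alpha> * re p * V v \<in> T"
        then have "V v * gho \<alpha> * re p * V v \<in> I" using TI by blast
        then show ?thesis by (rule ts_mid[OF I])
      next
        fix r assume r: "r \<noteq> []" "awalk v r v" "V v * gho \<alpha> * re p * V v \<approx> re r * V v"
        then obtain e r' where e: "r = e # r'" "e \<in> out_arcs E v" by (cases r) (auto simp: awalk_Cons_iff)
        have "u * ed e * (re r' * V v * u) \<in> I" using u_ed[OF e(2)] by (rule ts_rmult[OF I])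
        then have "u * (re r * V v) * u \<in> I" by (simp add: e mult.assoc)
        then show ?thesis using cg_mem[OF I cgI[OF cT_mid[OF r(3)]]] by blast
      qed
      then show "(u * gho \<alpha>) * (re p * u) * 1 \<in> I" using cg_mem[OF I mid] by blast
    next
      have "u * (V v * gho \<alpha> * re \<alpha> * V v) * u \<approx> u * V v * u" by (rule cT_mid[OF same])
      also have "\<dots> \<approx> u * u" by (rule cT_rmult[OF u(3)])
      also have "\<dots> \<approx> u" by (rule DId_idem[OF u(1)])
      finally show "(u * gho \<alpha>) * (re \<alpha> * u) * 1 \<approx>\<^bsub>I\<^esub> u" by (rule cgI_trans[OF mid cgI])
    qed
    then have "u \<in> I" using conclude u(1) by blast
    then show False using \<open>x \<notin> I\<close> cg_mem[OF I xu] ts_lmult[OF I, of u x] by simp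
  next
    case False
    \<comment> \<open>The live edge \<open>f\<close> has to avoid \<open>F\<close>, so that
      \<open>u\<close> fixes it, and all edges following \<open>\<alpha>\<close> in the other paths,
      so that \<open>f*\<close> kills them.\<close>
    let ?B = "F \<union> (\<lambda>p. hd (drop (length \<alpha>) p)) ` S'"
    have "finite ?B" using \<open>finite F\<close> S'(1) by simp
    then have "\<not> LF \<subseteq> ?B" using False finite_subset by metis
    then obtain f where f: "f \<in> LF" "f \<notin> F" "\<And>p. p \<in> S' \<Longrightarrow> f \<noteq> hd (drop (length \<alpha>) p)"
      by blast
    have fa: "f \<in> arcs E" "tail E f = v" "f \<in> out_arcs E v" "V (head E f) \<notin> I" using f by (auto simp: LF_def)
    have mid: "(gh f * gho \<alpha>) * (re p * u) * ed f \<approx>\<^bsub>I\<^esub> gh f * (V v * gho \<alpha> * re p * V v) * ed f" for p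
    proof -
      have ue: "u * ed f \<approx> V v * ed f" using cT_trans[OF u(6)[of f] cT_sym[OF rel_Ve[of f]]] f fa by simp
      have gV: "gh f \<approx> gh f * V v" using cT_sym[OF rel_gV[of f]] fa by simp
      have "gh f * (gho \<alpha> * re p) * (u * ed f) \<approx> (gh f * V v) * (gho \<alpha> * re p) * (V v * ed f)"
        by (rule cT_mult[OF cT_rmult[OF gV] ue])
      then show ?thesis using cgI by (simp add: mult.assoc)
    qed
    have "(gh f * gho \<alpha>) * x * ed f \<approx>\<^bsub>I\<^esub> sc (\<kappa>' \<alpha>) * V (head E f)"
    proof (rule coeff_at)
      fix p assume p: "p \<in> S'" "p \<noteq> \<alpha>"
      from cases[OF p] have "gh f * (V v * gho \<alpha> * re p * V v) * ed f \<in> I"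
      proof (elim disjE exE conjE)
        assume "V v * gho \<alpha> * re p * V v \<in> T"
        then have "V v * gho \<alpha> * re p * V v \<in> I" using TI by blast
        then show ?thesis by (rule ts_mid[OF I])
      next
        fix r assume r: "p = \<alpha> @ r" "r \<noteq> []" "awalk v r v" "V v * gho \<alpha> * re p * V v \<approx> re r * V v"
        then obtain e r' where e: "r = e # r'" "e \<in> out_arcs E v" by (cases r) (auto simp: awalk_Cons_iff)
        have "e \<noteq> f" using f(3)[OF p(1)] r(1) e by auto
        then have "gh f * ed e \<in> I" using rel_ge0[of f e] fa e TI by auto
        then have "gh f * ed e * (re r' * V v * ed f) \<in> I" by (rule ts_rmult[OF I])
        then have "gh f * (re r * V v) * ed f \<in> I" by (simp add: e mult.assoc)
        then show ?thesis using cg_mem[OF I cgI[OF cT_mid[OF r(4)]]] by blast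
      qed
      then show "(gh f * gho \<alpha>) * (re p * u) * ed f \<in> I" using cg_mem[OF I mid] by blast
    next
      have "gh f * (V v * gho \<alpha> * re \<alpha> * V v) * ed f \<approx> gh f * V v * ed f" by (rule cT_mid[OF same])
      also have "\<dots> \<approx> gh f * ed f" using cT_rmult[OF rel_gV[of f], of "ed f"] fa by simp
      also have "\<dots> \<approx> V (head E f)" by (rule rel_ge[OF fa(1)])
      finally show "(gh f * gho \<alpha>) * (re \<alpha> * u) * ed f \<approx>\<^bsub>I\<^esub> V (head E f)"
        by (rule cgI_trans[OF mid cgI])
    qed
    then have "V (head E f) \<in> I" by (rule conclude[OF V_DId[OF head_in_verts[OF fa(1)]]])
    then show False using fa by blast
  qed
qed

text \<open>By \<open>no_kernel\<close> some edge keeps \<open>x\<close> outside \<open>I\<close>;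
  multiplying by it lowers the ghost bound and moves the endpoint to the range of that edge.\<close>

lemma remove_ghosts:
  assumes "x \<in> X" "x \<notin> I" "x \<in> gspan I N v" "v \<in> verts E"
  shows "\<exists>x v. x \<in> X \<and> x \<notin> I \<and> x \<in> gspan I 0 v \<and> v \<in> verts E"
  using assms
proof (induction N arbitrary: x v)
  case (Suc N)
  then obtain f where f: "f \<in> out_arcs E v" "x * ed f \<notin> I" using no_kernel by blast
  show ?case
  proof (rule Suc.IH)
    show "x * ed f \<in> X" using Suc.prems(1) by (rule ts_rmult[OF X])
    show "x * ed f \<in> gspan I N (head E f)" using gspan_ed[OF Suc.prems(3)] f by auto
  qed (use f in auto)
qed blast

end

section \<open>Reaching a nonzero constant plus closed walks\<close>

context leavitt_reduction
begin

text \<open>All paths are nonempty, so modulo \<open>I\<close> the element \<open>x\<close> is the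
  sum of \<open>e e* x\<close> over the finitely many first edges \<open>e\<close>.\<close>

lemma left_edges:
  assumes "finite S" "S \<subseteq> {p. wlk p v \<and> p \<noteq> []}"
    and x: "x \<approx>\<^bsub>I\<^esub> (\<Sum>p\<in>S. sc (\<kappa> p) * (re p * V v))" "x \<notin> I"
  obtains e where "e \<in> arcs E" "gh e * x \<notin> I"
proof (rule ccontr)
  assume "\<not> thesis"
  with that have gx: "gh e * x \<in> I" if "e \<in> arcs E" for e using that by blast
  have arcs: "hd p \<in> arcs E" if "p \<in> S" for p
    using assms(2) that by (cases p) (auto simp: wlk_def awalk_Cons_iff)
  let ?F = "hd ` S"
  have edge: "(\<Sum>e\<in>?F. ed e * gh e * (re p * V v)) \<approx>\<^bsub>I\<^esub> re p * V v" if "p \<in> S" for p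
  proof -
    obtain f p' where p: "p = f # p'" "f \<in> arcs E" using arcs[OF \<open>p \<in> S\<close>] assms(2) \<open>p \<in> S\<close> by (cases p) auto
    have ed: "ed e * gh e * (re p * V v) \<approx> (if e = f then re p * V v else 0)" if "e \<in> ?F" for e
    proof (cases "e = f")
      case True
      have "ed e * gh e * (re p * V v) = ed e * (gh e * ed e) * (re p' * V v)"
        by (simp add: p True mult.assoc)
      also have "\<dots> \<approx> ed e * V (head E e) * (re p' * V v)" by (rule cT_mid[OF rel_ge]) (simp add: p True)
      also have "\<dots> \<approx> ed e * (re p' * V v)" by (rule cT_rmult[OF rel_eV]) (simp add: p True)
      finally show ?thesis by (simp add: True p mult.assoc)
    next
      case False
      have "ed e * (gh e * ed f) * (re p' * V v) \<in> T"
        by (rule ts_mid[OF T rel_ge0]) (use arcs that p False in auto)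
      then show ?thesis using False by (simp add: p cg_zero mult.assoc)
    qed
    have "(\<Sum>e\<in>?F. ed e * gh e * (re p * V v)) \<approx> (\<Sum>e\<in>?F. if e = f then re p * V v else 0)"
      by (rule cg_sum[OF T ed])
    also have "(\<Sum>e\<in>?F. if e = f then re p * V v else 0) = re p * V v"
      using \<open>p \<in> S\<close> p assms(1) by (simp add: image_iff) (metis list.sel(1))
    finally show ?thesis by (rule cgI)
  qed
  have "(\<Sum>e\<in>?F. ed e * gh e * x) \<approx>\<^bsub>I\<^esub> (\<Sum>e\<in>?F. ed e * gh e * (\<Sum>p\<in>S. sc (\<kappa> p) * (re p * V v)))"
    by (rule cg_sum[OF I cg_lmult[OF I x(1)]])
  also have "\<dots> = (\<Sum>p\<in>S. sc (\<kappa> p) * (\<Sum>e\<in>?F. ed e * gh e * (re p * V v)))"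
    by (subst sum_distrib_left, subst sum.swap) (simp add: sum_distrib_left sc_left)
  also have "\<dots> \<approx>\<^bsub>I\<^esub> (\<Sum>p\<in>S. sc (\<kappa> p) * (re p * V v))"
    by (rule cg_sum[OF I cg_lmult[OF I edge]])
  also have "\<dots> \<approx>\<^bsub>I\<^esub> x" by (rule cg_sym[OF I x(1)])
  finally have "(\<Sum>e\<in>?F. ed e * gh e * x) \<approx>\<^bsub>I\<^esub> x" .
  moreover have "(\<Sum>e\<in>?F. ed e * gh e * x) \<in> I"
  proof (rule ts_sum[OF I])
    fix e assume "e \<in> ?F"
    then have "ed e * (gh e * x) \<in> I" using gx arcs by (intro ts_lmult[OF I, of "gh e * x"]) auto
    then show "ed e * gh e * x \<in> I" by (simp add: mult.assoc)
  qed
  ultimately show False using cg_mem[OF I] x(2) by blast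
qed

text \<open>Left multiplication by \<open>V v\<close> keeps exactly the closed walks, and the
  coefficient of the empty path becomes \<open>k\<close>. If this closed part lies in
  \<open>I\<close> it is subtracted; then no empty path remains, and a ghost edge on the left
  shortens all paths.\<close>

lemma closed_part_aux:
  assumes "x \<in> X" "x \<notin> I" "x \<in> asp (I \<union> {sc k * (re p * V v) | k p. p \<in> {p. wlk p v \<and> length p \<le> N}})"
  shows "\<exists>y k \<kappa> \<Gamma>. y \<in> X \<and> y \<notin> I \<and> k \<noteq> 0 \<and> finite \<Gamma> \<and> \<Gamma> \<subseteq> {\<gamma>. awalk v \<gamma> v \<and> \<gamma> \<noteq> []} \<and>
    y \<approx>\<^bsub>I\<^esub> sc k * V v + (\<Sum>\<gamma>\<in>\<Gamma>. sc (\<kappa> \<gamma>) * (re \<gamma> * V v))"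
  using assms
proof (induction N arbitrary: x)
  case (0 x)
  from asp_finite_sum[OF I 0(3)] obtain S \<kappa>
    where S: "finite S" "S \<subseteq> {p. wlk p v \<and> length p \<le> 0}" "\<forall>p\<in>S. \<kappa> p \<noteq> 0"
      and xS: "x \<approx>\<^bsub>I\<^esub> (\<Sum>p\<in>S. sc (\<kappa> p) * (re p * V v))" by blast
  have "S \<subseteq> {[]}" using S(2) by auto
  moreover have "S \<noteq> {}" using xS 0(2) by (auto simp: cg_zero)
  ultimately have "S = {[]}" by blast
  then have "x \<approx>\<^bsub>I\<^esub> sc (\<kappa> []) * V v + (\<Sum>\<gamma>\<in>{}. sc (\<kappa> \<gamma>) * (re \<gamma> * V v))" "\<kappa> [] \<noteq> 0"
    using xS S(3) by auto
  then show ?case using 0(1,2)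
    by (intro exI[of _ x] exI[of _ "\<kappa> []"] exI[of _ \<kappa>] exI[of _ "{}"]) auto
next
  case (Suc N x)
  from asp_finite_sum[OF I Suc.prems(3)] obtain S \<kappa>
    where S: "finite S" "S \<subseteq> {p. wlk p v \<and> length p \<le> Suc N}" "\<forall>p\<in>S. \<kappa> p \<noteq> 0"
      and xS: "x \<approx>\<^bsub>I\<^esub> (\<Sum>p\<in>S. sc (\<kappa> p) * (re p * V v))" by blast
  let ?P = "{p \<in> S. awalk v p v}"
  have Vx: "V v * x \<approx>\<^bsub>I\<^esub> (\<Sum>p\<in>?P. sc (\<kappa> p) * (re p * V v))" if "v \<in> verts E"
  proof -
    have "V v * x \<approx>\<^bsub>I\<^esub> (\<Sum>p\<in>S. sc (\<kappa> p) * (V v * (re p * V v)))"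
      using cg_lmult[OF I xS, of "V v"] by (simp add: sum_distrib_left sc_left)
    also have "\<dots> \<approx>\<^bsub>I\<^esub> (\<Sum>p\<in>S. if awalk v p v then sc (\<kappa> p) * (re p * V v) else 0)"
    proof (rule cg_sum[OF I])
      fix p assume "p \<in> S"
      then obtain u where u: "awalk u p v" using S(2) by (auto simp: wlk_def)
      show "sc (\<kappa> p) * (V v * (re p * V v)) \<approx>\<^bsub>I\<^esub> (if awalk v p v then sc (\<kappa> p) * (re p * V v) else 0)"
      proof (cases "awalk v p v")
        case True
        then show ?thesis using cgI[OF cT_lmult[OF V_re[OF True], of "sc (\<kappa> p)"]] by (simp add: mult.assoc)
      next
        case False
        then have "V v * re p * V v \<in> T" using V_re0[OF u \<open>v \<in> verts E\<close>] u by auto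
        then have "sc (\<kappa> p) * (V v * re p * V v) \<in> I" using TI by (intro ts_lmult[OF I, of "V v * re p * V v"]) auto
        then show ?thesis using False by (simp add: cg_zero mult.assoc)
      qed
    qed
    also have "(\<Sum>p\<in>S. if awalk v p v then sc (\<kappa> p) * (re p * V v) else 0) = (\<Sum>p\<in>?P. sc (\<kappa> p) * (re p * V v))"
      using S(1) by (intro sum.mono_neutral_cong_right) auto
    finally show ?thesis .
  qed
  show ?case
  proof (cases "[] \<in> S \<and> V v * x \<notin> I")
    case True
    then have v: "v \<in> verts E" using S(2) by auto
    let ?G = "?P - {[]}"
    have "(\<Sum>p\<in>?P. sc (\<kappa> p) * (re p * V v)) = sc (\<kappa> []) * V v + (\<Sum>p\<in>?G. sc (\<kappa> p) * (re p * V v))"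
      using S(1) True v by (subst sum.remove[of _ "[]"]) (auto simp: awalk_Nil_iff)
    then have "V v * x \<approx>\<^bsub>I\<^esub> sc (\<kappa> []) * V v + (\<Sum>p\<in>?G. sc (\<kappa> p) * (re p * V v))" using Vx[OF v] by simp
    moreover have "V v * x \<in> X" using Suc.prems(1) by (rule ts_lmult[OF X])
    moreover have "finite ?G" "?G \<subseteq> {\<gamma>. awalk v \<gamma> v \<and> \<gamma> \<noteq> []}" "\<kappa> [] \<noteq> 0" using S True by auto
    ultimately show ?thesis using True
      by (intro exI[of _ "V v * x"] exI[of _ "\<kappa> []"] exI[of _ \<kappa>] exI[of _ ?G] conjI) simp_all
  next
    case False
    obtain x' S' where x': "x' \<in> X" "x' \<notin> I" "S' \<subseteq> S" "[] \<notin> S'"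
      and x'S: "x' \<approx>\<^bsub>I\<^esub> (\<Sum>p\<in>S'. sc (\<kappa> p) * (re p * V v))"
    proof (cases "[] \<in> S")
      case True
      then have v: "v \<in> verts E" and Vxi: "V v * x \<in> I" using S(2) False by auto
      show ?thesis
      proof (rule that[of "x - V v * x" "S - ?P"])
        show "x - V v * x \<in> X" using Suc.prems(1) by (intro ts_diff[OF X] ts_lmult[OF X])
        show "x - V v * x \<notin> I" using Suc.prems(2) ts_add[OF I _ Vxi, of "x - V v * x"] by auto
        have "x - V v * x \<approx>\<^bsub>I\<^esub> (\<Sum>p\<in>S. sc (\<kappa> p) * (re p * V v)) - (\<Sum>p\<in>?P. sc (\<kappa> p) * (re p * V v))"
          by (rule cg_diff[OF I xS Vx[OF v]])
        also have "\<dots> = (\<Sum>p\<in>S - ?P. sc (\<kappa> p) * (re p * V v))"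
          using S(1) by (subst sum_diff) auto
        finally show "x - V v * x \<approx>\<^bsub>I\<^esub> (\<Sum>p\<in>S - ?P. sc (\<kappa> p) * (re p * V v))" .
      qed (use v in \<open>auto simp: awalk_Nil_iff\<close>)
    next
      case False
      show ?thesis by (rule that[OF Suc.prems(1,2) subset_refl False xS])
    qed
    have fin: "finite S'" using x'(3) S(1) by (rule finite_subset)
    have sub: "S' \<subseteq> {p. wlk p v \<and> p \<noteq> []}" using x'(3,4) S(2) by auto
    obtain e where e: "e \<in> arcs E" "gh e * x' \<notin> I" using left_edges[OF fin sub x'S x'(2)] by blast
    show ?thesis
    proof (rule Suc.IH[OF _ e(2)])
      show "gh e * x' \<in> X" using x'(1) by (rule ts_lmult[OF X])
      let ?R = "asp (I \<union> {sc k * (re p * V v) | k p. p \<in> {p. wlk p v \<and> length p \<le> N}})"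
      have "(\<Sum>p\<in>S'. sc (\<kappa> p) * (gh e * (re p * V v))) \<in> ?R"
      proof (rule asp_sum)
        fix p assume p: "p \<in> S'"
        then obtain f p' where fp: "p = f # p'" "f \<in> arcs E" "awalk (head E f) p' v" "length p' \<le> N"
          using sub S(2) x'(3) by (cases p) (auto simp: wlk_def awalk_Cons_iff)
        show "sc (\<kappa> p) * (gh e * (re p * V v)) \<in> ?R"
        proof (cases "f = e")
          case True
          have "sc (\<kappa> p) * (gh e * (re p * V v)) = sc (\<kappa> p) * (gh e * ed e) * (re p' * V v)"
            by (simp add: fp True mult.assoc)
          also have "\<dots> \<approx> sc (\<kappa> p) * V (head E e) * (re p' * V v)" by (rule cT_mid[OF rel_ge[OF e(1)]])
          also have "\<dots> = sc (\<kappa> p) * (V (head E e) * re p' * V v)" by (simp add: mult.assoc)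
          also have "\<dots> \<approx> sc (\<kappa> p) * (re p' * V v)" by (rule cT_lmult[OF V_re]) (use fp True in simp)
          finally have *: "sc (\<kappa> p) * (gh e * (re p * V v)) \<approx>\<^bsub>I\<^esub> sc (\<kappa> p) * (re p' * V v)" by (rule cgI)
          show ?thesis using fp by (intro asp_cg[OF I *] asp_base) (auto simp: wlk_def)
        next
          case False
          then have "gh e * ed f \<in> T" using e fp by (intro rel_ge0) auto
          then have "sc (\<kappa> p) * (gh e * ed f) * (re p' * V v) \<in> I" using TI by (intro ts_mid[OF I, of "gh e * ed f"]) auto
          then show ?thesis by (intro asp_base) (simp add: fp mult.assoc)
        qed
      qed
      moreover have "gh e * x' \<approx>\<^bsub>I\<^esub> (\<Sum>p\<in>S'. sc (\<kappa> p) * (gh e * (re p * V v)))"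
        using cg_lmult[OF I x'S, of "gh e"] by (simp add: sum_distrib_left sc_left)
      ultimately show "gh e * x' \<in> ?R" by (rule asp_cg[OF I, rotated])
    qed
  qed
qed

lemma closed_part:
  assumes "x \<in> X" "x \<notin> I" "x \<in> gspan I 0 v"
  shows "\<exists>y k \<kappa> \<Gamma>. y \<in> X \<and> y \<notin> I \<and> k \<noteq> 0 \<and> finite \<Gamma> \<and> \<Gamma> \<subseteq> {\<gamma>. awalk v \<gamma> v \<and> \<gamma> \<noteq> []} \<and>
    y \<approx>\<^bsub>I\<^esub> sc k * V v + (\<Sum>\<gamma>\<in>\<Gamma>. sc (\<kappa> \<gamma>) * (re \<gamma> * V v))"
proof -
  have "I \<union> {sc k * mnl p w q | k p w q. wlk p w \<and> awalk v q w \<and> length q \<le> 0}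
      \<subseteq> I \<union> {sc k * (re p * V v) | k p. p \<in> {p. wlk p v}}"
  proof (rule Un_mono[OF subset_refl], rule subsetI)
    fix y assume "y \<in> {sc k * mnl p w q | k p w q. wlk p w \<and> awalk v q w \<and> length q \<le> 0}"
    then obtain k p w q where "y = sc k * mnl p w q" "wlk p w" "awalk v q w" "q = []" by auto
    then have "y = sc k * (re p * V v)" "wlk p v" by (auto simp: awalk_Nil_iff mnl_def)
    then show "y \<in> {sc k * (re p * V v) | k p. p \<in> {p. wlk p v}}" by blast
  qed
  from asp_finite_sum[OF I subsetD[OF asp_mono[OF this] assms(3)[unfolded gspan_def]]]
  obtain S \<kappa> where S: "finite S" "S \<subseteq> {p. wlk p v}"
    and xS: "x \<approx>\<^bsub>I\<^esub> (\<Sum>p\<in>S. sc (\<kappa> p) * (re p * V v))" by blast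
  define N where "N = Max (length ` S)"
  have "length p \<le> N" if "p \<in> S" for p using S(1) that by (auto simp: N_def)
  then have "(\<Sum>p\<in>S. sc (\<kappa> p) * (re p * V v)) \<in> asp (I \<union> {sc k * (re p * V v) | k p. p \<in> {p. wlk p v \<and> length p \<le> N}})"
    using S(2) by (intro asp_sum asp_base) auto
  then have "x \<in> asp (I \<union> {sc k * (re p * V v) | k p. p \<in> {p. wlk p v \<and> length p \<le> N}})"
    by (rule asp_cg[OF I xS])
  then show ?thesis by (rule closed_part_aux[OF assms(1,2)])
qed

end

section \<open>Leaving closed walks through an exit\<close>

context leavitt_ideal
begin

lemma exitless_trans:
  assumes "exitless I u" "awalk u p v" "V v \<notin> I" "awalk v c v" "c \<noteq> []"
  shows "exitless I v"
  unfolding exitless_def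
proof (intro conjI allI impI)
  show "v \<in> verts E" using assms(2) by blast
  show "\<exists>c. awalk v c v \<and> c \<noteq> []" using assms by blast
  fix q w assume "awalk v q w" "V w \<notin> I"
  then show "\<exists>e\<in>out_arcs E w. V w - ed e * gh e \<in> I"
    using assms(1,2) walk_app[of u p q w] unfolding exitless_def by blast
qed (fact assms(3))

text \<open>Conjugation by \<open>\<delta>\<close> and \<open>d\<close> should annihilate all given
  closed walks while \<open>d\<close> survives. The shortest walk \<open>\<gamma>1\<close> is left
  through an edge with live range, or at a vertex by the idempotent that removes its edge on
  \<open>\<gamma>1\<close>. If neither is possible, \<open>\<gamma>1\<close> shows that
  \<open>v\<close> is exitless.\<close>

lemma exits:
  assumes "finite \<Gamma>" "V v \<notin> I" "v \<in> verts E" "\<Gamma> \<subseteq> {\<gamma>. awalk v \<gamma> v \<and> \<gamma> \<noteq> []}" "\<not> exitless I v"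
  shows "\<exists>\<delta> w d. awalk v \<delta> w \<and> d \<in> DId \<and> d \<notin> I \<and> V w * d \<approx> d \<and> d * V w \<approx> d \<and>
    (\<forall>\<gamma>\<in>\<Gamma>. d * gho \<delta> * re \<gamma> * re \<delta> * d \<in> I)"
  using assms
proof (induction "card \<Gamma>" arbitrary: \<Gamma> v rule: less_induct)
  case less
  show ?case
  proof (cases "\<Gamma> = {}")
    case True
    then show ?thesis using less.prems by (intro exI[of _ "[]"] exI[of _ v] exI[of _ "V v"])
        (auto simp: awalk_Nil_iff rel_VV V_DId)
  next
    case False
    then obtain \<gamma>1 where \<gamma>1: "\<gamma>1 \<in> \<Gamma>" "\<And>\<gamma>. \<gamma> \<in> \<Gamma> \<Longrightarrow> length \<gamma>1 \<le> length \<gamma>"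
      using arg_min_if_finite[OF less.prems(1), of length] by (metis not_less)
    have closed: "awalk v \<gamma> v" "\<gamma> \<noteq> []" if "\<gamma> \<in> \<Gamma>" for \<gamma> using less.prems(4) that by auto
    \<comment> \<open>As \<open>\<delta>\<close> is no longer than \<open>\<gamma>\<close>, the
      product \<open>\<delta>* \<gamma>\<close> is zero or a real path. Prefixes of the shortest
      walk satisfy this for every \<open>\<gamma>\<close>.\<close>
    have prefix_cases: "V w * gho \<delta> * re \<gamma> * V v \<in> T \<or>
        (\<exists>\<tau>. \<gamma> = \<delta> @ \<tau> \<and> awalk w \<tau> v \<and> gho \<delta> * re \<gamma> * V v \<approx> re \<tau> * V v)"
      if "awalk v \<delta> w" "length \<delta> \<le> length \<gamma>" "\<gamma> \<in> \<Gamma>" for \<delta> w \<gamma>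
      using awalk_wlk[OF that(1)] awalk_wlk[OF closed(1)[OF that(3)]]
    proof (cases rule: walk_cases)
      case (pre r)
      then show ?thesis using gho_re_app[OF that(1) pre(2)] by blast
    next
      case (ext r)
      then have [simp]: "r = []" using that(2) by simp
      have "w = v" using ext by (auto simp: awalk_Nil_iff)
      then show ?thesis using ext gho_re_app[OF that(1), of "[]" v] by (auto simp: awalk_Nil_iff)
    qed blast
    show ?thesis
    proof (cases "\<exists>\<mu> e \<nu> f. \<gamma>1 = \<mu> @ e # \<nu> \<and> f \<in> arcs E \<and> tail E f = tail E e \<and> f \<noteq> e \<and> V (head E f) \<notin> I")
      case True
      then obtain \<mu> e \<nu> f where f: "\<gamma>1 = \<mu> @ e # \<nu>" "f \<in> arcs E" "tail E f = tail E e" "f \<noteq> e" "V (head E f) \<notin> I"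
        by blast
      let ?\<delta> = "\<mu> @ [f]" and ?w = "head E f"
      have \<delta>: "awalk v ?\<delta> ?w" using closed(1)[OF \<gamma>1(1)] f by (auto simp: walk_app awalk_simps)
      have len: "length ?\<delta> \<le> length \<gamma>" if "\<gamma> \<in> \<Gamma>" for \<gamma> using \<gamma>1(2)[OF that] f(1) by simp
      \<comment> \<open>The walks \<open>\<delta> \<tau>\<close> that follow the exit are rotated to
        closed walks \<open>\<tau> \<delta>\<close> at its range. \<open>\<gamma>1\<close> does not
        follow it, so the induction measure drops.\<close>
      define \<Gamma>' where "\<Gamma>' = (\<lambda>\<gamma>. drop (length ?\<delta>) \<gamma> @ ?\<delta>) ` {\<gamma> \<in> \<Gamma>. prefix ?\<delta> \<gamma>}"
      have \<Gamma>'I: "\<tau> @ ?\<delta> \<in> \<Gamma>'" if "?\<delta> @ \<tau> \<in> \<Gamma>" for \<tau>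
        unfolding \<Gamma>'_def by (rule image_eqI[of _ _ "?\<delta> @ \<tau>"]) (use that in \<open>auto simp: prefix_def\<close>)
      have \<Gamma>'D: "\<exists>\<tau>. g = \<tau> @ ?\<delta> \<and> ?\<delta> @ \<tau> \<in> \<Gamma> \<and> awalk ?w \<tau> v" if "g \<in> \<Gamma>'" for g
      proof -
        from that obtain \<tau> where \<tau>: "g = \<tau> @ ?\<delta>" "?\<delta> @ \<tau> \<in> \<Gamma>" by (auto simp: \<Gamma>'_def prefix_def)
        obtain z where z: "awalk v ?\<delta> z" "awalk z \<tau> v"
          using closed(1)[OF \<tau>(2)] walk_app[of v ?\<delta> \<tau> v] by blast
        have "z = ?w" by (rule awalk_end_unique[OF z(1) \<delta>]) simp
        then show ?thesis using \<tau> z by blast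
      qed
      have "\<not> prefix ?\<delta> \<gamma>1" using f by (auto simp: prefix_def)
      then have "{\<gamma> \<in> \<Gamma>. prefix ?\<delta> \<gamma>} \<subset> \<Gamma>" using \<gamma>1(1) by blast
      then have "card {\<gamma> \<in> \<Gamma>. prefix ?\<delta> \<gamma>} < card \<Gamma>" using less.prems(1) by (rule psubset_card_mono[rotated])
      moreover have "card \<Gamma>' \<le> card {\<gamma> \<in> \<Gamma>. prefix ?\<delta> \<gamma>}"
        unfolding \<Gamma>'_def using less.prems(1) by (intro card_image_le) auto
      ultimately have card: "card \<Gamma>' < card \<Gamma>" by simp
      have fin: "finite \<Gamma>'" using less.prems(1) by (simp add: \<Gamma>'_def)
      have closed': "\<Gamma>' \<subseteq> {\<gamma>. awalk ?w \<gamma> ?w \<and> \<gamma> \<noteq> []}"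
        using \<Gamma>'D \<delta> walk_app by blast
      have "\<exists>\<delta>' z d. awalk ?w \<delta>' z \<and> d \<in> DId \<and> d \<notin> I \<and> V z * d \<approx> d \<and> d * V z \<approx> d \<and>
          (\<forall>\<gamma>\<in>\<Gamma>'. d * gho \<delta>' * re \<gamma> * re \<delta>' * d \<in> I)"
      proof (cases "\<Gamma>' = {}")
        case True
        then show ?thesis using f by (intro exI[of _ "[]"] exI[of _ ?w] exI[of _ "V ?w"])
          (auto simp: awalk_Nil_iff rel_VV V_DId)
      next
        case False
        then obtain \<tau> where \<tau>: "awalk ?w \<tau> v" using \<Gamma>'D by blast
        \<comment> \<open>A rotated walk contains a way back to \<open>v\<close>, so exitlessness
          would pass from \<open>?w\<close> to \<open>v\<close>.\<close>
        have "\<not> exitless I ?w" using exitless_trans[OF _ \<tau> less.prems(2) closed[OF \<gamma>1(1)]] less.prems(5) by blast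
        then show ?thesis using less.hyps[OF card fin f(5) _ closed'] f(2) by simp
      qed
      then obtain \<delta>' z d where d: "awalk ?w \<delta>' z" "d \<in> DId" "d \<notin> I" "V z * d \<approx> d" "d * V z \<approx> d"
          "\<And>\<gamma>. \<gamma> \<in> \<Gamma>' \<Longrightarrow> d * gho \<delta>' * re \<gamma> * re \<delta>' * d \<in> I" by blast
      have L: "d * gho \<delta>' \<approx> d * gho \<delta>' * V ?w"
      proof -
        have "d * gho \<delta>' \<approx> d * V z * gho \<delta>'" by (rule cT_rmult[OF cT_sym[OF d(5)]])
        also have "\<dots> = d * (V z * gho \<delta>')" by (simp add: mult.assoc)
        also have "\<dots> \<approx> d * (V z * gho \<delta>' * V ?w)" by (rule cT_lmult[OF cT_sym[OF gho_V[OF d(1)]]])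
        also have "\<dots> = d * V z * (gho \<delta>' * V ?w)" by (simp add: mult.assoc)
        also have "\<dots> \<approx> d * (gho \<delta>' * V ?w)" by (rule cT_rmult[OF d(5)])
        finally show ?thesis by (simp add: mult.assoc)
      qed
      have R0: "re \<delta>' * d \<approx> V ?w * (re \<delta>' * d)"
      proof -
        have "re \<delta>' * d \<approx> re \<delta>' * (V z * d)" by (rule cT_lmult[OF cT_sym[OF d(4)]])
        also have "\<dots> = (re \<delta>' * V z) * d" by (simp add: mult.assoc)
        also have "\<dots> \<approx> (V ?w * re \<delta>' * V z) * d" by (rule cT_rmult[OF cT_sym[OF V_re[OF d(1)]]])
        also have "\<dots> = V ?w * re \<delta>' * (V z * d)" by (simp add: mult.assoc)
        also have "\<dots> \<approx> V ?w * re \<delta>' * d" by (rule cT_lmult[OF d(4)])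
        finally show ?thesis by (simp add: mult.assoc)
      qed
      have R: "re ?\<delta> * (re \<delta>' * d) \<approx> V v * re ?\<delta> * (re \<delta>' * d)"
      proof -
        have "re ?\<delta> * (re \<delta>' * d) \<approx> re ?\<delta> * (V ?w * (re \<delta>' * d))" by (rule cT_lmult[OF R0])
        also have "\<dots> = (re ?\<delta> * V ?w) * (re \<delta>' * d)" by (simp only: mult.assoc)
        also have "\<dots> \<approx> (V v * re ?\<delta> * V ?w) * (re \<delta>' * d)" by (rule cT_rmult[OF cT_sym[OF V_re[OF \<delta>]]])
        also have "\<dots> = V v * re ?\<delta> * (V ?w * (re \<delta>' * d))" by (simp only: mult.assoc)
        also have "\<dots> \<approx> V v * re ?\<delta> * (re \<delta>' * d)" by (rule cT_lmult[OF cT_sym[OF R0]])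
        finally show ?thesis .
      qed
      have "d * gho (?\<delta> @ \<delta>') * re \<gamma> * re (?\<delta> @ \<delta>') * d \<in> I" if \<gamma>: "\<gamma> \<in> \<Gamma>" for \<gamma>
      proof -
        have "d * gho (?\<delta> @ \<delta>') * re \<gamma> * re (?\<delta> @ \<delta>') * d = (d * gho \<delta>') * (gho ?\<delta> * re \<gamma>) * (re ?\<delta> * (re \<delta>' * d))"
          by (simp add: mult.assoc)
        also have "\<dots> \<approx> (d * gho \<delta>' * V ?w) * (gho ?\<delta> * re \<gamma>) * (V v * re ?\<delta> * (re \<delta>' * d))"
          by (rule cT_mult[OF cT_rmult[OF L] R])
        finally have eq: "d * gho (?\<delta> @ \<delta>') * re \<gamma> * re (?\<delta> @ \<delta>') * d \<approx>
           (d * gho \<delta>' * V ?w) * (gho ?\<delta> * re \<gamma>) * (V v * re ?\<delta> * (re \<delta>' * d))" .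
        from prefix_cases[OF \<delta> len[OF \<gamma>] \<gamma>] show ?thesis
        proof (elim disjE exE conjE)
          assume "V ?w * gho ?\<delta> * re \<gamma> * V v \<in> T"
          then have "(d * gho \<delta>') * (V ?w * gho ?\<delta> * re \<gamma> * V v) * (re ?\<delta> * (re \<delta>' * d)) \<in> T" by (rule ts_mid[OF T])
          also have "(d * gho \<delta>') * (V ?w * gho ?\<delta> * re \<gamma> * V v) * (re ?\<delta> * (re \<delta>' * d)) =
            (d * gho \<delta>' * V ?w) * (gho ?\<delta> * re \<gamma>) * (V v * re ?\<delta> * (re \<delta>' * d))" by (simp only: mult.assoc)
          finally show ?thesis using cT_mem[OF eq] TI by blast
        next
          fix \<tau> assume \<tau>: "\<gamma> = ?\<delta> @ \<tau>" "awalk ?w \<tau> v" "gho ?\<delta> * re \<gamma> * V v \<approx> re \<tau> * V v"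
          have "(d * gho \<delta>' * V ?w) * (gho ?\<delta> * re \<gamma>) * (V v * re ?\<delta> * (re \<delta>' * d)) =
              (d * gho \<delta>' * V ?w) * (gho ?\<delta> * re \<gamma> * V v) * (re ?\<delta> * (re \<delta>' * d))" by (simp only: mult.assoc)
          also have "\<dots> \<approx> (d * gho \<delta>' * V ?w) * (re \<tau> * V v) * (re ?\<delta> * (re \<delta>' * d))"
            by (rule cT_mid[OF \<tau>(3)])
          also have "\<dots> = (d * gho \<delta>' * V ?w) * re \<tau> * (V v * re ?\<delta> * (re \<delta>' * d))" by (simp only: mult.assoc)
          also have "\<dots> \<approx> (d * gho \<delta>') * re \<tau> * (re ?\<delta> * (re \<delta>' * d))"
            by (rule cT_mult[OF cT_rmult[OF cT_sym[OF L]] cT_sym[OF R]])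
          also have "\<dots> = d * gho \<delta>' * re (\<tau> @ ?\<delta>) * re \<delta>' * d" by (simp add: mult.assoc)
          finally show ?thesis
            using cg_mem[OF I cgI[OF cT_trans[OF eq]]] d(6)[OF \<Gamma>'I] \<gamma> \<tau>(1) by blast
        qed
      qed
      moreover have "awalk v (?\<delta> @ \<delta>') z" using \<delta> d(1) walk_app[of v ?\<delta> \<delta>' z] by blast
      ultimately show ?thesis using d(2-5) by (intro exI[of _ "?\<delta> @ \<delta>'"] exI[of _ z] exI[of _ d] conjI ballI)
    next
      case noexit: False
      show ?thesis
      proof (cases "\<exists>\<mu> e \<nu>. \<gamma>1 = \<mu> @ e # \<nu> \<and> V (tail E e) - ed e * gh e \<notin> I")
        case True
        then obtain \<mu> e \<nu> where e: "\<gamma>1 = \<mu> @ e # \<nu>" "V (tail E e) - ed e * gh e \<notin> I" by blast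
        let ?w = "tail E e" and ?d = "V (tail E e) - ed e * gh e"
        have ea: "e \<in> arcs E" and \<mu>: "awalk v \<mu> ?w"
          using closed(1)[OF \<gamma>1(1)] e(1) by (auto simp: walk_app awalk_simps)
        have F: "finite {e}" "{e} \<subseteq> out_arcs E ?w" "?w \<in> verts E" using ea by auto
        note d = V_minus_edges[OF F, simplified]
        have "?d * gho \<mu> * re \<gamma> * re \<mu> * ?d \<in> I" if \<gamma>: "\<gamma> \<in> \<Gamma>" for \<gamma>
        proof -
          have R: "re \<mu> * ?d \<approx> V v * re \<mu> * ?d"
          proof -
            have "re \<mu> * ?d \<approx> re \<mu> * (V ?w * ?d)" by (rule cT_lmult[OF cT_sym[OF d(2)]])
            also have "\<dots> = (re \<mu> * V ?w) * ?d" by (simp only: mult.assoc)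
            also have "\<dots> \<approx> (V v * re \<mu> * V ?w) * ?d" by (rule cT_rmult[OF cT_sym[OF V_re[OF \<mu>]]])
            also have "\<dots> = V v * re \<mu> * (V ?w * ?d)" by (simp only: mult.assoc)
            also have "\<dots> \<approx> V v * re \<mu> * ?d" by (rule cT_lmult[OF d(2)])
            finally show ?thesis .
          qed
          have "?d * gho \<mu> * re \<gamma> * re \<mu> * ?d = ?d * (gho \<mu> * re \<gamma>) * (re \<mu> * ?d)" by (simp only: mult.assoc)
          also have "\<dots> \<approx> (?d * V ?w) * (gho \<mu> * re \<gamma>) * (V v * re \<mu> * ?d)"
            by (rule cT_mult[OF cT_rmult[OF cT_sym[OF d(3)]] R])
          finally have eq: "?d * gho \<mu> * re \<gamma> * re \<mu> * ?d \<approx> (?d * V ?w) * (gho \<mu> * re \<gamma>) * (V v * re \<mu> * ?d)" .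
          \<comment> \<open>The strict inequality makes \<open>\<tau>\<close> nonempty below, so
            that it starts with an edge at \<open>?w\<close>.\<close>
          have len: "length \<mu> < length \<gamma>" using \<gamma>1(2)[OF \<gamma>] e(1) by simp
          from prefix_cases[OF \<mu> less_imp_le[OF len] \<gamma>] show ?thesis
          proof (elim disjE exE conjE)
            assume "V ?w * gho \<mu> * re \<gamma> * V v \<in> T"
            then have "?d * (V ?w * gho \<mu> * re \<gamma> * V v) * (re \<mu> * ?d) \<in> T" by (rule ts_mid[OF T])
            also have "?d * (V ?w * gho \<mu> * re \<gamma> * V v) * (re \<mu> * ?d) = (?d * V ?w) * (gho \<mu> * re \<gamma>) * (V v * re \<mu> * ?d)"
              by (simp only: mult.assoc)
            finally show ?thesis using cT_mem[OF eq] TI by blast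
          next
            fix \<tau> assume \<tau>: "\<gamma> = \<mu> @ \<tau>" "awalk ?w \<tau> v" "gho \<mu> * re \<gamma> * V v \<approx> re \<tau> * V v"
            obtain g \<tau>' where g: "\<tau> = g # \<tau>'" "g \<in> arcs E" "tail E g = ?w"
              using \<tau>(1,2) len by (cases \<tau>) (auto simp: awalk_Cons_iff)
            \<comment> \<open>Either \<open>g\<close> is the edge removed in \<open>?d\<close>, or
              its range lies in \<open>I\<close> because \<open>\<gamma>1\<close> has no live
              exit.\<close>
            have dg: "?d * ed g \<in> I"
            proof (cases "g = e")
              case True
              then show ?thesis using d(5) TI by auto
            next
              case False
              then have "V (head E g) \<in> I" using noexit e(1) g by blast
              then have "ed g \<in> I" by (rule dead_ed[OF g(2)])
              then show ?thesis by (rule ts_lmult[OF I])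
            qed
            have "(?d * V ?w) * (gho \<mu> * re \<gamma>) * (V v * re \<mu> * ?d) \<approx> ?d * (gho \<mu> * re \<gamma>) * (V v * re \<mu> * ?d)"
              by (intro cT_rmult d(3))
            also have "\<dots> = ?d * (gho \<mu> * re \<gamma> * V v) * (re \<mu> * ?d)" by (simp only: mult.assoc)
            also have "\<dots> \<approx> ?d * (re \<tau> * V v) * (re \<mu> * ?d)" by (rule cT_mid[OF \<tau>(3)])
            also have "\<dots> = (?d * ed g) * (re \<tau>' * V v * (re \<mu> * ?d))" by (simp only: g re_simps mult.assoc)
            finally have eq2: "(?d * V ?w) * (gho \<mu> * re \<gamma>) * (V v * re \<mu> * ?d) \<approx> (?d * ed g) * (re \<tau>' * V v * (re \<mu> * ?d))" .
            have "(?d * ed g) * (re \<tau>' * V v * (re \<mu> * ?d)) \<in> I" by (rule ts_rmult[OF I dg])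
            then show ?thesis using cg_mem[OF I cgI[OF cT_trans[OF eq eq2]]] by blast
          qed
        qed
        then show ?thesis using \<mu> e(2) d(1-3)
          by (intro exI[of _ \<mu>] exI[of _ ?w] exI[of _ ?d] conjI ballI)
      next
        case False
        have start: "\<exists>\<mu> e \<nu>. \<gamma>1 = \<mu> @ e # \<nu> \<and> tail E e = v"
        proof -
          obtain e \<nu> where "\<gamma>1 = e # \<nu>" using closed(2)[OF \<gamma>1(1)] by (cases \<gamma>1) auto
          then have "\<gamma>1 = [] @ e # \<nu>" "tail E e = v" using closed(1)[OF \<gamma>1(1)] by (auto simp: awalk_Cons_iff)
          then show ?thesis by blast
        qed
        \<comment> \<open>Every live vertex reachable from \<open>v\<close> lies on
          \<open>\<gamma>1\<close>: a step into a live vertex must follow \<open>\<gamma>1\<close>,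
          and its last edge leads back to \<open>v\<close>.\<close>
        have pos: "\<exists>\<mu> e \<nu>. \<gamma>1 = \<mu> @ e # \<nu> \<and> tail E e = u" if "awalk v p u" "V u \<notin> I" for p u
          using that
        proof (induction p arbitrary: u rule: rev_induct)
          case Nil
          then show ?case using start by (simp add: awalk_Nil_iff)
        next
          case (snoc f p)
          then have f: "awalk v p (tail E f)" "f \<in> arcs E" "u = head E f" by (auto simp: walk_app awalk_simps)
          have "V (tail E f) \<notin> I"
          proof
            assume "V (tail E f) \<in> I"
            then have "V (tail E f) * ed f \<in> I" by (rule ts_rmult[OF I])
            then have "ed f \<in> I" using cg_mem[OF I cgI[OF rel_Ve[OF f(2)]]] by blast
            then have "gh f * ed f \<in> I" by (rule ts_lmult[OF I])
            then show False using cg_mem[OF I cgI[OF rel_ge[OF f(2)]]] snoc.prems(2) f(3) by blast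
          qed
          then obtain \<mu> e \<nu> where e: "\<gamma>1 = \<mu> @ e # \<nu>" "tail E e = tail E f" using snoc.IH f by blast
          then have "f = e" using noexit f snoc.prems(2) by metis
          show ?case
          proof (cases \<nu>)
            case Nil
            then have "u = v" using closed(1)[OF \<gamma>1(1)] e(1) f \<open>f = e\<close> by (auto simp: walk_app awalk_simps)
            then show ?thesis using start by simp
          next
            case (Cons e' \<nu>')
            then have "\<gamma>1 = (\<mu> @ [e]) @ e' # \<nu>'" using e by simp
            moreover have "tail E e' = u" using closed(1)[OF \<gamma>1(1)] e(1) Cons f \<open>f = e\<close> by (auto simp: walk_app awalk_simps)
            ultimately show ?thesis by blast
          qed
        qed
        have "exitless I v" unfolding exitless_def
        proof (intro conjI allI impI)
          show "\<exists>c. awalk v c v \<and> c \<noteq> []" using closed[OF \<gamma>1(1)] by blast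
          fix p u assume "awalk v p u" "V u \<notin> I"
          from pos[OF this] obtain \<mu> e \<nu> where e: "\<gamma>1 = \<mu> @ e # \<nu>" "tail E e = u" by blast
          then have "e \<in> arcs E" using closed(1)[OF \<gamma>1(1)] by (auto simp: walk_app awalk_simps)
          moreover have "V (tail E e) - ed e * gh e \<in> I" using False e(1) by blast
          ultimately show "\<exists>e\<in>out_arcs E u. V u - ed e * gh e \<in> I" using e(2) by (intro bexI[of _ e]) auto
        qed (fact less.prems)+
        then show ?thesis using less.prems(5) by blast
      qed
    qed
  qed
qed

end

section \<open>From an element outside the ideal to a cycle without exits\<close>

context leavitt_reduction
begin

text \<open>Quantifying over all finite supersets \<open>W'\<close> allows the vertex sets of the
  summands to be united; \<open>N\<close> bounds the ghost lengths for all \<open>v\<close> at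
  once.\<close>

lemma source_support:
  assumes "x \<in> M"
  shows "\<exists>W N. finite W \<and> W \<subseteq> verts E \<and> (\<forall>W'. finite W' \<longrightarrow> W' \<subseteq> verts E \<longrightarrow> W \<subseteq> W' \<longrightarrow> x * (\<Sum>w\<in>W'. V w) \<approx>\<^bsub>I\<^esub> x) \<and>
    (\<forall>v\<in>verts E. x * V v \<in> gspan I N v)"
  using assms unfolding M_eq
proof (induction rule: asp.induct)
  case zero
  then show ?case by (intro exI[of _ "{}"] exI[of _ 0]) (auto simp: gspan_def cg_refl[OF I] intro: asp.zero)
next
  case (step y x)
  from step.IH obtain W N where W0: "finite W" "W \<subseteq> verts E"
      "\<forall>W'. finite W' \<longrightarrow> W' \<subseteq> verts E \<longrightarrow> W \<subseteq> W' \<longrightarrow> x * (\<Sum>w\<in>W'. V w) \<approx>\<^bsub>I\<^esub> x"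
      "\<forall>v\<in>verts E. x * V v \<in> gspan I N v" by (elim exE conjE)
  note W = W0(1,2) W0(3)[rule_format] W0(4)[rule_format]
  have mono: "gspan I a v \<subseteq> gspan I b v" if "a \<le> b" for a b v
    unfolding gspan_def
  proof (intro asp_mono Un_mono subset_refl subsetI)
    fix x assume "x \<in> {sc k * mnl p w q | k p w q. wlk p w \<and> awalk v q w \<and> length q \<le> a}"
    then obtain k p w q where "x = sc k * mnl p w q" "wlk p w" "awalk v q w" "length q \<le> a" by blast
    moreover from this(4) that have "length q \<le> b" by simp
    ultimately show "x \<in> {sc k * mnl p w q | k p w q. wlk p w \<and> awalk v q w \<and> length q \<le> b}" by blast
  qed
  from step.hyps(1) show ?case
  proof
    assume y: "y \<in> T"
    have yI: "y * a \<in> I" for a using y TI by (intro ts_rmult[OF I]) auto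
    have "(y + x) * (\<Sum>w\<in>W'. V w) \<approx>\<^bsub>I\<^esub> y + x" if "finite W'" "W' \<subseteq> verts E" "W \<subseteq> W'" for W'
    proof -
      have "y * (\<Sum>w\<in>W'. V w) - y \<in> I" using yI y TI by (intro ts_diff[OF I]) auto
      then show ?thesis unfolding distrib_right using W(3)[OF that] by (intro cg_add[OF I]) (auto simp: cg_def)
    qed
    moreover have "(y + x) * V v \<in> gspan I N v" if "v \<in> verts E" for v
      using asp_add[OF asp_base[OF UnI1[OF yI]] W(4)[OF that, unfolded gspan_def]]
      unfolding distrib_right gspan_def .
    ultimately show ?thesis using W(1,2) by blast
  next
    assume "y \<in> Mons"
    then obtain k p w q where "y = sc k * mnl p w q" "wlk p w" "wlk q w" unfolding Mons_def by blast
    moreover from \<open>wlk q w\<close> obtain u where "awalk u q w" by (auto simp: wlk_def)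
    ultimately have y: "y = sc k * mnl p w q" "wlk p w" "awalk u q w" by blast+
    have u: "u \<in> verts E" using y(3) by blast
    have yV: "y * V v \<approx>\<^bsub>I\<^esub> (if v = u then y else 0)" if "v \<in> verts E" for v
    proof (cases "v = u")
      case True
      then show ?thesis using cgI[OF cT_lmult[OF gho_V[OF y(3)], of "sc k * re p"]]
        by (simp add: y(1) mnl_def mult.assoc)
    next
      case False
      have "sc k * re p * (V w * gho q * V v) \<in> I"
        using gho_V0[OF y(3) that False] TI by (intro ts_lmult[OF I, of "V w * gho q * V v"]) auto
      then show ?thesis using False by (simp add: y(1) mnl_def mult.assoc cg_zero)
    qed
    have "(y + x) * (\<Sum>w\<in>W'. V w) \<approx>\<^bsub>I\<^esub> y + x" if W': "finite W'" "W' \<subseteq> verts E" "insert u W \<subseteq> W'" for W'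
    proof -
      have "y * (\<Sum>w\<in>W'. V w) \<approx>\<^bsub>I\<^esub> (\<Sum>w\<in>W'. if w = u then y else 0)"
        unfolding sum_distrib_left by (intro cg_sum[OF I] yV subsetD[OF W'(2)])
      also have "(\<Sum>w\<in>W'. if w = u then y else 0) = y" using W' by auto
      finally show ?thesis unfolding distrib_right using W(3) W' by (intro cg_add[OF I]) auto
    qed
    moreover have "(y + x) * V v \<in> gspan I (max N (length q)) v" if v: "v \<in> verts E" for v
    proof -
      have "(if v = u then y else 0) \<in> gspan I (length q) v"
      proof (cases "v = u")
        case True
        then show ?thesis unfolding gspan_def y(1) using y(2,3) by (intro asp_base UnI2) auto
      qed (simp add: gspan_def asp.zero)
      then have "y * V v \<in> gspan I (length q) v" unfolding gspan_def by (rule asp_cg[OF I yV[OF v]])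
      then have "y * V v \<in> gspan I (max N (length q)) v" "x * V v \<in> gspan I (max N (length q)) v"
        using mono[of "length q" "max N (length q)" v] mono[of N "max N (length q)" v] W(4)[OF v] by auto
      then show ?thesis unfolding distrib_right gspan_def by (rule asp_add)
    qed
    moreover have "finite (insert u W)" "insert u W \<subseteq> verts E" using W u by auto
    ultimately show ?thesis by (intro exI[of _ "insert u W"] exI[of _ "max N (length q)"] conjI allI impI ballI)
  qed
qed

text \<open>An element of \<open>X\<close> outside \<open>I\<close> is cut down to
  \<open>k v\<close> plus closed walks at \<open>v\<close>. If \<open>v\<close> were not exitless,
  \<open>exits\<close> would conjugate this to \<open>k d\<close> modulo \<open>I\<close>, giving
  \<open>X\<close> a new diagonal idempotent.\<close>

theorem reduction:
  assumes "X \<noteq> I"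
  shows "\<exists>v y. exitless I v \<and> y \<in> X \<and> y \<notin> I \<and> V v * y * V v \<approx> y"
proof -
  obtain x where x: "x \<in> X" "x \<notin> I" using assms IX by blast
  then have "x \<in> M" using XM by blast
  from source_support[OF this] obtain W N where W0: "finite W" "W \<subseteq> verts E"
      "\<forall>W'. finite W' \<longrightarrow> W' \<subseteq> verts E \<longrightarrow> W \<subseteq> W' \<longrightarrow> x * (\<Sum>w\<in>W'. V w) \<approx>\<^bsub>I\<^esub> x"
      "\<forall>v\<in>verts E. x * V v \<in> gspan I N v" by (elim exE conjE)
  note W = W0(1,2) W0(3)[rule_format, OF W0(1,2) subset_refl] W0(4)[rule_format]
  have "\<exists>v\<in>W. x * V v \<notin> I"
  proof (rule ccontr)
    assume "\<not> (\<exists>v\<in>W. x * V v \<notin> I)"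
    then have "x * (\<Sum>w\<in>W. V w) \<in> I" unfolding sum_distrib_left by (intro ts_sum[OF I]) blast
    then show False using cg_mem[OF I W(3)] x by blast
  qed
  then obtain v where v: "v \<in> verts E" "x * V v \<notin> I" using W(2) by blast
  have "x * V v \<in> X" using x(1) by (rule ts_rmult[OF X])
  from remove_ghosts[OF this v(2) W(4)[OF v(1)] v(1)] obtain x1 v1
    where 1: "x1 \<in> X" "x1 \<notin> I" "x1 \<in> gspan I 0 v1" "v1 \<in> verts E" by blast
  from closed_part[OF 1(1-3)] obtain y k \<kappa> \<Gamma> where y: "y \<in> X" "y \<notin> I" "k \<noteq> 0" "finite \<Gamma>"
      "\<Gamma> \<subseteq> {\<gamma>. awalk v1 \<gamma> v1 \<and> \<gamma> \<noteq> []}"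
      "y \<approx>\<^bsub>I\<^esub> sc k * V v1 + (\<Sum>\<gamma>\<in>\<Gamma>. sc (\<kappa> \<gamma>) * (re \<gamma> * V v1))" by blast
  have "V v1 \<notin> I"
  proof
    assume "V v1 \<in> I"
    then have "sc k * V v1 + (\<Sum>\<gamma>\<in>\<Gamma>. sc (\<kappa> \<gamma>) * (re \<gamma> * V v1)) \<in> I"
      by (intro ts_add[OF I] ts_sum[OF I] ts_lmult[OF I])
    then show False using cg_mem[OF I y(6)] y(2) by blast
  qed
  have corner: "V v1 * y * V v1 \<approx>\<^bsub>I\<^esub> y"
  proof -
    have "V v1 * (sc k * V v1 + (\<Sum>\<gamma>\<in>\<Gamma>. sc (\<kappa> \<gamma>) * (re \<gamma> * V v1))) * V v1 =
        sc k * (V v1 * V v1 * V v1) + (\<Sum>\<gamma>\<in>\<Gamma>. sc (\<kappa> \<gamma>) * (V v1 * re \<gamma> * V v1 * V v1))"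
      by (simp add: distrib_left distrib_right sum_distrib_left sum_distrib_right mult.assoc sc_left)
    also have "\<dots> \<approx> sc k * V v1 + (\<Sum>\<gamma>\<in>\<Gamma>. sc (\<kappa> \<gamma>) * (re \<gamma> * V v1))"
    proof (intro cT_add cT_lmult cg_sum[OF T])
      have VV: "V v1 * V v1 \<approx> V v1" by (rule rel_VV[OF 1(4)])
      show "V v1 * V v1 * V v1 \<approx> V v1" by (rule cT_trans[OF cT_rmult[OF VV] VV])
      fix \<gamma> assume "\<gamma> \<in> \<Gamma>"
      then have w: "awalk v1 \<gamma> v1" using y(5) by blast
      have "V v1 * re \<gamma> * V v1 * V v1 \<approx> re \<gamma> * V v1 * V v1" by (rule cT_rmult[OF V_re[OF w]])
      also have "\<dots> = re \<gamma> * (V v1 * V v1)" by (simp add: mult.assoc)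
      also have "\<dots> \<approx> re \<gamma> * V v1" by (rule cT_lmult[OF VV])
      finally show "V v1 * re \<gamma> * V v1 * V v1 \<approx> re \<gamma> * V v1" .
    qed
    finally have eq: "V v1 * (sc k * V v1 + (\<Sum>\<gamma>\<in>\<Gamma>. sc (\<kappa> \<gamma>) * (re \<gamma> * V v1))) * V v1
        \<approx>\<^bsub>I\<^esub> sc k * V v1 + (\<Sum>\<gamma>\<in>\<Gamma>. sc (\<kappa> \<gamma>) * (re \<gamma> * V v1))" by (rule cgI)
    show ?thesis by (rule cgI_trans[OF cg_mid[OF I y(6)] cgI_trans[OF eq cg_sym[OF I y(6)]]])
  qed
  have "exitless I v1"
  proof (rule ccontr)
    assume "\<not> exitless I v1"
    from exits[OF y(4) \<open>V v1 \<notin> I\<close> 1(4) y(5) this] obtain \<delta> w d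
      where d: "awalk v1 \<delta> w" "d \<in> DId" "d \<notin> I" "V w * d \<approx> d" "d * V w \<approx> d"
        "\<And>\<gamma>. \<gamma> \<in> \<Gamma> \<Longrightarrow> d * gho \<delta> * re \<gamma> * re \<delta> * d \<in> I" by blast
    have R: "V v1 * re \<delta> * d \<approx> re \<delta> * d"
    proof -
      have "V v1 * re \<delta> * d \<approx> V v1 * re \<delta> * (V w * d)" by (rule cT_lmult[OF cT_sym[OF d(4)]])
      also have "\<dots> = (V v1 * re \<delta> * V w) * d" by (simp only: mult.assoc)
      also have "\<dots> \<approx> (re \<delta> * V w) * d" by (rule cT_rmult[OF V_re[OF d(1)]])
      also have "\<dots> = re \<delta> * (V w * d)" by (simp only: mult.assoc)
      also have "\<dots> \<approx> re \<delta> * d" by (rule cT_lmult[OF d(4)])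
      finally show ?thesis .
    qed
    have unit: "d * gho \<delta> * (re \<delta> * d) \<approx> d"
    proof -
      have "d * gho \<delta> * (re \<delta> * d) \<approx> d * gho \<delta> * (re \<delta> * (V w * d))"
        by (intro cT_lmult cT_sym[OF d(4)])
      also have "\<dots> = d * (gho \<delta> * re \<delta> * V w) * d" by (simp only: mult.assoc)
      also have "\<dots> \<approx> d * V w * d" by (rule cT_mid[OF gho_re[OF d(1)]])
      also have "\<dots> \<approx> d * d" by (rule cT_rmult[OF d(5)])
      also have "\<dots> \<approx> d" by (rule DId_idem[OF d(2)])
      finally show ?thesis .
    qed
    have "(d * gho \<delta>) * y * (re \<delta> * d) \<approx>\<^bsub>I\<^esub> (d * gho \<delta>) * (sc k * V v1 + (\<Sum>\<gamma>\<in>\<Gamma>. sc (\<kappa> \<gamma>) * (re \<gamma> * V v1))) * (re \<delta> * d)"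
      by (rule cg_mid[OF I y(6)])
    also have "\<dots> = sc k * (d * gho \<delta> * (V v1 * re \<delta> * d)) + (\<Sum>\<gamma>\<in>\<Gamma>. sc (\<kappa> \<gamma>) * (d * gho \<delta> * re \<gamma> * (V v1 * re \<delta> * d)))"
      by (simp add: distrib_left distrib_right sum_distrib_left sum_distrib_right mult.assoc sc_left)
    also have "\<dots> \<approx>\<^bsub>I\<^esub> sc k * d + 0"
    proof (intro cg_add[OF I] cg_lmult[OF I])
      show "d * gho \<delta> * (V v1 * re \<delta> * d) \<approx>\<^bsub>I\<^esub> d"
        by (rule cgI[OF cT_trans[OF cT_lmult[OF R] unit]])
      have "sc (\<kappa> \<gamma>) * (d * gho \<delta> * re \<gamma> * (V v1 * re \<delta> * d)) \<in> I" if "\<gamma> \<in> \<Gamma>" for \<gamma>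
      proof (rule ts_lmult[OF I])
        have "d * gho \<delta> * re \<gamma> * (re \<delta> * d) \<in> I" using d(6)[OF that] by (simp add: mult.assoc)
        then show "d * gho \<delta> * re \<gamma> * (V v1 * re \<delta> * d) \<in> I" using cg_mem[OF I cgI[OF cT_lmult[OF R]]] by blast
      qed
      then show "(\<Sum>\<gamma>\<in>\<Gamma>. sc (\<kappa> \<gamma>) * (d * gho \<delta> * re \<gamma> * (V v1 * re \<delta> * d))) \<approx>\<^bsub>I\<^esub> 0"
        by (simp add: cg_zero ts_sum[OF I])
    qed
    finally have "(d * gho \<delta>) * y * (re \<delta> * d) \<approx>\<^bsub>I\<^esub> sc k * d" by simp
    moreover have "(d * gho \<delta>) * y * (re \<delta> * d) \<in> X" by (rule ts_mid[OF X y(1)])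
    ultimately have "sc k * d \<in> X" using X_cg by blast
    then have "d \<in> X" by (rule sc_mem[OF X y(3)])
    then show False using nd d(2,3) by blast
  qed
  \<comment> \<open>\<open>y\<close> is known to lie in the corner only modulo \<open>I\<close>; the
    witness \<open>V v1 * y * V v1\<close> does so modulo \<open>T\<close>.\<close>
  moreover have "V v1 * (V v1 * y * V v1) * V v1 \<approx> V v1 * y * V v1"
    using cT_mult[OF cT_rmult[OF rel_VV[OF 1(4)], of y] rel_VV[OF 1(4)]] by (simp add: mult.assoc)
  moreover have "V v1 * y * V v1 \<in> X" by (rule ts_mid[OF X y(1)])
  moreover have "V v1 * y * V v1 \<notin> I" using cg_mem[OF I corner] y(2) by blast
  ultimately show ?thesis by blast
qed

end

section \<open>The corner at an exitless cycle\<close>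

lemma poly_ideal_principal:
  fixes F :: "'k::field poly set"
  assumes "0 \<in> F" "\<And>f g. f \<in> F \<Longrightarrow> g \<in> F \<Longrightarrow> f + g \<in> F" "\<And>f g. f \<in> F \<Longrightarrow> g * f \<in> F"
  obtains g where "F = {f. g dvd f}"
proof (cases "F = {0}")
  case True
  then show ?thesis by (intro that[of 0]) auto
next
  case False
  then obtain g0 where "g0 \<in> F \<and> g0 \<noteq> 0" using assms(1) by blast
  define g where "g = (ARG_MIN degree g. g \<in> F \<and> g \<noteq> 0)"
  have g: "g \<in> F \<and> g \<noteq> 0" unfolding g_def using \<open>g0 \<in> F \<and> g0 \<noteq> 0\<close> by (rule arg_min_natI)
  have le: "degree g \<le> degree f" if "f \<in> F \<and> f \<noteq> 0" for f
    unfolding g_def using that by (rule arg_min_nat_le)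
  have "g dvd f" if "f \<in> F" for f
  proof (rule ccontr)
    assume "\<not> g dvd f"
    then have nz: "f mod g \<noteq> 0" by (simp add: dvd_eq_mod_eq_0)
    have "f + (- (f div g)) * g \<in> F" using assms that g by blast
    also have "f + (- (f div g)) * g = f mod g" by (simp add: minus_div_mult_eq_mod[symmetric])
    finally have "degree g \<le> degree (f mod g)" using nz le by blast
    then show False using degree_mod_less[of g f] g nz by simp
  qed
  moreover have "f \<in> F" if dvd: "g dvd f" for f
  proof -
    obtain k where "f = k * g" using dvd by (auto simp: dvd_def mult.commute)
    then show ?thesis using assms(3)[of g k] g by simp
  qed
  ultimately show ?thesis by (intro that[of g]) auto
qed

context leavitt_family
begin

text \<open>Horner evaluation in a noncommutative ring. Coefficients enter through the central map
  \<open>sc\<close>, so evaluation is multiplicative.\<close>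

definition poly_at :: "'r \<Rightarrow> 'k poly \<Rightarrow> 'r" where
  "poly_at c f = fold_coeffs (\<lambda>a s. sc a + c * s) f 0"

lemma poly_at_0 [simp]: "poly_at c 0 = 0"
  by (simp add: poly_at_def)

lemma poly_at_pCons [simp]: "poly_at c (pCons a f) = sc a + c * poly_at c f"
  by (cases "a = 0 \<and> f = 0") (auto simp: poly_at_def)

lemma poly_at_1 [simp]: "poly_at c 1 = 1"
  by (simp add: one_pCons sc_one)

lemma poly_at_add: "poly_at c (f + g) = poly_at c f + poly_at c g"
  by (induction f g rule: poly_induct2) (simp_all add: sc_add algebra_simps)

lemma poly_at_smult: "poly_at c (smult a f) = sc a * poly_at c f"
  by (induction f) (simp_all add: sc_mult distrib_left sc_left)

lemma poly_at_mult: "poly_at c (f * g) = poly_at c f * poly_at c g"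
  by (induction f) (simp_all add: poly_at_add poly_at_smult distrib_right mult.assoc)

lemma poly_at_power: "poly_at c (f ^ n) = poly_at c f ^ n"
  by (induction n) (simp_all add: poly_at_mult)

lemma poly_at_X: "poly_at c [:0, 1:] = c"
  by (simp add: sc_one)

end

context leavitt_ideal
begin

text \<open>The vertices in an ideal are closed under following edges, because \<open>p* u p\<close>
  is the range of \<open>p\<close>.\<close>

lemma live_start:
  assumes "awalk u p w" "V u \<in> I" shows "V w \<in> I"
proof -
  have "gho p * V u * (re p * V w) \<in> I" using assms(2) by (rule ts_mid[OF I])
  moreover have "gho p * V u * (re p * V w) \<approx> gho p * (re p * V w)"
    using cT_lmult[OF V_re[OF assms(1)], of "gho p"] by (simp add: mult.assoc)
  moreover have "gho p * (re p * V w) \<approx> V w" using gho_re[OF assms(1)] by (simp add: mult.assoc)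
  ultimately show ?thesis using cg_mem[OF I cgI[OF cT_trans]] by blast
qed

end

locale leavitt_exitless = leavitt_ideal E V ed gh sc T M I
  for E :: "('v, 'e) pre_digraph" and V :: "'v \<Rightarrow> 'r::ring_1" and ed gh :: "'e \<Rightarrow> 'r"
    and sc :: "'k::field \<Rightarrow> 'r" and T :: "'r set" (structure) and M I :: "'r set" +
  fixes v :: 'v
  assumes exitless: "exitless I v"
begin

lemma v_verts: "v \<in> verts E" and v_live: "V v \<notin> I"
  using exitless by (auto simp: exitless_def)

text \<open>The edge granted by exitlessness must be \<open>f\<close>: multiplying
  \<open>u - e e*\<close> by a different edge \<open>f\<close> would put \<open>f\<close>, and with
  it the range of \<open>f\<close>, into \<open>I\<close>.\<close>

lemma exit_free:
  assumes "awalk v p u" "V u \<notin> I" "f \<in> out_arcs E u" "V (head E f) \<notin> I"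
  shows "V u - ed f * gh f \<in> I"
proof -
  obtain e where e: "e \<in> out_arcs E u" "V u - ed e * gh e \<in> I"
    using exitless assms(1,2) unfolding exitless_def by blast
  have "e = f"
  proof (rule ccontr)
    assume "e \<noteq> f"
    then have "ed e * (gh e * ed f) \<in> I"
      using rel_ge0[of e f] e assms(3) TI by (intro ts_lmult[OF I, of "gh e * ed f"]) auto
    moreover have "(V u - ed e * gh e) * ed f \<in> I" using e(2) by (rule ts_rmult[OF I])
    ultimately have "(V u - ed e * gh e) * ed f + ed e * (gh e * ed f) \<in> I" by (intro ts_add[OF I])
    then have "V u * ed f \<in> I" by (simp add: left_diff_distrib mult.assoc)
    then have "ed f \<in> I" using cg_mem[OF I cgI[OF rel_Ve[of f]]] assms(3) by simp
    then have "gh f * ed f \<in> I" by (rule ts_lmult[OF I])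
    then show False using cg_mem[OF I cgI[OF rel_ge[of f]]] assms(3,4) by simp
  qed
  then show ?thesis using e by simp
qed

lemma exit_free_unique:
  assumes "awalk v p u" "f \<in> out_arcs E u" "g \<in> out_arcs E u" "V (head E f) \<notin> I" "V (head E g) \<notin> I"
  shows "f = g"
proof (rule ccontr)
  assume "f \<noteq> g"
  have u: "V u \<notin> I" using live_start[of u "[f]" "head E f"] assms(2,4) by (auto simp: awalk_simps)
  have "(V u - ed f * gh f) * ed g \<in> I" by (intro ts_rmult[OF I] exit_free[OF assms(1) u assms(2,4)])
  moreover have "ed f * (gh f * ed g) \<in> I"
    using rel_ge0[of f g] \<open>f \<noteq> g\<close> assms TI by (intro ts_lmult[OF I, of "gh f * ed g"]) auto
  ultimately have "(V u - ed f * gh f) * ed g + ed f * (gh f * ed g) \<in> I" by (intro ts_add[OF I])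
  then have "V u * ed g \<in> I" by (simp add: left_diff_distrib mult.assoc)
  then have "ed g \<in> I" using cg_mem[OF I cgI[OF rel_Ve[of g]]] assms(3) by simp
  then have "gh g * ed g \<in> I" by (rule ts_lmult[OF I])
  then show False using cg_mem[OF I cgI[OF rel_ge[of g]]] assms(3,5) by simp
qed

text \<open>Edges are peeled off the end of \<open>p\<close>; each \<open>f f*\<close> met on the
  way is the source of \<open>f\<close> modulo \<open>I\<close>.\<close>

lemma mnl_V: "awalk v p w \<Longrightarrow> V w \<notin> I \<Longrightarrow> mnl p w p \<approx>\<^bsub>I\<^esub> V v"
proof (induction p arbitrary: w rule: rev_induct)
  case Nil
  then show ?case by (simp add: awalk_Nil_iff mnl_def cg_refl[OF I])
next
  case (snoc f p)
  then have f: "awalk v p (tail E f)" "f \<in> arcs E" "w = head E f" by (auto simp: walk_app awalk_simps)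
  have u: "V (tail E f) \<notin> I"
    using live_start[of "tail E f" "[f]" w] f snoc.prems(2) by (auto simp: awalk_simps)
  have "mnl (p @ [f]) w (p @ [f]) = re p * (ed f * V w * gh f) * gho p" by (simp add: mnl_def mult.assoc)
  also have "\<dots> \<approx>\<^bsub>I\<^esub> re p * (ed f * gh f) * gho p"
    using cT_rmult[OF rel_eV[OF f(2)], of "gh f"] f(3) by (intro cg_mid[OF I] cgI) simp
  also have "\<dots> \<approx>\<^bsub>I\<^esub> re p * V (tail E f) * gho p"
    by (rule cg_mid[OF I cg_sym[OF I]]) (use exit_free[OF f(1) u, of f] f snoc.prems(2) in \<open>simp add: cg_def\<close>)
  also have "\<dots> \<approx>\<^bsub>I\<^esub> V v" using snoc.IH[OF f(1) u] by (simp add: mnl_def)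
  finally show ?case .
qed

text \<open>At a branching point two different edges would both have a live range, since all
  vertices on a walk with live end are live.\<close>

lemma walks_prefix:
  assumes "awalk v p w" "V w \<notin> I" "awalk v q z" "V z \<notin> I" "length p \<le> length q"
  shows "prefix p q"
proof -
  have "\<not> p \<parallel> q"
  proof
    assume "p \<parallel> q"
    then obtain as e p' f q' where *: "e \<noteq> f" "p = as @ e # p'" "q = as @ f # q'"
      using parallel_decomp by blast
    obtain u where u: "awalk v as u" "awalk u (e # p') w" using assms(1) * by (auto simp: walk_app)
    obtain u' where u': "awalk v as u'" "awalk u' (f # q') z" using assms(3) * by (auto simp: walk_app)
    have "u = u'" using awalk_end_unique[OF u(1) u'(1)] u(1) u'(1) by (cases "as = []") (auto simp: awalk_Nil_iff)
    then have "e \<in> out_arcs E u" "f \<in> out_arcs E u" "awalk (head E e) p' w" "awalk (head E f) q' z"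
      using u u' by (auto simp: awalk_Cons_iff)
    then show False using exit_free_unique[OF u(1)] live_start assms(2,4) *(1) by blast
  qed
  then show ?thesis using assms(5) by (auto simp: parallel_def prefix_def)
qed

text \<open>Minimal length together with the comparability of live walks makes every closed walk at
  \<open>v\<close> a power of this one.\<close>

definition "cyc = (ARG_MIN length c. awalk v c v \<and> c \<noteq> [])"

lemma cyc: "awalk v cyc v" "cyc \<noteq> []" and cyc_min: "awalk v c v \<Longrightarrow> c \<noteq> [] \<Longrightarrow> length cyc \<le> length c"
proof -
  obtain c0 where "awalk v c0 v \<and> c0 \<noteq> []" using exitless by (auto simp: exitless_def)
  from arg_min_natI[of "\<lambda>c. awalk v c v \<and> c \<noteq> []", OF this, of length] show "awalk v cyc v" "cyc \<noteq> []" by (auto simp: cyc_def)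
  show "awalk v c v \<Longrightarrow> c \<noteq> [] \<Longrightarrow> length cyc \<le> length c"
    unfolding cyc_def by (rule arg_min_nat_le) blast
qed

definition "cycs n = concat (replicate n cyc)"

lemma cycs_simps [simp]: "cycs 0 = []" "cycs (Suc n) = cyc @ cycs n"
  by (simp_all add: cycs_def)

lemma cycs_walk: "awalk v (cycs n) v"
  by (induction n) (use cyc v_verts in \<open>auto simp: awalk_Nil_iff walk_app\<close>)

lemma closed_walks: "awalk v q v \<Longrightarrow> \<exists>n. q = cycs n"
proof (induction "length q" arbitrary: q rule: less_induct)
  case less
  show ?case
  proof (cases "q = []")
    case True
    then show ?thesis by (intro exI[of _ 0]) simp
  next
    case False
    then obtain q' where q': "q = cyc @ q'"
      using walks_prefix[OF cyc(1) v_live less.prems v_live cyc_min[OF less.prems]] by (auto simp: prefix_def)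
    then obtain z where z: "awalk v cyc z" "awalk z q' v" using less.prems by (auto simp: walk_app)
    have "awalk v q' v" using z awalk_end_unique[OF z(1) cyc(1) cyc(2)] by simp
    moreover have "length q' < length q" using q' cyc(2) by simp
    ultimately obtain n where "q' = cycs n" using less.hyps by blast
    then show ?thesis using q' by (intro exI[of _ "Suc n"]) simp
  qed
qed

text \<open>A nonempty \<open>p\<close> is an initial piece of a power of the cycle, and the
  remainder of that power leads back. The exponent \<open>length p\<close> merely makes the power
  long enough.\<close>

lemma return:
  assumes "awalk v p w" "V w \<notin> I"
  shows "\<exists>\<sigma>. awalk w \<sigma> v"
proof (cases "p = []")
  case True
  then show ?thesis using assms(1) by (auto simp: awalk_Nil_iff intro!: exI[of _ "[]"])
next
  case False
  have "n \<le> length (cycs n)" for n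
  proof (induction n)
    case (Suc n)
    have "0 < length cyc" using cyc(2) by simp
    with Suc show ?case by (simp del: length_greater_0_conv)
  qed simp
  then have "prefix p (cycs (length p))" by (intro walks_prefix[OF assms cycs_walk v_live])
  then obtain \<sigma> where "cycs (length p) = p @ \<sigma>" by (auto simp: prefix_def)
  then obtain z where "awalk v p z" "awalk z \<sigma> v" using cycs_walk[of "length p"] by (auto simp: walk_app)
  then show ?thesis using awalk_end_unique[OF _ assms(1) False] by blast
qed

lemma exitless_reachable:
  assumes "awalk v p w" "V w \<notin> I" shows "exitless I w"
proof (cases "p = []")
  case True
  then show ?thesis using assms(1) exitless by (simp add: awalk_Nil_iff)
next
  case False
  obtain \<sigma> where "awalk w \<sigma> v" using return[OF assms] by blast
  then have "awalk w (\<sigma> @ p) w" using assms(1) walk_app[of w \<sigma> p w] by blast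
  then show ?thesis by (rule exitless_trans[OF exitless assms]) (simp add: False)
qed

text \<open>The cycle and its ghost, inverse to each other with unit \<open>V v\<close>:
  \<open>G * C\<close> modulo \<open>T\<close>, but \<open>C * G\<close> only modulo
  \<open>I\<close>, where the absence of exits enters.\<close>

definition "C = re cyc * V v"
definition "G = V v * gho cyc"

lemma VV: "V v * V v \<approx> V v" by (rule rel_VV[OF v_verts])

lemma VC: "V v * C \<approx> C" and CV: "C * V v \<approx> C"
  and GC: "G * C \<approx> V v"
  using V_re[OF cyc(1)] cT_lmult[OF VV, of "re cyc"] gho_V[OF cyc(1)] cT_rmult[OF VV, of "gho cyc"]
    V_gho_re[OF cyc(1)]
  by (simp_all add: C_def G_def mult.assoc)

lemma CG: "C * G \<approx>\<^bsub>I\<^esub> V v"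
proof -
  have "C * G = re cyc * (V v * V v) * gho cyc" by (simp add: C_def G_def mult.assoc)
  also have "\<dots> \<approx>\<^bsub>I\<^esub> re cyc * V v * gho cyc" by (intro cgI cT_mid VV)
  also have "\<dots> \<approx>\<^bsub>I\<^esub> V v" using mnl_V[OF cyc(1) v_live] by (simp add: mnl_def)
  finally show ?thesis .
qed

lemma re_cycs: "re (cycs n) * V v \<approx> C ^ n * V v"
proof (induction n)
  case (Suc n)
  have "re (cycs (Suc n)) * V v = re cyc * (re (cycs n) * V v)" by (simp add: mult.assoc)
  also have "\<dots> \<approx> re cyc * (V v * re (cycs n) * V v)" by (rule cT_lmult[OF cT_sym[OF V_re[OF cycs_walk]]])
  also have "\<dots> = C * (re (cycs n) * V v)" by (simp add: C_def mult.assoc)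
  also have "\<dots> \<approx> C * (C ^ n * V v)" by (rule cT_lmult[OF Suc])
  finally show ?case by (simp add: mult.assoc)
qed simp

lemma gho_cycs: "V v * gho (cycs n) \<approx> V v * G ^ n"
proof (induction n)
  case (Suc n)
  have "V v * gho (cycs (Suc n)) = (V v * gho (cycs n)) * gho cyc" by (simp add: mult.assoc)
  also have "\<dots> \<approx> (V v * gho (cycs n) * V v) * gho cyc" by (rule cT_rmult[OF cT_sym[OF gho_V[OF cycs_walk]]])
  also have "\<dots> = (V v * gho (cycs n)) * G" by (simp add: G_def mult.assoc)
  also have "\<dots> \<approx> V v * G ^ n * G" by (rule cT_rmult[OF Suc])
  finally show ?case by (simp add: mult.assoc power_Suc2 del: power_Suc)
qed simp

lemma G_pow_C_pow: "G ^ n * (C ^ n * V v) \<approx> V v"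
proof (induction n)
  case (Suc n)
  have "G ^ Suc n * (C ^ Suc n * V v) = G ^ n * (G * C) * (C ^ n * V v)"
    by (simp add: power_Suc2 mult.assoc del: power_Suc) (simp add: power_commutes mult.assoc[symmetric])
  also have "\<dots> \<approx> G ^ n * V v * (C ^ n * V v)" by (rule cT_mid[OF GC])
  also have "\<dots> = G ^ n * (V v * (C ^ n * V v))" by (simp add: mult.assoc)
  also have "\<dots> \<approx> G ^ n * (C ^ n * V v)"
  proof (rule cT_lmult)
    show "V v * (C ^ n * V v) \<approx> C ^ n * V v"
      using VV cT_rmult[OF VC, of "C ^ (n - 1) * V v"] by (cases n) (simp_all add: mult.assoc)
  qed
  also have "\<dots> \<approx> V v" by (rule Suc)
  finally show ?case .
qed simp

lemma C_pow_G_pow: "C ^ n * V v * G ^ n \<approx>\<^bsub>I\<^esub> V v"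
proof (induction n)
  case 0
  then show ?case by (simp add: cg_refl[OF I])
next
  case (Suc n)
  have "C ^ Suc n * V v * G ^ Suc n = C * (C ^ n * V v * G ^ n) * G"
    by (simp add: mult.assoc power_commutes)
  also have "\<dots> \<approx>\<^bsub>I\<^esub> C * V v * G" by (rule cg_mid[OF I Suc])
  also have "\<dots> \<approx>\<^bsub>I\<^esub> C * G" by (rule cgI[OF cT_rmult[OF CV]])
  also have "\<dots> \<approx>\<^bsub>I\<^esub> V v" by (rule CG)
  finally show ?case .
qed

text \<open>Polynomials evaluated inside the corner, whose unit is \<open>V v\<close>.\<close>

definition "ev f = poly_at C f * V v"

lemma V_ev: "V v * ev f \<approx> ev f"
proof (induction f)
  case (pCons a f)
  have "V v * ev (pCons a f) = sc a * (V v * V v) + V v * C * (poly_at C f * V v)"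
    by (simp add: ev_def distrib_left distrib_right mult.assoc sc_left)
  also have "\<dots> \<approx> sc a * V v + C * (poly_at C f * V v)"
    by (intro cT_add cT_lmult[OF VV] cT_rmult[OF VC])
  finally show ?case by (simp add: ev_def distrib_right mult.assoc)
qed (simp add: ev_def)

lemma ev_mult: "ev (f * g) = poly_at C f * ev g"
  by (simp add: ev_def poly_at_mult mult.assoc)

lemma ev_ev: "ev f * ev g \<approx> ev (f * g)"
  using cT_lmult[OF V_ev[of g], of "poly_at C f"] unfolding ev_mult by (simp add: ev_def mult.assoc)

lemma ev_0 [simp]: "ev 0 = 0" and ev_1 [simp]: "ev 1 = V v" and ev_add: "ev (f + g) = ev f + ev g"
  by (simp_all add: ev_def poly_at_add distrib_right)

lemma C_pow_ev: "C ^ n * ev f = ev ([:0, 1:] ^ n * f)"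
  by (simp only: ev_mult poly_at_power poly_at_X)

lemma ev_M: "ev f \<in> M"
  unfolding ev_def by (rule ts_lmult[OF M V_M[OF v_verts]])

lemma G_pow_ev: "G ^ n * ev ([:0, 1:] ^ n * f) \<approx>\<^bsub>I\<^esub> ev f"
proof -
  have "G ^ n * ev ([:0, 1:] ^ n * f) = G ^ n * (C ^ n * ev f)" by (simp only: C_pow_ev)
  also have "\<dots> \<approx> G ^ n * (C ^ n * (V v * ev f))" by (intro cT_lmult cT_sym[OF V_ev])
  also have "\<dots> = G ^ n * (C ^ n * V v) * ev f" by (simp only: mult.assoc)
  also have "\<dots> \<approx> V v * ev f" by (rule cT_rmult[OF G_pow_C_pow])
  also have "\<dots> \<approx> ev f" by (rule V_ev)
  finally show ?thesis by (rule cgI)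
qed

text \<open>A return walk \<open>\<sigma>\<close> makes \<open>p \<sigma>\<close> and
  \<open>q \<sigma>\<close> powers of the cycle, so \<open>p q* = p \<sigma> \<sigma>* q*\<close>
  becomes \<open>C^i G^j\<close>. Multiplying by \<open>C^j\<close> clears the ghosts.\<close>

lemma corner_mnl:
  assumes "wlk p w" "wlk q w"
  shows "\<exists>n f. C ^ n * (V v * mnl p w q * V v) \<approx>\<^bsub>I\<^esub> ev f"
proof (cases "awalk v p w \<and> awalk v q w \<and> V w \<notin> I")
  case True
  then obtain \<sigma> where \<sigma>: "awalk w \<sigma> v" using return by blast
  \<comment> \<open>Exitlessness at \<open>w\<close> is what makes \<open>\<sigma> \<sigma>*\<close>
    congruent to \<open>V w\<close>.\<close>
  interpret w: leavitt_exitless E V ed gh sc T M I w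
    using exitless_reachable True by unfold_locales blast
  obtain i j where ij: "p @ \<sigma> = cycs i" "q @ \<sigma> = cycs j"
    using closed_walks walk_app \<sigma> True by metis
  have "mnl p w q \<approx>\<^bsub>I\<^esub> re p * mnl \<sigma> v \<sigma> * gho q"
    using cg_mid[OF I cg_sym[OF I w.mnl_V[OF \<sigma> v_live]], of "re p" "gho q"] by (simp add: mnl_def)
  also have "re p * mnl \<sigma> v \<sigma> * gho q = re (cycs i) * V v * gho (cycs j)"
    by (simp add: mnl_def mult.assoc ij[symmetric])
  also have "\<dots> \<approx>\<^bsub>I\<^esub> C ^ i * V v * gho (cycs j)" by (intro cgI cT_rmult re_cycs)
  also have "\<dots> = C ^ i * (V v * gho (cycs j))" by (simp add: mult.assoc)
  also have "\<dots> \<approx>\<^bsub>I\<^esub> C ^ i * (V v * G ^ j)" by (intro cgI cT_lmult gho_cycs)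
  finally have *: "mnl p w q \<approx>\<^bsub>I\<^esub> C ^ i * (V v * G ^ j)" .
  have "V v * mnl p w q * V v \<approx> mnl p w q"
  proof -
    have "V v * mnl p w q * V v = V v * re p * (V w * gho q * V v)" by (simp add: mnl_def mult.assoc)
    also have "\<dots> \<approx> V v * re p * (V w * gho q)" using True by (intro cT_lmult gho_V) blast
    also have "\<dots> = (V v * re p * V w) * gho q" by (simp add: mult.assoc)
    also have "\<dots> \<approx> (re p * V w) * gho q" using True by (intro cT_rmult V_re) blast
    finally show ?thesis by (simp add: mnl_def)
  qed
  then have "C ^ j * (V v * mnl p w q * V v) \<approx>\<^bsub>I\<^esub> C ^ j * (C ^ i * (V v * G ^ j))"
    by (intro cg_lmult[OF I] cgI_trans[OF cgI *])
  also have "\<dots> = C ^ i * (C ^ j * V v * G ^ j)"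
    by (simp add: mult.assoc[symmetric] power_add[symmetric] add.commute)
  also have "\<dots> \<approx>\<^bsub>I\<^esub> C ^ i * V v" by (rule cg_lmult[OF I C_pow_G_pow])
  also have "\<dots> = ev ([:0, 1:] ^ i)" using C_pow_ev[of i 1] by simp
  finally show ?thesis by blast
next
  case False
  have "V v * mnl p w q * V v \<in> I"
  proof (cases "V w \<in> I")
    case True
    then have "(V v * re p) * V w * (gho q * V v) \<in> I" by (rule ts_mid[OF I])
    then show ?thesis by (simp add: mnl_def mult.assoc)
  next
    case w: False
    show ?thesis
    proof (cases "awalk v p w")
      case True
      then have "\<not> awalk v q w" using False w by blast
      then have "V w * gho q * V v \<in> T" using assms(2) gho_V0 v_verts by (metis wlk_def)
      then have "V v * re p * (V w * gho q * V v) \<in> I"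
        using TI by (intro ts_lmult[OF I, of "V w * gho q * V v"]) auto
      then show ?thesis by (simp add: mnl_def mult.assoc)
    next
      case False
      then have "V v * re p * V w \<in> T" using assms(1) V_re0 v_verts by (metis wlk_def)
      then have "V v * re p * V w * (gho q * V v) \<in> I"
        using TI by (intro ts_rmult[OF I, of "V v * re p * V w"]) auto
      then show ?thesis by (simp add: mnl_def mult.assoc)
    qed
  qed
  then show ?thesis by (intro exI[of _ 0]) (auto simp: cg_def intro!: exI[of _ 0])
qed

text \<open>A Laurent polynomial is represented by a polynomial and a power of \<open>C\<close>
  clearing its denominator; two summands are brought to a common power.\<close>

lemma corner:
  assumes "y \<in> M"
  shows "\<exists>n f. C ^ n * (V v * y * V v) \<approx>\<^bsub>I\<^esub> ev f"
  using assms unfolding M_eq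
proof (induction rule: asp.induct)
  case zero
  show ?case by (intro exI[of _ 0]) (simp add: cg_refl[OF I])
next
  case (step y x)
  have "\<exists>n f. C ^ n * (V v * y * V v) \<approx>\<^bsub>I\<^esub> ev f"
    using step.hyps(1)
  proof
    assume "y \<in> T"
    then have "V v * y * V v \<in> I" using ts_mid[OF T, of y "V v" "V v"] TI by blast
    then show ?thesis by (intro exI[of _ 0]) (simp add: cg_zero)
  next
    assume "y \<in> Mons"
    then obtain k p w q where y: "y = sc k * mnl p w q" "wlk p w" "wlk q w" unfolding Mons_def by blast
    obtain n f where nf: "C ^ n * (V v * mnl p w q * V v) \<approx>\<^bsub>I\<^esub> ev f" using corner_mnl[OF y(2,3)] by blast
    have "C ^ n * (V v * y * V v) = sc k * (C ^ n * (V v * mnl p w q * V v))"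
      by (simp add: y(1) mult.assoc sc_left)
    also have "\<dots> \<approx>\<^bsub>I\<^esub> sc k * ev f" by (rule cg_lmult[OF I nf])
    also have "\<dots> = ev (smult k f)" by (simp add: ev_def poly_at_smult mult.assoc)
    finally show ?thesis by blast
  qed
  then obtain n f where f: "C ^ n * (V v * y * V v) \<approx>\<^bsub>I\<^esub> ev f" by blast
  obtain m g where g: "C ^ m * (V v * x * V v) \<approx>\<^bsub>I\<^esub> ev g" using step.IH by blast
  have "C ^ (n + m) * (V v * (y + x) * V v) =
      C ^ m * (C ^ n * (V v * y * V v)) + C ^ n * (C ^ m * (V v * x * V v))"
    by (simp add: distrib_left distrib_right mult.assoc[symmetric] power_add[symmetric] add.commute)
  moreover have "C ^ m * (C ^ n * (V v * y * V v)) + C ^ n * (C ^ m * (V v * x * V v))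
      \<approx>\<^bsub>I\<^esub> C ^ m * ev f + C ^ n * ev g"
    by (intro cg_add[OF I] cg_lmult[OF I] f g)
  moreover have "C ^ m * ev f + C ^ n * ev g = ev ([:0, 1:] ^ m * f + [:0, 1:] ^ n * g)"
    by (simp only: C_pow_ev ev_add)
  ultimately have "C ^ (n + m) * (V v * (y + x) * V v) \<approx>\<^bsub>I\<^esub> ev ([:0, 1:] ^ m * f + [:0, 1:] ^ n * g)"
    by simp
  then show ?case by blast
qed

lemma corner_inverse:
  assumes "C ^ n * (V v * y * V v) \<approx>\<^bsub>I\<^esub> ev f"
  shows "V v * y * V v \<approx>\<^bsub>I\<^esub> G ^ n * ev f"
proof -
  have "V v * y * V v \<approx> V v * (V v * y * V v)"
    using cT_rmult[OF cT_sym[OF VV], of "y * V v"] by (simp add: mult.assoc)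
  also have "\<dots> \<approx> G ^ n * (C ^ n * V v) * (V v * y * V v)" by (rule cT_rmult[OF cT_sym[OF G_pow_C_pow]])
  also have "\<dots> = G ^ n * C ^ n * (V v * (V v * y * V v))" by (simp only: mult.assoc)
  also have "\<dots> \<approx> G ^ n * C ^ n * (V v * y * V v)"
    using cT_rmult[OF VV, of "y * V v"] by (intro cT_lmult) (simp add: mult.assoc)
  finally have "V v * y * V v \<approx>\<^bsub>I\<^esub> G ^ n * (C ^ n * (V v * y * V v))" by (simp add: cgI mult.assoc)
  also have "\<dots> \<approx>\<^bsub>I\<^esub> G ^ n * ev f" by (rule cg_lmult[OF I assms])
  finally show ?thesis .
qed

text \<open>\<open>C\<close> is invertible in the corner modulo \<open>I\<close>, so clearing
  denominators does not affect membership in an ideal above \<open>I\<close>.\<close>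

lemma corner_mem:
  assumes "two_sided K" "I \<subseteq> K" "C ^ n * (V v * y * V v) \<approx>\<^bsub>I\<^esub> ev f"
  shows "V v * y * V v \<in> K \<longleftrightarrow> ev f \<in> K"
proof
  assume "V v * y * V v \<in> K"
  then have "C ^ n * (V v * y * V v) \<in> K" by (rule ts_lmult[OF assms(1)])
  then show "ev f \<in> K" using cg_mem[OF assms(1) cg_mono[OF assms(3,2)]] by blast
next
  assume "ev f \<in> K"
  then have "G ^ n * ev f \<in> K" by (rule ts_lmult[OF assms(1)])
  then show "V v * y * V v \<in> K" using cg_mem[OF assms(1) cg_mono[OF corner_inverse[OF assms(3)] assms(2)]] by blast
qed

lemma ev_cancel_X:
  assumes "two_sided K" "I \<subseteq> K"
  shows "ev ([:0, 1:] ^ n * f) \<in> K \<longleftrightarrow> ev f \<in> K"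
proof
  assume "ev ([:0, 1:] ^ n * f) \<in> K"
  then have "G ^ n * ev ([:0, 1:] ^ n * f) \<in> K" by (rule ts_lmult[OF assms(1)])
  then show "ev f \<in> K" using cg_mem[OF assms(1) cg_mono[OF G_pow_ev assms(2)]] by blast
next
  assume "ev f \<in> K"
  then show "ev ([:0, 1:] ^ n * f) \<in> K" unfolding ev_mult by (rule ts_lmult[OF assms(1)])
qed

lemma ev_principal:
  assumes "two_sided K"
  obtains g where "\<And>f. ev f \<in> K \<longleftrightarrow> g dvd f"
proof -
  have "\<exists>g. {f. ev f \<in> K} = {f. g dvd f}"
  proof (rule poly_ideal_principal[of "{f. ev f \<in> K}"])
    show "0 \<in> {f. ev f \<in> K}" by (simp add: ts_zero[OF assms])
    show "f + g \<in> {f. ev f \<in> K}" if "f \<in> {f. ev f \<in> K}" "g \<in> {f. ev f \<in> K}" for f g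
      using that by (simp add: ev_add ts_add[OF assms])
    show "g * f \<in> {f. ev f \<in> K}" if "f \<in> {f. ev f \<in> K}" for f g
      using that by (simp add: ev_mult ts_lmult[OF assms])
  qed blast
  then show ?thesis using that by blast
qed

lemma C_commute: "C ^ n * poly_at C f = poly_at C f * C ^ n"
proof -
  have "poly_at C ([:0, 1:] ^ n * f) = poly_at C (f * [:0, 1:] ^ n)" by (simp only: mult.commute)
  then show ?thesis by (simp only: poly_at_mult poly_at_power poly_at_X)
qed

text \<open>\<open>v u v\<close> is a polynomial in the cycle up to a power of \<open>C\<close>, and
  polynomials in \<open>C\<close> commute with \<open>C\<close>. This is the form in which the
  commutativity of the corner is used.\<close>

lemma ev_middle: "\<exists>n h. C ^ n * (ev f * u * ev g) \<approx>\<^bsub>I\<^esub> ev (f * h * g)"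
proof -
  have "V v * u \<in> M" by (rule ts_rmult[OF M V_M[OF v_verts]])
  then obtain n h where h: "C ^ n * (V v * (V v * u) * V v) \<approx>\<^bsub>I\<^esub> ev h" using corner by blast
  have "C ^ n * (ev f * u * ev g) = (C ^ n * poly_at C f) * V v * u * ev g"
    by (simp only: ev_def mult.assoc)
  also have "\<dots> = poly_at C f * C ^ n * V v * (u * ev g)" by (simp only: C_commute mult.assoc)
  also have "\<dots> \<approx> poly_at C f * C ^ n * (V v * V v) * (u * (V v * ev g))"
    by (intro cT_mult[OF cT_lmult[OF cT_sym[OF VV]] cT_lmult[OF cT_sym[OF V_ev]]])
  also have "\<dots> = poly_at C f * (C ^ n * (V v * (V v * u) * V v)) * ev g" by (simp only: mult.assoc)
  finally have "C ^ n * (ev f * u * ev g) \<approx>\<^bsub>I\<^esub> poly_at C f * (C ^ n * (V v * (V v * u) * V v)) * ev g"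
    by (rule cgI)
  also have "\<dots> \<approx>\<^bsub>I\<^esub> poly_at C f * ev h * ev g" by (rule cg_mid[OF I h])
  also have "\<dots> \<approx>\<^bsub>I\<^esub> poly_at C f * ev (h * g)"
    using cgI[OF cT_lmult[OF ev_ev[of h g], of "poly_at C f"]] by (simp only: mult.assoc)
  also have "\<dots> = ev (f * h * g)" by (simp only: ev_mult mult.assoc)
  finally show ?thesis by blast
qed

text \<open>The middle factor \<open>u\<close> turns into a polynomial, which can be moved out of
  the way to leave a multiple of \<open>f * g\<close>.\<close>

lemma ev_sandwich:
  assumes K: "two_sided K" "I \<subseteq> K" and "ev (f * g) \<in> K"
  shows "ev f * u * ev g \<in> K"
proof -
  obtain n h where h: "C ^ n * (ev f * u * ev g) \<approx>\<^bsub>I\<^esub> ev (f * h * g)" using ev_middle by blast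
  have "f * h * g = h * (f * g)" by (simp only: mult_ac)
  then have "ev (f * h * g) \<in> K" using ts_lmult[OF K(1) assms(3)] by (simp only: ev_mult)
  moreover have "V v * (ev f * u * ev g) * V v \<approx> ev f * u * ev g"
  proof -
    have "V v * (ev f * u * ev g) * V v = (V v * ev f) * u * (poly_at C g * (V v * V v))"
      by (simp only: ev_def mult.assoc)
    also have "\<dots> \<approx> ev f * u * (poly_at C g * V v)"
      by (intro cT_mult[OF cT_rmult[OF V_ev] cT_lmult[OF VV]])
    finally show ?thesis by (simp only: ev_def)
  qed
  note e = cgI[OF this]
  have "C ^ n * (V v * (ev f * u * ev g) * V v) \<approx>\<^bsub>I\<^esub> ev (f * h * g)"
    by (rule cgI_trans[OF cg_lmult[OF I e] h])
  ultimately have "V v * (ev f * u * ev g) * V v \<in> K" using corner_mem[OF K] by blast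
  then show ?thesis using cg_mem[OF K(1) cg_mono[OF e K(2)]] by blast
qed

text \<open>Two uses of \<open>ev_middle\<close>, each with the constant polynomial 1 on the outer
  side.\<close>

lemma corner_ev: "\<exists>n h. C ^ n * (V v * (a * ev s * b) * V v) \<approx>\<^bsub>I\<^esub> ev (s * h)"
proof -
  obtain n h where h: "C ^ n * (V v * a * ev s) \<approx>\<^bsub>I\<^esub> ev (h * s)" using ev_middle[of 1 a s] by auto
  obtain m k where k: "C ^ m * (ev (h * s) * b * V v) \<approx>\<^bsub>I\<^esub> ev (h * s * k)"
    using ev_middle[of "h * s" b 1] by auto
  have e1: "C ^ (m + n) * (V v * (a * ev s * b) * V v) = C ^ m * (C ^ n * (V v * a * ev s)) * (b * V v)"
    by (simp add: power_add mult.assoc)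
  have e2: "C ^ m * (C ^ n * (V v * a * ev s)) * (b * V v) \<approx>\<^bsub>I\<^esub> C ^ m * ev (h * s) * (b * V v)"
    by (rule cg_mid[OF I h])
  have e3: "C ^ m * ev (h * s) * (b * V v) = C ^ m * (ev (h * s) * b * V v)" by (simp only: mult.assoc)
  have e4: "h * s * k = s * (h * k)" by (simp only: mult_ac)
  have "C ^ (m + n) * (V v * (a * ev s * b) * V v) \<approx>\<^bsub>I\<^esub> ev (s * (h * k))"
    using cgI_trans[OF e2[unfolded e3] k] unfolding e1 e4 .
  then show ?thesis by blast
qed

text \<open>For a walk \<open>p\<close> from \<open>v\<close> with live range, \<open>p p*\<close>
  is \<open>v\<close> modulo \<open>I\<close>; all other diagonal monomials vanish in the
  corner.\<close>

lemma corner_D: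
  assumes "x \<in> D"
  shows "\<exists>k. V v * x * V v \<approx>\<^bsub>I\<^esub> sc k * V v"
  using assms
proof (induction rule: D_induct)
  case (rel t)
  then have "V v * t * V v \<in> I" using ts_mid[OF T, of t "V v" "V v"] TI by blast
  then show ?case by (intro exI[of _ 0]) (simp add: cg_zero)
next
  case (mnl k p w)
  show ?case
  proof (cases "awalk v p w \<and> V w \<notin> I")
    case True
    have "V v * mnl p w p * V v \<approx>\<^bsub>I\<^esub> V v * V v * V v" using True by (intro cg_mid[OF I mnl_V]) auto
    also have "\<dots> \<approx>\<^bsub>I\<^esub> V v" by (rule cgI[OF cT_trans[OF cT_rmult[OF VV] VV]])
    finally have "sc k * (V v * mnl p w p * V v) \<approx>\<^bsub>I\<^esub> sc k * V v" by (rule cg_lmult[OF I])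
    then show ?thesis by (intro exI[of _ k]) (simp add: sc_left mult.assoc)
  next
    case False
    have "V v * mnl p w p * V v \<in> I"
    proof (cases "V w \<in> I")
      case True
      then have "(V v * re p) * V w * (gho p * V v) \<in> I" by (rule ts_mid[OF I])
      then show ?thesis by (simp add: mnl_def mult.assoc)
    next
      case w: False
      then have "\<not> awalk v p w" using False by blast
      then have "V v * re p * V w \<in> T" using mnl V_re0 v_verts by (metis wlk_def)
      then have "V v * re p * V w * (gho p * V v) \<in> I"
        using TI by (intro ts_rmult[OF I, of "V v * re p * V w"]) auto
      then show ?thesis by (simp add: mnl_def mult.assoc)
    qed
    then have "sc k * (V v * mnl p w p * V v) \<in> I" by (rule ts_lmult[OF I])
    then show ?thesis by (intro exI[of _ 0]) (simp add: sc_left mult.assoc cg_zero)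
  qed
next
  case (add x y)
  then obtain k l where "V v * x * V v \<approx>\<^bsub>I\<^esub> sc k * V v" "V v * y * V v \<approx>\<^bsub>I\<^esub> sc l * V v" by blast
  then have "V v * x * V v + V v * y * V v \<approx>\<^bsub>I\<^esub> sc k * V v + sc l * V v" by (rule cg_add[OF I])
  then show ?case by (intro exI[of _ "k + l"]) (simp add: sc_add distrib_left distrib_right)
qed

end

section \<open>Prime powers in polynomial rings over a field\<close>

lemma poly_prime_power_factor:
  fixes p f :: "'k::field poly"
  assumes "prime_elem p" "f \<noteq> 0"
  shows "\<exists>i g. f = p ^ i * g \<and> \<not> p dvd g"
  using assms(2)
proof (induction "degree f" arbitrary: f rule: less_induct)
  case less
  show ?case
  proof (cases "p dvd f")
    case True
    then obtain g where g: "f = p * g" by blast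
    have "p \<noteq> 0" "g \<noteq> 0" using g less.prems by auto
    have "\<not> is_unit p" using assms(1) by (simp add: prime_elem_def)
    then have "degree p \<noteq> 0" using \<open>p \<noteq> 0\<close> is_unit_iff_degree by blast
    then have "degree g < degree f" using \<open>p \<noteq> 0\<close> \<open>g \<noteq> 0\<close> by (simp add: g degree_mult_eq)
    then obtain i h where "g = p ^ i * h" "\<not> p dvd h" using less.hyps \<open>g \<noteq> 0\<close> by blast
    then show ?thesis using g by (intro exI[of _ "Suc i"] exI[of _ h]) (simp add: mult.assoc)
  next
    case False
    then show ?thesis by (intro exI[of _ 0] exI[of _ f]) simp
  qed
qed

lemma poly_prime_divisor:
  fixes f :: "'k::field poly"
  assumes "f \<noteq> 0" "\<not> is_unit f"
  shows "\<exists>p. prime_elem p \<and> p dvd f"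
  using assms
proof (induction "degree f" arbitrary: f rule: less_induct)
  case less
  show ?case
  proof (cases "irreducible f")
    case True
    then show ?thesis using field_poly_irreducible_imp_prime[OF True] by (intro exI[of _ f]) simp
  next
    case False
    then obtain g h where gh: "f = g * h" "\<not> is_unit g" "\<not> is_unit h"
      using less.prems by (auto simp: irreducible_def)
    have nz: "g \<noteq> 0" "h \<noteq> 0" using gh less.prems by auto
    have "degree h \<noteq> 0" using gh(3) nz is_unit_iff_degree by blast
    then have "degree g < degree f" using nz by (simp add: gh(1) degree_mult_eq)
    then obtain p where "prime_elem p" "p dvd g" using less.hyps nz gh by blast
    then show ?thesis using gh(1) by auto
  qed
qed

lemma power_dvd_imp_le_exponent:
  fixes p c :: "'a::idom"
  assumes "p \<noteq> 0" "p ^ k dvd p ^ i * c" "\<not> p dvd c"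
  shows "k \<le> i"
proof (rule ccontr)
  assume "\<not> k \<le> i"
  then obtain j where j: "k = i + Suc j" using less_imp_Suc_add[of i k] by auto
  then have "p ^ i * p ^ Suc j dvd p ^ i * c" using assms(2) by (simp only: power_add)
  then have "p ^ Suc j dvd c" using assms(1) by (simp only: dvd_mult_cancel_left) simp
  then have "p dvd c" by (simp add: dvd_mult_left)
  then show False using assms(3) by simp
qed

lemma dvd_prime_power_coprime:
  fixes p q :: "'k::field poly"
  assumes "prime_elem p" "q dvd p ^ n" "\<not> p dvd q"
  shows "is_unit q"
  using assms(2)
proof (induction n)
  case (Suc n)
  then obtain s where s: "p ^ Suc n = q * s" by blast
  then have "p dvd q * s" by (metis dvd_triv_left power_Suc)
  then have "p dvd s" using prime_elem_dvd_multD[OF assms(1)] assms(3) by blast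
  then obtain s' where "s = p * s'" by blast
  then have "p * p ^ n = p * (q * s')" using s by (simp add: mult_ac)
  then have "p ^ n = q * s'" using assms(1) by (simp add: prime_elem_def)
  then show ?case using Suc.IH by simp
qed simp

text \<open>Up to a unit \<open>q\<close> is a power \<open>p^k\<close>. Let \<open>a\<close>,
  \<open>b\<close> be \<open>p^i a'\<close>, \<open>p^j b'\<close> with cofactors not divisible by
  \<open>p\<close>. With \<open>m\<close> the larger of \<open>i\<close> and \<open>j\<close>, the
  common multiple \<open>p^m a' b'\<close> forces \<open>k \<le> m\<close>.\<close>

lemma poly_prime_power_dvd_common_multiple:
  fixes p q a b :: "'k::field poly"
  assumes p: "prime_elem p" and q: "q dvd p ^ n"
    and lcm: "\<And>f. a dvd f \<Longrightarrow> b dvd f \<Longrightarrow> q dvd f"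
  shows "q dvd a \<or> q dvd b"
proof (cases "a = 0 \<or> b = 0")
  case False
  have pnz: "p \<noteq> 0" using p by (simp add: prime_elem_def)
  have "q \<noteq> 0" using q pnz by auto
  then obtain k q' where q': "q = p ^ k * q'" "\<not> p dvd q'" using poly_prime_power_factor[OF p] by blast
  have "q' dvd p ^ n" using q q' dvd_mult_right by blast
  then have unit: "is_unit q'" by (rule dvd_prime_power_coprime[OF p _ q'(2)])
  obtain i a' where a: "a = p ^ i * a'" "\<not> p dvd a'" using False poly_prime_power_factor[OF p] by blast
  obtain j b' where b: "b = p ^ j * b'" "\<not> p dvd b'" using False poly_prime_power_factor[OF p] by blast
  have ab: "\<not> p dvd a' * b'" using a(2) b(2) prime_elem_dvd_multD[OF p] by blast
  have main: "p ^ k dvd p ^ i * (a' * b') \<Longrightarrow> k \<le> i" for i by (rule power_dvd_imp_le_exponent[OF pnz _ ab])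
  have qk: "q dvd f" if "p ^ k dvd f" for f
    using that unit unfolding q'(1) by (simp add: mult_unit_dvd_iff)
  have kq: "p ^ k dvd q" using q'(1) by simp
  show ?thesis
  proof (cases "j \<le> i")
    case True
    have "a dvd p ^ i * (a' * b')" "b dvd p ^ i * (a' * b')"
      using le_imp_power_dvd[OF True, of p] by (auto simp: a(1) b(1) mult_ac intro: mult_dvd_mono)
    then have "k \<le> i" using main lcm kq dvd_trans by blast
    then have "q dvd a" by (intro qk) (simp add: a(1) le_imp_power_dvd dvd_mult2)
    then show ?thesis ..
  next
    case False
    then have ij: "i \<le> j" by simp
    have "a dvd p ^ j * (a' * b')" "b dvd p ^ j * (a' * b')"
      using le_imp_power_dvd[OF ij, of p] by (auto simp: a(1) b(1) mult_ac intro: mult_dvd_mono)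
    then have "k \<le> j" using main lcm kq dvd_trans by blast
    then have "q dvd b" by (intro qk) (simp add: b(1) le_imp_power_dvd dvd_mult2)
    then show ?thesis ..
  qed
qed auto

text \<open>One factor \<open>p\<close> is added at a time: it divides the cofactor because it does
  not divide \<open>g\<close>.\<close>

lemma prime_power_coprime_mult_dvd:
  fixes p g f :: "'a::idom"
  assumes "prime_elem p" "\<not> p dvd g" "p ^ n dvd f" "g dvd f"
  shows "p ^ n * g dvd f"
  using assms(3)
proof (induction n)
  case 0
  then show ?case using assms(4) by simp
next
  case (Suc n)
  then have "p ^ n * g dvd f" using power_le_dvd[of p "Suc n" f n] by simp
  then obtain s where s: "f = p ^ n * g * s" by blast
  obtain t where t: "f = p ^ Suc n * t" using Suc.prems by blast
  have pnz: "p \<noteq> 0" using assms(1) by (simp add: prime_elem_def)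
  have "p ^ n * (g * s) = f" unfolding s by (simp only: mult.assoc)
  also have "f = p ^ n * (p * t)" unfolding t by (simp only: power_Suc mult_ac)
  finally have "g * s = p * t" using pnz by simp
  then have "p dvd g * s" by simp
  then have "p dvd s" using prime_elem_dvd_multD[OF assms(1)] assms(2) by blast
  then obtain r where "s = p * r" by blast
  then show ?case using s by (simp add: mult_ac)
qed

text \<open>\<open>X\<close> has degree 1 and \<open>p\<close> is not constant, so the cofactor is a
  unit.\<close>

lemma poly_prime_dvd_X:
  fixes p :: "'k::field poly"
  assumes "prime_elem p" "p dvd [:0, 1:]"
  shows "[:0, 1:] dvd p"
proof -
  obtain u where u: "[:0, 1:] = p * u" using assms(2) by blast
  have nz: "p \<noteq> 0" "u \<noteq> 0" using u by auto
  have "degree p \<noteq> 0" using assms(1) nz is_unit_iff_degree by (auto simp: prime_elem_def)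
  moreover have "degree p + degree u = 1" using u nz by (metis degree_mult_eq degree_pCons_eq_if degree_1 one_neq_zero one_pCons One_nat_def)
  ultimately have "is_unit u" using nz is_unit_iff_degree[of u] by simp
  then show ?thesis unfolding u by (simp add: mult_unit_dvd_iff)
qed

section \<open>Irreducible ideals and powers of prime ideals\<close>

context leavitt_family
begin

lemma admD: "adm I \<Longrightarrow> two_sided I" "adm I \<Longrightarrow> T \<subseteq> I" "adm I \<Longrightarrow> I \<subseteq> M"
  by (auto simp: adm_def)

lemma adm_Int: "adm A \<Longrightarrow> adm B \<Longrightarrow> adm (A \<inter> B)"
  unfolding adm_def by (intro conjI two_sided_Int) auto

text \<open>The part of \<open>I\<close> generated by its diagonal idempotents. It has local units,
  and working modulo it instead of \<open>I\<close> keeps the polynomial ideal of \<open>I\<close>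
  in the corner visible.\<close>

definition "diag_ideal I = gen_ideal (T \<union> (DId \<inter> I))"

lemma diag_ideal_adm: "adm (diag_ideal I)"
  unfolding diag_ideal_def using T_le_M DId_M by (intro adm_gen) auto

lemma diag_ideal_le: "adm I \<Longrightarrow> diag_ideal I \<subseteq> I"
  unfolding diag_ideal_def by (rule gen_least) (auto dest: admD)

lemma diag_ideal_DId: "adm I \<Longrightarrow> DId \<inter> diag_ideal I = DId \<inter> I"
  using diag_ideal_le[of I] unfolding diag_ideal_def by (auto intro: gen_base)

lemma leavitt_idealI: "adm I \<Longrightarrow> leavitt_ideal E V ed gh sc T M I"
  by unfold_locales (auto dest: admD)

text \<open>Exitlessness mentions only elements \<open>V u\<close> and
  \<open>V u - ed e * gh e\<close>, which are diagonal idempotents.\<close>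

lemma exitless_cong:
  assumes "adm I" "adm I'" "DId \<inter> I = DId \<inter> I'" "exitless I v"
  shows "exitless I' v"
proof -
  have V: "V u \<in> I \<longleftrightarrow> V u \<in> I'" if "u \<in> verts E" for u using assms(3) V_DId[OF that] by blast
  have Ve: "V u - ed e * gh e \<in> I \<longleftrightarrow> V u - ed e * gh e \<in> I'" if "e \<in> out_arcs E u" for u e
  proof -
    have "u \<in> verts E" using that by auto
    with V_minus_edges(1)[of "{e}" u] that have "V u - ed e * gh e \<in> DId" by auto
    then show ?thesis using assms(3) by blast
  qed
  show ?thesis
    unfolding exitless_def
  proof (intro conjI allI impI)
    show "v \<in> verts E" "\<exists>c. awalk v c v \<and> c \<noteq> []" using assms(4) by (simp_all add: exitless_def)
    then show "V v \<notin> I'" using V assms(4) by (simp add: exitless_def)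
    fix p u assume u: "awalk v p u" "V u \<notin> I'"
    have "V u \<notin> I" using V[OF awalk_last_in_verts[OF u(1)]] u(2) by simp
    then obtain e where e: "e \<in> out_arcs E u" "V u - ed e * gh e \<in> I"
      using assms(4) u(1) unfolding exitless_def by blast
    then show "\<exists>e\<in>out_arcs E u. V u - ed e * gh e \<in> I'" using Ve by blast
  qed
qed

lemma exitless_diag_ideal: "adm I \<Longrightarrow> exitless (diag_ideal I) v \<longleftrightarrow> exitless I v"
  using exitless_cong[OF diag_ideal_adm, of I] exitless_cong[OF _ diag_ideal_adm, of I] diag_ideal_DId by metis

lemma leavitt_exitlessI: "adm I \<Longrightarrow> exitless I v \<Longrightarrow> leavitt_exitless E V ed gh sc T M I v"
  using leavitt_idealI by (simp add: leavitt_exitless_def leavitt_exitless_axioms_def)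

lemma reduction_step:
  assumes "adm I" "adm X" "I \<subseteq> X" "X \<noteq> I" "\<And>d. d \<in> DId \<Longrightarrow> d \<in> X \<Longrightarrow> d \<in> I"
  obtains v y where "exitless I v" "y \<in> X" "y \<notin> I" "V v * y * V v \<approx> y"
proof -
  interpret leavitt_reduction E V ed gh sc T M I X
    using assms leavitt_idealI[OF assms(1)] admD[OF assms(2)]
    by (simp add: leavitt_reduction_def leavitt_reduction_axioms_def)
  show ?thesis using reduction[OF assms(4)] that by blast
qed

lemma mnl_witness:
  assumes "two_sided I" "T \<subseteq> I" "x \<in> M" "a * x * b \<notin> I"
  obtains p w q where "wlk p w" "wlk q w" "a * mnl p w q * b \<notin> I"
proof (rule ccontr)
  assume "\<not> thesis"
  with that have *: "a * mnl p w q * b \<in> I" if "wlk p w" "wlk q w" for p w q using that by blast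
  have "a * x * b \<in> I"
    using assms(3) unfolding M_eq
  proof (induction rule: asp.induct)
    case zero
    then show ?case by (simp add: ts_zero[OF assms(1)])
  next
    case (step y x)
    have "a * y * b \<in> I"
      using step.hyps(1)
    proof
      assume "y \<in> T"
      then have "y \<in> I" using assms(2) by blast
      then show ?thesis by (rule ts_mid[OF assms(1)])
    next
      assume "y \<in> Mons"
      then obtain k p w q where y: "y = sc k * mnl p w q" "wlk p w" "wlk q w" unfolding Mons_def by blast
      have "a * y * b = sc k * (a * mnl p w q * b)" by (simp add: y(1) sc_left mult.assoc)
      then show ?thesis using ts_lmult[OF assms(1) *[OF y(2,3)], of "sc k"] by simp
    qed
    with step.IH show ?case by (simp add: distrib_left distrib_right ts_add[OF assms(1)])
  qed
  then show False using assms(4) by simp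
qed

lemma irr_adm: "irr I \<Longrightarrow> adm I"
  by (simp add: irr_def)

text \<open>An irreducible ideal admits at most one cycle without exits, so that all of it beyond its
  diagonal idempotents is visible in a single corner.\<close>

lemma irr_structure:
  assumes "irr I" "exitless I v"
  shows "I \<subseteq> gen_ideal (diag_ideal I \<union> {V v * y * V v | y. y \<in> I})" (is "_ \<subseteq> ?I1")
proof -
  have adm: "adm I" using assms(1) by (rule irr_adm)
  note I = admD[OF adm]
  have sub: "diag_ideal I \<union> {V v * y * V v | y. y \<in> I} \<subseteq> I"
    using diag_ideal_le[OF adm] ts_mid[OF I(1)] by blast
  have I1: "adm ?I1" using sub I admD[OF diag_ideal_adm] by (intro adm_gen) blast+
  have I1_le: "?I1 \<subseteq> I" by (rule gen_least[OF I(1) sub])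
  have J_le: "diag_ideal I \<subseteq> ?I1" by (auto intro: gen_base)
  have DI: "DId \<inter> ?I1 = DId \<inter> I" using I1_le J_le diag_ideal_DId[OF adm] by blast
  show ?thesis
  proof (rule ccontr)
    assume "\<not> I \<subseteq> ?I1"
    then have "I \<noteq> ?I1" by blast
    \<comment> \<open>If \<open>I\<close> exceeds \<open>?I1\<close>, reduction yields a second
      exitless vertex \<open>w\<close> and an element of its corner that \<open>?I1\<close>
      misses.\<close>
    then obtain w y where w: "exitless ?I1 w" "y \<in> I" "y \<notin> ?I1" "V w * y * V w \<approx> y"
      using reduction_step[OF I1 adm I1_le] DI by blast
    have XLw: "exitless I w" by (rule exitless_cong[OF I1 adm DI w(1)])
    have verts: "v \<in> verts E" "w \<in> verts E" and live: "V v \<notin> I" "V w \<notin> I"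
      using assms(2) XLw by (auto simp: exitless_def)
    \<comment> \<open>Irreducibility links the two vertices, and a monomial realizing the link,
      followed by a return walk, gives the walk \<open>?\<pi>\<close> from \<open>w\<close> to
      \<open>v\<close>.\<close>
    obtain a where a: "V v * a * V w \<notin> I"
      using irr_corner(1)[OF assms(1) V_DId[OF verts(1)] live(1) V_M[OF verts(2)] live(2)] by blast
    have "V v * (a * V w) * 1 \<notin> I" using a by (simp add: mult.assoc)
    moreover have VVw: "V v * (a * V w) * V w \<approx> V v * (a * V w) * 1"
      using cT_lmult[OF rel_VV[OF verts(2)], of "V v * a"] by (simp add: mult.assoc)
    ultimately have "V v * (a * V w) * V w \<notin> I" using cg_mem[OF I(1) cg_mono[OF VVw I(2)]] by blast
    then obtain p z q where pzq: "wlk p z" "wlk q z" "V v * mnl p z q * V w \<notin> I"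
      using mnl_witness[OF I(1,2) ts_lmult[OF M V_M[OF verts(2)]]] by blast
    interpret v: leavitt_exitless E V ed gh sc T M I v using leavitt_exitlessI adm assms(2) by blast
    interpret w: leavitt_exitless E V ed gh sc T M ?I1 w using leavitt_exitlessI I1 w(1) by blast
    have p: "awalk v p z"
    proof (rule ccontr)
      assume "\<not> awalk v p z"
      then have "V v * re p * V z \<in> T" using pzq(1) V_re0 verts(1) by (metis wlk_def)
      then have "V v * re p * V z \<in> I" using I(2) by blast
      then have "V v * re p * V z * (gho q * V w) \<in> I" by (rule ts_rmult[OF I(1)])
      then show False using pzq(3) by (simp add: mnl_def mult.assoc)
    qed
    have q: "awalk w q z"
    proof (rule ccontr)
      assume "\<not> awalk w q z"
      then have "V z * gho q * V w \<in> T" using pzq(2) gho_V0 verts(2) by (metis wlk_def)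
      then have "V z * gho q * V w \<in> I" using I(2) by blast
      then have "V v * re p * (V z * gho q * V w) \<in> I" by (rule ts_lmult[OF I(1)])
      then show False using pzq(3) by (simp add: mnl_def mult.assoc)
    qed
    have z: "V z \<notin> I"
    proof
      assume "V z \<in> I"
      then have "(V v * re p) * V z * (gho q * V w) \<in> I" by (rule ts_mid[OF I(1)])
      then show False using pzq(3) by (simp add: mnl_def mult.assoc)
    qed
    obtain \<sigma> where \<sigma>: "awalk z \<sigma> v" using v.return[OF p z] by blast
    let ?\<pi> = "q @ \<sigma>"
    have \<pi>: "awalk w ?\<pi> v" using q \<sigma> walk_app[of w q \<sigma> v] by blast
    have "V v \<notin> ?I1" using live(1) I1_le by blast
    note unit = w.mnl_V[OF \<pi> this]
    \<comment> \<open>Conjugation by \<open>?\<pi>\<close> brings \<open>y\<close> into the corner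
      at \<open>v\<close>, where \<open>?I1\<close> agrees with \<open>I\<close>. As
      \<open>?\<pi> ?\<pi>*\<close> is \<open>V w\<close> modulo \<open>?I1\<close>, the element
      \<open>y\<close> is recovered afterwards.\<close>
    have "V v * (gho ?\<pi> * y * re ?\<pi>) * V v \<in> ?I1"
      using ts_mid[OF I(1) w(2), of "gho ?\<pi>" "re ?\<pi>"] by (intro gen_base) blast
    then have "re ?\<pi> * (V v * (gho ?\<pi> * y * re ?\<pi>) * V v) * gho ?\<pi> \<in> ?I1"
      by (rule ts_mid[OF two_sided_gen])
    moreover have "re ?\<pi> * (V v * (gho ?\<pi> * y * re ?\<pi>) * V v) * gho ?\<pi> = mnl ?\<pi> v ?\<pi> * y * mnl ?\<pi> v ?\<pi>"
      by (simp only: mnl_def mult.assoc)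
    ultimately have "mnl ?\<pi> v ?\<pi> * y * mnl ?\<pi> v ?\<pi> \<in> ?I1" by simp
    moreover have "mnl ?\<pi> v ?\<pi> * y * mnl ?\<pi> v ?\<pi> \<approx>\<^bsub>?I1\<^esub> V w * y * V w"
      by (rule cg_mult[OF two_sided_gen cg_rmult[OF two_sided_gen unit] unit])
    note cg_mem[OF two_sided_gen this]
    ultimately have "V w * y * V w \<in> ?I1" by simp
    moreover have "V w * y * V w \<approx>\<^bsub>?I1\<^esub> y" by (rule cg_mono[OF w(4) admD(2)[OF I1]])
    note cg_mem[OF two_sided_gen this]
    ultimately have "y \<in> ?I1" by simp
    then show False using w(3) by simp
  qed
qed

text \<open>Stated with products of elements, which for an ideal \<open>P\<close> is the same as
  containing the additive closure of these products.\<close>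

definition "prm P \<longleftrightarrow> adm P \<and> P \<noteq> M \<and>
  (\<forall>A B. adm A \<longrightarrow> adm B \<longrightarrow> (\<forall>a\<in>A. \<forall>b\<in>B. a * b \<in> P) \<longrightarrow> A \<subseteq> P \<or> B \<subseteq> P)"

definition "sirr I \<longleftrightarrow> adm I \<and> (\<forall>A B. adm A \<longrightarrow> adm B \<longrightarrow> A \<inter> B \<subseteq> I \<longrightarrow> A \<subseteq> I \<or> B \<subseteq> I)"

text \<open>\<open>T\<close> is added because products of elements of two preimages need not cover
  it.\<close>

definition "pr A B = asp (T \<union> {a * b | a b. a \<in> A \<and> b \<in> B})"

fun pw where
  "pw P 0 = M"
| "pw P (Suc 0) = P"
| "pw P (Suc (Suc n)) = pr (pw P (Suc n)) P"

lemma sirr_irr: "sirr I \<Longrightarrow> irr I"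
  unfolding sirr_def irr_def by blast

text \<open>The product of two ideals lies in their intersection.\<close>

lemma prm_irr: assumes "prm P" shows "irr P"
  unfolding irr_def
proof (intro conjI allI impI)
  show "adm P" using assms by (simp add: prm_def)
  fix A B assume AB: "adm A" "adm B" "A \<inter> B = P"
  have "\<forall>a\<in>A. \<forall>b\<in>B. a * b \<in> P"
    using AB(3) ts_rmult[OF admD(1)[OF AB(1)]] ts_lmult[OF admD(1)[OF AB(2)]] by blast
  then have "A \<subseteq> P \<or> B \<subseteq> P" using assms AB(1,2) unfolding prm_def by blast
  then show "A = P \<or> B = P" using AB(3) by blast
qed

lemma prm_elements:
  assumes "prm P" "a \<in> M" "b \<in> M" "\<And>u. a * u * b \<in> P"
  shows "a \<in> P \<or> b \<in> P"
proof -
  note P = admD[of P]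
  have adm: "adm P" using assms(1) by (simp add: prm_def)
  have "adm (gen_ideal (T \<union> {a}))" "adm (gen_ideal (T \<union> {b}))"
    using assms(2,3) T_le_M by (intro adm_gen; blast)+
  moreover have "x * y \<in> P" if "x \<in> gen_ideal (T \<union> {a})" "y \<in> gen_ideal (T \<union> {b})" for x y
  proof (rule gen_mult[OF P(1)[OF adm] _ that])
    fix x y c assume "x \<in> T \<union> {a}" "y \<in> T \<union> {b}"
    then consider "x \<in> P" | "y \<in> P" | "x = a \<and> y = b" using P(2)[OF adm] by blast
    then show "x * c * y \<in> P"
    proof cases
      case 1
      then have "x * (c * y) \<in> P" by (rule ts_rmult[OF P(1)[OF adm]])
      then show ?thesis by (simp add: mult.assoc)
    next
      case 2
      then show ?thesis by (rule ts_lmult[OF P(1)[OF adm]])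
    next
      case 3
      then show ?thesis using assms(4) by simp
    qed
  qed
  ultimately have "gen_ideal (T \<union> {a}) \<subseteq> P \<or> gen_ideal (T \<union> {b}) \<subseteq> P"
    using assms(1) unfolding prm_def by blast
  then show ?thesis using gen_base[of a "T \<union> {a}"] gen_base[of b "T \<union> {b}"] by blast
qed

lemma pr_mult: "a \<in> A \<Longrightarrow> b \<in> B \<Longrightarrow> a * b \<in> pr A B"
  unfolding pr_def by (intro asp_base) blast

lemma pr_least:
  assumes "adm I" "\<And>a b. a \<in> A \<Longrightarrow> b \<in> B \<Longrightarrow> a * b \<in> I"
  shows "pr A B \<subseteq> I"
  unfolding pr_def using admD(2)[OF assms(1)] assms(2)
  by (intro subsetI, elim asp_least) (auto intro: ts_zero[OF admD(1)[OF assms(1)]] ts_add[OF admD(1)[OF assms(1)]])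

lemma pr_adm:
  assumes "adm A" "adm B" shows "adm (pr A B)"
proof -
  have "two_sided (pr A B)"
  proof (rule two_sidedI)
    fix c x assume x: "x \<in> pr A B"
    show "c * x \<in> pr A B"
      using x unfolding pr_def
    proof (rule asp_lmult, elim UnE)
      fix y assume "y \<in> T"
      then show "c * y \<in> asp (T \<union> {a * b | a b. a \<in> A \<and> b \<in> B})" by (intro asp_base) (simp add: ts_lmult)
    next
      fix y assume "y \<in> {a * b | a b. a \<in> A \<and> b \<in> B}"
      then obtain a b where ab: "y = a * b" "a \<in> A" "b \<in> B" by blast
      then have "(c * a) * b \<in> pr A B" using ts_lmult[OF admD(1)[OF assms(1)]] by (intro pr_mult)
      then show "c * y \<in> asp (T \<union> {a * b | a b. a \<in> A \<and> b \<in> B})" by (simp add: ab pr_def mult.assoc)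
    qed
    show "x * c \<in> pr A B"
      using x unfolding pr_def
    proof (rule asp_rmult, elim UnE)
      fix y assume "y \<in> T"
      then show "y * c \<in> asp (T \<union> {a * b | a b. a \<in> A \<and> b \<in> B})" by (intro asp_base) (simp add: ts_rmult)
    next
      fix y assume "y \<in> {a * b | a b. a \<in> A \<and> b \<in> B}"
      then obtain a b where ab: "y = a * b" "a \<in> A" "b \<in> B" by blast
      then have "a * (b * c) \<in> pr A B" using ts_rmult[OF admD(1)[OF assms(2)]] by (intro pr_mult)
      then show "y * c \<in> asp (T \<union> {a * b | a b. a \<in> A \<and> b \<in> B})" by (simp add: ab pr_def mult.assoc)
    qed
  qed (auto simp: pr_def intro: asp.zero asp_add)
  moreover have "T \<subseteq> pr A B" unfolding pr_def by (auto intro: asp_base)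
  moreover have "pr A B \<subseteq> A" using ts_rmult[OF admD(1)[OF assms(1)]] by (intro pr_least assms) blast
  ultimately show ?thesis using admD(3)[OF assms(1)] unfolding adm_def by blast
qed

lemma pw_adm: "adm P \<Longrightarrow> adm (pw P (Suc n))"
  by (induction n) (auto intro: pr_adm)

lemma pw_le: assumes "adm P" shows "pw P (Suc n) \<subseteq> P"
proof (cases n)
  case (Suc m)
  have "pr (pw P (Suc m)) P \<subseteq> P"
    using ts_lmult[OF admD(1)[OF assms]] by (intro pr_least assms) blast
  then show ?thesis by (simp add: Suc)
qed simp

text \<open>Local units make the diagonal ideal idempotent: \<open>x\<close> is \<open>u * x\<close>
  modulo \<open>T\<close> with both factors inside.\<close>

lemma diag_ideal_pw: assumes "adm P" shows "diag_ideal P \<subseteq> pw P (Suc n)"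
proof (induction n)
  case 0
  then show ?case using diag_ideal_le[OF assms] by simp
next
  case (Suc n)
  show ?case
  proof
    fix x assume x: "x \<in> diag_ideal P"
    then obtain u where u: "u \<in> diag_ideal P" "u * x \<approx> x"
      using s_unital_left[of "DId \<inter> P" x x] unfolding diag_ideal_def by blast
    have "u * x \<in> pw P (Suc (Suc n))" using u(1) x Suc diag_ideal_le[OF assms] by (auto intro!: pr_mult)
    then show "x \<in> pw P (Suc (Suc n))"
      using cg_mem[OF admD(1) cg_mono[OF u(2) admD(2)]] pw_adm[OF assms] by blast
  qed
qed

end

section \<open>Powers of prime ideals are strongly irreducible\<close>

lemma (in leavitt_exitless) ev_principal_ex:
  "two_sided K \<Longrightarrow> \<exists>g. \<forall>f. ev f \<in> K \<longleftrightarrow> g dvd f"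
  by (rule ev_principal) blast+

context leavitt_family
begin

text \<open>Write \<open>x = a + j = b + j'\<close> and take a common local unit \<open>u\<close> of
  \<open>j\<close> and \<open>j'\<close>. Then \<open>x - u * x\<close> lies in both
  \<open>A\<close> and \<open>B\<close>, while \<open>u * x\<close> lies in the diagonal
  ideal.\<close>

lemma ideal_sum_diag_ideal:
  assumes "adm I" "adm A" "adm B" "adm Q" "A \<inter> B \<subseteq> Q" "diag_ideal I \<subseteq> Q"
  shows "ideal_sum A (diag_ideal I) \<inter> ideal_sum B (diag_ideal I) \<subseteq> Q"
proof
  fix x assume "x \<in> ideal_sum A (diag_ideal I) \<inter> ideal_sum B (diag_ideal I)"
  then have "x \<in> ideal_sum A (diag_ideal I)" "x \<in> ideal_sum B (diag_ideal I)" by blast+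
  then obtain a j b j' where x: "x = a + j" "x = b + j'" "a \<in> A" "b \<in> B" "j \<in> diag_ideal I" "j' \<in> diag_ideal I"
    unfolding ideal_sum_def by blast
  obtain u where u: "u \<in> diag_ideal I" "u * j \<approx> j" "u * j' \<approx> j'"
    using s_unital_left[of "DId \<inter> I" j j'] x(5,6) unfolding diag_ideal_def by blast
  have "x - u * x = (a - u * a) - (u * j - j)" by (simp add: x(1) algebra_simps)
  moreover have "u * j - j \<in> A" "u * j' - j' \<in> B"
    using u admD(2)[OF assms(2)] admD(2)[OF assms(3)] by (auto simp: cg_def)
  ultimately have A: "x - u * x \<in> A" using x(3) admD(1)[OF assms(2)] by (simp add: ts_diff ts_lmult)
  have "x - u * x = (b - u * b) - (u * j' - j')" by (simp add: x(2) algebra_simps)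
  then have "x - u * x \<in> B" using x(4) \<open>u * j' - j' \<in> B\<close> admD(1)[OF assms(3)] by (simp add: ts_diff ts_lmult)
  with A have "x - u * x \<in> Q" using assms(5) by blast
  moreover have "u * x \<in> Q" using u(1) assms(6) ts_rmult[OF admD(1)[OF assms(4)]] by blast
  ultimately have "(x - u * x) + u * x \<in> Q" by (rule ts_add[OF admD(1)[OF assms(4)]])
  then show "x \<in> Q" by simp
qed

text \<open>If \<open>P\<close> equals its diagonal ideal, all its powers equal \<open>P\<close>.
  Otherwise reduction over the diagonal ideal provides a cycle, and comparing \<open>A\<close> and
  \<open>B\<close> with the power becomes divisibility between the generators of their polynomial
  ideals.\<close>

theorem prime_power_sirr:
  assumes "prm P"
  shows "sirr (pw P (Suc m))"
proof -
  let ?Q = "pw P (Suc m)" and ?J = "diag_ideal P"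
  have P: "adm P" using assms by (simp add: prm_def)
  note P' = admD[OF P]
  have Q: "adm ?Q" by (rule pw_adm[OF P])
  note Q' = admD[OF Q]
  have QP: "?Q \<subseteq> P" by (rule pw_le[OF P])
  have JQ: "?J \<subseteq> ?Q" by (rule diag_ideal_pw[OF P])
  have prime: "A \<subseteq> P \<or> B \<subseteq> P" if "adm A" "adm B" "A \<inter> B \<subseteq> P" for A B
  proof -
    have "\<forall>a\<in>A. \<forall>b\<in>B. a * b \<in> P"
      using that(3) ts_rmult[OF admD(1)[OF that(1)]] ts_lmult[OF admD(1)[OF that(2)]] by blast
    then show ?thesis using assms that(1,2) unfolding prm_def by blast
  qed
  show ?thesis
  proof (cases "?J = P")
    case True
    then have "?Q = P" using QP JQ by blast
    then show ?thesis unfolding sirr_def using prime Q by metis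
  next
    case False
    have J: "adm ?J" by (rule diag_ideal_adm)
    note J' = admD[OF J]
    have JP: "?J \<subseteq> P" by (rule diag_ideal_le[OF P])
    have "\<And>d. d \<in> DId \<Longrightarrow> d \<in> P \<Longrightarrow> d \<in> ?J" using diag_ideal_DId[OF P] by blast
    then obtain v y where v: "exitless ?J v" "y \<in> P" "y \<notin> ?J" "V v * y * V v \<approx> y"
      using reduction_step[OF J P JP False[symmetric]] by blast
    interpret v: leavitt_exitless E V ed gh sc T M ?J v by (rule leavitt_exitlessI[OF J v(1)])
    have XLP: "exitless P v" using v(1) exitless_diag_ideal[OF P] by blast
    then have live: "V v \<notin> P" by (simp add: exitless_def)
    obtain p where p: "\<And>f. v.ev f \<in> P \<longleftrightarrow> p dvd f" using v.ev_principal[OF P'(1)] by blast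
    have "prime_elem p" unfolding prime_elem_def
    proof (intro conjI allI impI)
      \<comment> \<open>The new element \<open>y\<close> of \<open>P\<close> yields a polynomial
        whose value is in \<open>P\<close> but not in \<open>?J\<close>.\<close>
      show "p \<noteq> 0"
      proof
        assume "p = 0"
        obtain n f where f: "v.C ^ n * (V v * y * V v) \<approx>\<^bsub>?J\<^esub> v.ev f" using v.corner v(2) P'(3) by blast
        have "V v * y * V v \<in> P" using ts_mid[OF P'(1) v(2)] .
        then have "v.ev f \<in> P" using v.corner_mem[OF P'(1) JP f] by blast
        then have "v.ev f \<in> ?J" using p \<open>p = 0\<close> ts_zero[OF J'(1)] by auto
        then have "V v * y * V v \<in> ?J" using v.corner_mem[OF J'(1) subset_refl f] by blast
        then show False using v(3) cg_mem[OF J'(1) cg_mono[OF v(4) J'(2)]] by blast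
      qed
      show "\<not> is_unit p" using p[of 1] live by simp
      fix f g assume "p dvd f * g"
      then have "v.ev (f * g) \<in> P" using p by blast
      then have "v.ev f * u * v.ev g \<in> P" for u by (rule v.ev_sandwich[OF P'(1) JP])
      then show "p dvd f \<or> p dvd g" using prm_elements[OF assms v.ev_M v.ev_M] p by blast
    qed
    have evpow: "v.ev (p ^ Suc n) \<in> pw P (Suc n)" for n
    proof (induction n)
      case 0
      then show ?case using p[of p] by simp
    next
      case (Suc n)
      have "v.ev (p ^ Suc n) * v.ev p \<in> pr (pw P (Suc n)) P" using Suc p[of p] by (intro pr_mult) simp_all
      then have "v.ev (p ^ Suc n) * v.ev p \<in> pw P (Suc (Suc n))" by simp
      moreover have "v.ev (p ^ Suc n) * v.ev p \<approx> v.ev (p ^ Suc n * p)" by (rule v.ev_ev)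
      ultimately have "v.ev (p ^ Suc n * p) \<in> pw P (Suc (Suc n))"
        using pw_adm[OF P, of "Suc n"] cg_mem[OF admD(1) cg_mono[OF _ admD(2)]] by blast
      then show ?case by (simp only: power_Suc2)
    qed
    obtain q where q: "\<And>f. v.ev f \<in> ?Q \<longleftrightarrow> q dvd f" using v.ev_principal[OF Q'(1)] by blast
    \<comment> \<open>As a divisor of a power of the prime \<open>p\<close>, the generator
      \<open>q\<close> is itself a power of \<open>p\<close> up to a unit.\<close>
    have qp: "q dvd p ^ Suc m" using q evpow by blast
    \<comment> \<open>By \<open>irr_structure\<close>, \<open>P\<close> lies in the ideal generated
      by \<open>T\<close> and these idempotents, whose local units also serve the elements of
      \<open>P\<close>.\<close>
    define W where "W = insert (V v) (DId \<inter> P)"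
    have W: "W \<subseteq> DId" using V_DId v.v_verts by (auto simp: W_def)
    have P_N: "P \<subseteq> gen_ideal (T \<union> W)"
    proof -
      have "?J \<subseteq> gen_ideal (T \<union> W)" unfolding diag_ideal_def by (rule gen_mono) (auto simp: W_def)
      moreover have "V v * y * V v \<in> gen_ideal (T \<union> W)" for y
        by (rule ts_rmult[OF two_sided_gen ts_rmult[OF two_sided_gen gen_base]]) (simp add: W_def)
      ultimately have "?J \<union> {V v * y * V v | y. y \<in> P} \<subseteq> gen_ideal (T \<union> W)" by blast
      from gen_least[OF two_sided_gen this] irr_structure[OF prm_irr[OF assms] XLP]
      show ?thesis by blast
    qed
    \<comment> \<open>Containment in \<open>?Q\<close> is tested on polynomials at \<open>v\<close>.
      The test first forces \<open>A\<close> into \<open>P\<close>; local units on both sides then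
      reduce each element to its corner.\<close>
    have key: "A \<subseteq> ?Q" if A: "adm A" and sub: "\<And>f. v.ev f \<in> ideal_sum A ?J \<Longrightarrow> v.ev f \<in> ?Q" for A
    proof
      let ?A = "ideal_sum A ?J"
      have A': "adm ?A" by (rule adm_sum[OF A J])
      have JA: "?J \<subseteq> ?A" by (rule ideal_sum_right[OF admD(1)[OF A]])
      have corner: "V v * z * V v \<in> ?Q" if zA: "z \<in> ?A" for z
      proof -
        have "z \<in> M" using zA admD(3)[OF A'] by blast
        then obtain n f where f: "v.C ^ n * (V v * z * V v) \<approx>\<^bsub>?J\<^esub> v.ev f"
          using v.corner[of z] by blast
        have "V v * z * V v \<in> ?A" by (rule ts_mid[OF admD(1)[OF A'] zA])
        then have "v.ev f \<in> ?Q" using sub v.corner_mem[OF admD(1)[OF A'] JA f] by blast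
        then show ?thesis using v.corner_mem[OF Q'(1) JQ f] by blast
      qed
      \<comment> \<open>The corner of \<open>?A\<close> lies in \<open>?Q\<close>, hence in
        \<open>P\<close>; since \<open>V v\<close> is not in \<open>P\<close>, primeness removes it
        on both sides.\<close>
      have AP: "z \<in> P" if z: "z \<in> ?A" for z
      proof -
        have zM: "z \<in> M" using z admD(3)[OF A'] by blast
        have "z * t * V v \<in> P" for t
        proof -
          have "V v * s * (z * t * V v) \<in> P" for s
            using corner[OF ts_mid[OF admD(1)[OF A'] z], of s t] QP by (auto simp: mult.assoc)
          then show ?thesis
            using prm_elements[OF assms V_M[OF v.v_verts], of "z * t * V v"] live ts_lmult[OF M V_M[OF v.v_verts]] by blast
        qed
        then show ?thesis using prm_elements[OF assms zM V_M[OF v.v_verts]] live by blast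
      qed
      fix z assume "z \<in> A"
      then have z: "z \<in> ?A" by (rule subsetD[OF ideal_sum_left[OF J'(1)]])
      then have zN: "z \<in> gen_ideal (T \<union> W)" using AP P_N by blast
      obtain u where u: "u \<in> gen_ideal (T \<union> W)" "u * z \<approx> z" using s_unital_left[OF W zN zN] by blast
      obtain u' where u': "u' \<in> gen_ideal (T \<union> W)" "z * u' \<approx> z" using s_unital_right[OF W zN] by blast
      have WQ: "x \<in> ?Q" if "x \<in> T \<union> W" "x \<noteq> V v" for x
      proof -
        have "x \<in> ?J" using that unfolding diag_ideal_def W_def by (intro gen_base) blast
        then show ?thesis using JQ by blast
      qed
      \<comment> \<open>Only the pair \<open>x = y = V v\<close> is not settled by
        \<open>?J\<close>, and it produces a corner element.\<close>
      have mid: "x * c * z * d * y \<in> ?Q" if xy: "x \<in> T \<union> W" "y \<in> T \<union> W" for x y c d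
      proof -
        consider "x \<in> ?Q" | "y \<in> ?Q" | "x = V v \<and> y = V v" using WQ xy by blast
        then show ?thesis
        proof cases
          case 1
          then have "x * (c * z * d * y) \<in> ?Q" by (rule ts_rmult[OF Q'(1)])
          then show ?thesis by (simp add: mult.assoc)
        next
          case 2
          then show ?thesis by (rule ts_lmult[OF Q'(1)])
        next
          case 3
          have "V v * (c * z * d) * V v \<in> ?Q" by (rule corner[OF ts_mid[OF admD(1)[OF A'] z]])
          then show ?thesis using 3 by (simp add: mult.assoc)
        qed
      qed
      have right: "x * c * z * u' \<in> ?Q" if "x \<in> T \<union> W" for x c
        by (rule gen_mult[OF Q'(1) _ gen_base u'(1), of "{x * c * z}"]) (use mid that in auto)
      have "u * (z * u') \<in> ?Q"
        by (rule gen_mult[OF Q'(1) _ u(1) gen_base, of "{z * u'}"]) (use right in \<open>auto simp: mult.assoc\<close>)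
      moreover have "u * (z * u') \<approx> z" by (rule cT_trans[OF cT_lmult[OF u'(2)] u(2)])
      ultimately show "z \<in> ?Q" using cg_mem[OF Q'(1) cg_mono[OF _ Q'(2)]] by blast
    qed
    show ?thesis
      unfolding sirr_def
    proof (intro conjI allI impI Q)
      fix A B assume A: "adm A" and B: "adm B" and AB: "A \<inter> B \<subseteq> ?Q"
      let ?A = "ideal_sum A ?J" and ?B = "ideal_sum B ?J"
      have sub: "?A \<inter> ?B \<subseteq> ?Q" by (rule ideal_sum_diag_ideal[OF P A B Q AB JQ])
      obtain a where a: "\<forall>f. v.ev f \<in> ?A \<longleftrightarrow> a dvd f"
        using v.ev_principal_ex[OF admD(1)[OF adm_sum[OF A J]]] by blast
      obtain b where b: "\<forall>f. v.ev f \<in> ?B \<longleftrightarrow> b dvd f"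
        using v.ev_principal_ex[OF admD(1)[OF adm_sum[OF B J]]] by blast
      have "q dvd f" if "a dvd f" "b dvd f" for f
      proof -
        have "v.ev f \<in> ?A \<inter> ?B" using that a b by simp
        then show ?thesis using sub q by blast
      qed
      from poly_prime_power_dvd_common_multiple[OF \<open>prime_elem p\<close> qp this]
      have "q dvd a \<or> q dvd b" by blast
      then show "A \<subseteq> ?Q \<or> B \<subseteq> ?Q"
      proof
        assume "q dvd a"
        then have "v.ev f \<in> ?Q" if "v.ev f \<in> ?A" for f using that a q dvd_trans by blast
        then show ?thesis using key[OF A] by blast
      next
        assume "q dvd b"
        then have "v.ev f \<in> ?Q" if "v.ev f \<in> ?B" for f using that b q dvd_trans by blast
        then show ?thesis using key[OF B] by blast
      qed
    qed
  qed
qed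

end

section \<open>Ideals defined by divisibility in the corner\<close>

context leavitt_exitless
begin

text \<open>Membership of \<open>z\<close> in the ideal generated by \<open>h\<close> in the Laurent
  polynomial corner, taken modulo \<open>K\<close>.\<close>

definition "corner_dvd K h z \<longleftrightarrow> (\<exists>n t. C ^ n * z \<approx>\<^bsub>K\<^esub> ev (h * t))"

text \<open>
  For \<open>h = p\<close> this is the candidate for the prime ideal whose power is the given irreducible ideal:
  the powers of \<open>C\<close> in \<open>corner_dvd\<close> only clear the ghost edges.
\<close>

definition "corner_ideal K h = {y \<in> M. \<forall>a b. corner_dvd K h (V v * (a * y * b) * V v)}"

context
  fixes K f
  assumes K: "adm K" and IK: "I \<subseteq> K" and f: "\<And>g. ev g \<in> K \<longleftrightarrow> f dvd g"
begin

lemma K_ts: "two_sided K" and TK: "T \<subseteq> K" and KM: "K \<subseteq> M"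
  using K by (auto simp: adm_def)

lemma cgK: "x \<approx>\<^bsub>I\<^esub> y \<Longrightarrow> x \<approx>\<^bsub>K\<^esub> y"
  by (rule cg_mono[OF _ IK])

lemma corner_ideal_mem: "z \<in> K \<Longrightarrow> corner_dvd K h z"
  unfolding corner_dvd_def by (intro exI[of _ 0]) (simp add: cg_zero)

lemma K_le_corner_ideal: "K \<subseteq> corner_ideal K h"
  unfolding corner_ideal_def using KM by (auto intro!: corner_ideal_mem ts_mid[OF K_ts])

lemma corner_dvd_add:
  assumes "corner_dvd K h x" "corner_dvd K h y" shows "corner_dvd K h (x + y)"
proof -
  obtain n s m t where x: "C ^ n * x \<approx>\<^bsub>K\<^esub> ev (h * s)" and y: "C ^ m * y \<approx>\<^bsub>K\<^esub> ev (h * t)"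
    using assms unfolding corner_dvd_def by blast
  have "C ^ m * (C ^ n * x) + C ^ n * (C ^ m * y) \<approx>\<^bsub>K\<^esub> C ^ m * ev (h * s) + C ^ n * ev (h * t)"
    by (intro cg_add[OF K_ts] cg_lmult[OF K_ts] x y)
  moreover have "C ^ m * (C ^ n * x) + C ^ n * (C ^ m * y) = C ^ (n + m) * (x + y)"
    by (simp add: distrib_left mult.assoc[symmetric] power_add[symmetric] add.commute)
  moreover have "C ^ m * ev (h * s) + C ^ n * ev (h * t) = ev (h * ([:0, 1:] ^ m * s + [:0, 1:] ^ n * t))"
    by (simp only: C_pow_ev ev_add[symmetric] distrib_left mult_ac)
  ultimately show ?thesis unfolding corner_dvd_def by metis
qed

lemma corner_ideal_adm: "adm (corner_ideal K h)"
proof -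
  have "two_sided (corner_ideal K h)"
  proof (rule two_sidedI)
    show "0 \<in> corner_ideal K h" using K_le_corner_ideal ts_zero[OF K_ts] by blast
  next
    fix x y assume xy: "x \<in> corner_ideal K h" "y \<in> corner_ideal K h"
    have "V v * (a * (x + y) * b) * V v = V v * (a * x * b) * V v + V v * (a * y * b) * V v" for a b
      by (simp add: distrib_left distrib_right)
    then show "x + y \<in> corner_ideal K h" using xy corner_dvd_add unfolding corner_ideal_def by (auto intro: ts_add[OF M])
  next
    fix c x assume x: "x \<in> corner_ideal K h"
    have "V v * (a * (c * x) * b) * V v = V v * ((a * c) * x * b) * V v" for a b by (simp add: mult.assoc)
    then show "c * x \<in> corner_ideal K h" using x unfolding corner_ideal_def by (auto intro: ts_lmult[OF M])
    have "V v * (a * (x * c) * b) * V v = V v * (a * x * (c * b)) * V v" for a b by (simp add: mult.assoc)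
    then show "x * c \<in> corner_ideal K h" using x unfolding corner_ideal_def by (auto intro: ts_rmult[OF M])
  qed
  then show ?thesis using K_le_corner_ideal TK unfolding adm_def corner_ideal_def by blast
qed

text \<open>Since \<open>h\<close> divides the generator \<open>f\<close> of \<open>K\<close>, a
  congruence modulo \<open>K\<close> becomes one between polynomials modulo \<open>h\<close>. The
  power of \<open>X\<close> comes from clearing denominators.\<close>

lemma corner_dvd_dvd:
  assumes "h dvd f" "corner_dvd K h z" "C ^ m * z \<approx>\<^bsub>K\<^esub> ev g"
  shows "\<exists>n. h dvd [:0, 1:] ^ n * g"
proof -
  obtain n t where z: "C ^ n * z \<approx>\<^bsub>K\<^esub> ev (h * t)" using assms(2) unfolding corner_dvd_def by blast
  have comm: "C ^ m * (C ^ n * z) = C ^ n * (C ^ m * z)"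
    by (simp add: mult.assoc[symmetric] power_add[symmetric] add.commute)
  have "C ^ n * (C ^ m * z) \<approx>\<^bsub>K\<^esub> C ^ n * ev g" by (rule cg_lmult[OF K_ts assms(3)])
  from cg_sym[OF K_ts this] have "C ^ n * ev g \<approx>\<^bsub>K\<^esub> C ^ m * ev (h * t)"
    by (rule cg_trans[OF K_ts _ cg_lmult[OF K_ts z, of "C ^ m", unfolded comm]])
  then have "ev ([:0, 1:] ^ n * g) - ev ([:0, 1:] ^ m * (h * t)) \<in> K" by (simp only: C_pow_ev cg_def)
  moreover have "ev ([:0, 1:] ^ n * g) - ev ([:0, 1:] ^ m * (h * t)) = ev ([:0, 1:] ^ n * g - [:0, 1:] ^ m * (h * t))"
    using ev_add[of "[:0, 1:] ^ n * g - [:0, 1:] ^ m * (h * t)" "[:0, 1:] ^ m * (h * t)"] by simp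
  ultimately have "f dvd [:0, 1:] ^ n * g - [:0, 1:] ^ m * (h * t)" using f by simp
  then have "h dvd [:0, 1:] ^ n * g - [:0, 1:] ^ m * (h * t)" using assms(1) dvd_trans by blast
  then have "h dvd ([:0, 1:] ^ n * g - [:0, 1:] ^ m * (h * t)) + [:0, 1:] ^ m * (h * t)"
    by (rule dvd_add) (simp add: dvd_mult)
  then show ?thesis by auto
qed

lemma ev_corner_ideal: "h dvd s \<Longrightarrow> ev s \<in> corner_ideal K h"
proof -
  assume "h dvd s"
  then obtain t where t: "s = h * t" by blast
  have "corner_dvd K h (V v * (a * ev s * b) * V v)" for a b
  proof -
    obtain n k where "C ^ n * (V v * (a * ev s * b) * V v) \<approx>\<^bsub>I\<^esub> ev (s * k)" using corner_ev[of a s b] by blast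
    then have "C ^ n * (V v * (a * ev s * b) * V v) \<approx>\<^bsub>K\<^esub> ev (h * (t * k))" using cgK by (simp add: t mult.assoc)
    then show ?thesis unfolding corner_dvd_def by blast
  qed
  then show ?thesis using ev_M by (simp add: corner_ideal_def)
qed

lemma ev_corner_ideal_dvd:
  assumes "h dvd f" "ev s \<in> corner_ideal K h" shows "\<exists>n. h dvd [:0, 1:] ^ n * s"
proof (rule corner_dvd_dvd[OF assms(1)])
  show "corner_dvd K h (V v * (1 * ev s * 1) * V v)" using assms(2) unfolding corner_ideal_def by blast
  have "V v * ev s * V v \<approx> ev s"
  proof -
    have "V v * ev s * V v \<approx> ev s * V v" by (rule cT_rmult[OF V_ev])
    also have "\<dots> = poly_at C s * (V v * V v)" by (simp add: ev_def mult.assoc)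
    also have "\<dots> \<approx> poly_at C s * V v" by (rule cT_lmult[OF VV])
    finally show ?thesis by (simp add: ev_def)
  qed
  then show "C ^ 0 * (V v * (1 * ev s * 1) * V v) \<approx>\<^bsub>K\<^esub> ev s" using cg_mono[OF _ TK] by simp
qed

end

end

section \<open>Irreducible ideals are powers of prime ideals\<close>

context leavitt_family
begin

text \<open>A nonprime irreducible \<open>I\<close> lies properly in an ideal \<open>?N\<close>
  whose square is inside \<open>I\<close>, and reduction for this pair finds a cycle. The polynomial
  \<open>f\<close> of \<open>I\<close> there is a prime power up to a unit, since a coprime
  splitting of \<open>f\<close> makes \<open>I\<close> an intersection of two corner ideals.\<close>

theorem irr_prime_power:
  assumes irr: "irr I" and neq: "I \<noteq> M"
  shows "\<exists>P n. prm P \<and> I = pw P (Suc n)"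
proof (cases "prm I")
  case True
  then show ?thesis by (intro exI[of _ I] exI[of _ 0]) simp
next
  case False
  have I: "adm I" using irr by (rule irr_adm)
  note I' = admD[OF I]
  obtain A B where AB: "adm A" "adm B" "\<And>a b. a \<in> A \<Longrightarrow> b \<in> B \<Longrightarrow> a * b \<in> I" "\<not> A \<subseteq> I" "\<not> B \<subseteq> I"
    using False I neq unfolding prm_def by blast
  let ?N = "ideal_sum A I \<inter> ideal_sum B I"
  have AI: "adm (ideal_sum A I)" "adm (ideal_sum B I)" using adm_sum AB I by blast+
  have N: "adm ?N" by (rule adm_Int[OF AI])
  have sup: "I \<subseteq> ideal_sum A I" "I \<subseteq> ideal_sum B I" "A \<subseteq> ideal_sum A I" "B \<subseteq> ideal_sum B I"
    using ideal_sum_left[OF I'(1)] ideal_sum_right admD(1)[OF AB(1)] admD(1)[OF AB(2)] by blast+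
  have "?N \<noteq> I"
  proof
    assume "?N = I"
    then have "ideal_sum A I = I \<or> ideal_sum B I = I" using irr AI unfolding irr_def by blast
    then show False using sup AB(4,5) by blast
  qed
  have NN: "x * y \<in> I" if xy: "x \<in> ?N" "y \<in> ?N" for x y
  proof -
    have "x \<in> ideal_sum A I" "y \<in> ideal_sum B I" using xy by auto
    then obtain a i b j where *: "x = a + i" "y = b + j" "a \<in> A" "b \<in> B" "i \<in> I" "j \<in> I"
      unfolding ideal_sum_def by blast
    have "x * y = a * b + (a + i) * j + i * b" by (simp add: * algebra_simps)
    also have "\<dots> \<in> I" by (intro ts_add[OF I'(1)] ts_lmult[OF I'(1)] ts_rmult[OF I'(1)] AB(3) *)
    finally show ?thesis .
  qed
  have IN: "I \<subseteq> ?N" using sup by blast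
  \<comment> \<open>An idempotent of \<open>?N\<close> lies in the square of
    \<open>?N\<close>.\<close>
  have "d \<in> I" if "d \<in> DId" "d \<in> ?N" for d
    using NN[OF that(2,2)] cg_mem[OF I'(1) cg_mono[OF DId_idem[OF that(1)] I'(2)]] by blast
  then obtain v y where v: "exitless I v" "y \<in> ?N" "y \<notin> I" "V v * y * V v \<approx> y"
    using reduction_step[OF I N IN \<open>?N \<noteq> I\<close>] by blast
  let ?J = "diag_ideal I"
  have J: "adm ?J" by (rule diag_ideal_adm)
  note J' = admD[OF J]
  have JI: "?J \<subseteq> I" by (rule diag_ideal_le[OF I])
  have XLJ: "exitless ?J v" using v(1) exitless_diag_ideal[OF I] by blast
  interpret v: leavitt_exitless E V ed gh sc T M ?J v by (rule leavitt_exitlessI[OF J XLJ])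
  have live: "V v \<notin> I" using v(1) by (simp add: exitless_def)
  have VId: "V v \<in> DId" by (rule V_DId[OF v.v_verts])
  obtain f where f: "\<forall>g. v.ev g \<in> I \<longleftrightarrow> f dvd g" using v.ev_principal_ex[OF I'(1)] by blast
  note f' = f[rule_format]
  have yM: "y \<in> M" using v(2) admD(3)[OF N] by blast
  obtain n g where g: "v.C ^ n * (V v * y * V v) \<approx>\<^bsub>?J\<^esub> v.ev g" using v.corner[OF yM] by blast
  have "V v * y * V v \<in> ?N" by (rule ts_mid[OF admD(1)[OF N] v(2)])
  then have gN: "v.ev g \<in> ?N" using v.corner_mem[OF admD(1)[OF N] _ g] JI IN by blast
  have gI: "v.ev g \<notin> I"
  proof
    assume "v.ev g \<in> I"
    then have "V v * y * V v \<in> I" using v.corner_mem[OF I'(1) JI g] by blast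
    then show False using v(3) cg_mem[OF I'(1) cg_mono[OF v(4) I'(2)]] by blast
  qed
  \<comment> \<open>Now \<open>f\<close> divides \<open>g * g\<close> but not \<open>g\<close>,
    which is impossible for \<open>f = 0\<close>.\<close>
  have "v.ev (g * g) \<in> I" using NN[OF gN gN] unfolding cg_mem[OF I'(1) cg_mono[OF v.ev_ev[of g g] I'(2)]] .
  then have "f dvd g * g" using f'[of "g * g"] by (rule iffD1[rotated])
  moreover have "\<not> f dvd g" using f'[of g] gI by simp
  ultimately have fnz: "f \<noteq> 0" by auto
  have fnu: "\<not> is_unit f" using f'[of 1] live by simp
  obtain p where p: "prime_elem p" "p dvd f" using poly_prime_divisor[OF fnz fnu] by blast
  obtain k h where h: "f = p ^ k * h" "\<not> p dvd h" using poly_prime_power_factor[OF p(1) fnz] by blast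
  have pnz: "p \<noteq> 0" and pnu: "\<not> is_unit p" using p(1) by (auto simp: prime_elem_def)
  have knz: "k \<noteq> 0" using h p(2) by (intro notI) simp
  then obtain m where m: "k = Suc m" using not0_implies_Suc by blast
  \<comment> \<open>\<open>X\<close> is invertible in the corner, so it could be cancelled from the
    generator \<open>f\<close>, which would then divide a nonzero polynomial of smaller
    degree.\<close>
  have Xf: "\<not> p dvd [:0, 1:]"
  proof
    assume "p dvd [:0, 1:]"
    then have "[:0, 1:] dvd f" using poly_prime_dvd_X[OF p(1)] p(2) dvd_trans by blast
    then obtain s where s: "f = [:0, 1:] * s" by blast
    then have "v.ev ([:0, 1:] ^ 1 * s) \<in> I" using f' by simp
    then have "f dvd s" using v.ev_cancel_X[OF I'(1) JI] f' by blast
    moreover have "s \<noteq> 0" using s fnz by auto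
    ultimately have "degree f \<le> degree s" by (rule dvd_imp_degree_le)
    moreover have "degree f = Suc (degree s)" using s \<open>s \<noteq> 0\<close> by (simp add: degree_mult_eq)
    ultimately show False by simp
  qed
  have pX: "p dvd g" if "p dvd [:0, 1:] ^ n * g" for n g
    using that prime_elem_dvd_multD[OF p(1)] prime_elem_dvd_power[OF p(1)] Xf by blast
  note Kadm = v.corner_ideal_adm[OF I JI f'] and Kle = v.K_le_corner_ideal[OF I JI f'] and Kev = v.ev_corner_ideal[OF I JI f']
    and Kdvd = v.ev_corner_ideal_dvd[OF I JI f'] and Cdvd = v.corner_dvd_dvd[OF I JI f']
  \<comment> \<open>The corner ideals of \<open>p ^ k\<close> and \<open>h\<close> intersect in
    \<open>I\<close>, so one of them is \<open>I\<close>. It cannot be that of \<open>h\<close>, as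
    \<open>p\<close> divides \<open>f\<close> but not \<open>h\<close>.\<close>
  have fk: "v.ev s \<in> I \<longleftrightarrow> p ^ k dvd s" for s
  proof -
    let ?K1 = "v.corner_ideal I (p ^ k)" and ?K2 = "v.corner_ideal I h"
    have "?K1 \<inter> ?K2 \<subseteq> I"
    proof
      fix y assume y: "y \<in> ?K1 \<inter> ?K2"
      show "y \<in> I"
      proof (rule ccontr)
        assume "y \<notin> I"
        have yM: "y \<in> M" using y by (simp add: v.corner_ideal_def)
        \<comment> \<open>Irreducibility, applied on the left and then on the right, brings an
          element outside \<open>I\<close> into the corner without losing it.\<close>
        obtain a where a: "V v * a * y \<notin> I" using irr_corner(1)[OF irr VId live yM \<open>y \<notin> I\<close>] by blast
        obtain b where b: "V v * a * y * b * V v \<notin> I"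
          using irr_corner(2)[OF irr VId live ts_lmult[OF M yM] a] by blast
        have wM: "a * y * b \<in> M" by (rule ts_mid[OF M yM])
        obtain n g where g: "v.C ^ n * (V v * (a * y * b) * V v) \<approx>\<^bsub>?J\<^esub> v.ev g" using v.corner[OF wM] by blast
        have gI: "v.C ^ n * (V v * (a * y * b) * V v) \<approx>\<^bsub>I\<^esub> v.ev g" by (rule cg_mono[OF g JI])
        have "v.corner_dvd I (p ^ k) (V v * (a * y * b) * V v)" "v.corner_dvd I h (V v * (a * y * b) * V v)"
          using y by (simp_all add: v.corner_ideal_def)
        then obtain i j where ij: "p ^ k dvd [:0, 1:] ^ i * g" "h dvd [:0, 1:] ^ j * g"
          using Cdvd[OF _ _ gI] h(1) by (metis dvd_triv_left dvd_triv_right)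
        have "p ^ k dvd [:0, 1:] ^ j * ([:0, 1:] ^ i * g)" "h dvd [:0, 1:] ^ i * ([:0, 1:] ^ j * g)"
          using ij by (simp_all only: dvd_mult)
        then have "p ^ k * h dvd [:0, 1:] ^ (i + j) * g"
          by (intro prime_power_coprime_mult_dvd[OF p(1) h(2)]) (simp_all only: power_add mult_ac)
        then have "v.ev ([:0, 1:] ^ (i + j) * g) \<in> I" using f' h(1) by simp
        then have "v.ev g \<in> I" using v.ev_cancel_X[OF I'(1) JI] by blast
        then have "V v * (a * y * b) * V v \<in> I" using v.corner_mem[OF I'(1) JI g] by blast
        then show False using b by (simp add: mult.assoc)
      qed
    qed
    then have "?K1 \<inter> ?K2 = I" by (rule equalityI[OF _ Int_greatest[OF Kle Kle]])
    then consider "?K1 = I" | "?K2 = I" using irr Kadm unfolding irr_def by blast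
    then have "f dvd p ^ k"
    proof cases
      case 1
      then show ?thesis using Kev[of "p ^ k" "p ^ k"] f' by simp
    next
      case 2
      then have "f dvd h" using Kev[of h h] f' by simp
      then show ?thesis using p(2) h(2) dvd_trans by blast
    qed
    moreover have "p ^ k dvd f" using h(1) by simp
    ultimately show ?thesis using f' dvd_trans by blast
  qed
  define P where "P = v.corner_ideal I p"
  have P: "adm P" unfolding P_def by (rule Kadm)
  note P' = admD[OF P]
  have IP: "I \<subseteq> P" unfolding P_def by (rule Kle)
  have evP: "v.ev s \<in> P \<longleftrightarrow> p dvd s" for s
  proof
    assume "v.ev s \<in> P"
    then obtain n where "p dvd [:0, 1:] ^ n * s" using Kdvd[OF p(2), of s] unfolding P_def by blast
    then show "p dvd s" by (rule pX)
  next
    assume "p dvd s"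
    then show "v.ev s \<in> P" unfolding P_def by (rule Kev)
  qed
  have liveP: "V v \<notin> P" using evP[of 1] pnu by simp
  have prmP: "prm P" unfolding prm_def
  proof (intro conjI allI impI P)
    show "P \<noteq> M" using liveP V_M[OF v.v_verts] by blast
    fix A B assume A: "adm A" and B: "adm B" and AB: "\<forall>a\<in>A. \<forall>b\<in>B. a * b \<in> P"
    \<comment> \<open>The primality of \<open>p\<close> will be applied to polynomials extracted
      from \<open>A\<close> and \<open>B\<close>. Adding \<open>I\<close> brings these ideals above
      \<open>?J\<close>, as \<open>corner_mem\<close> demands.\<close>
    have witness: "\<exists>s. v.ev s \<in> ideal_sum A I \<and> \<not> p dvd s" if A: "adm A" and nle: "\<not> A \<subseteq> P" for A
    proof -
      obtain a where a: "a \<in> A" "a \<notin> P" using nle by blast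
      then have aM: "a \<in> M" using admD(3)[OF A] by blast
      then obtain c d where cd: "\<not> v.corner_dvd I p (V v * (c * a * d) * V v)"
        using a(2) unfolding P_def v.corner_ideal_def by blast
      obtain n s where s: "v.C ^ n * (V v * (c * a * d) * V v) \<approx>\<^bsub>?J\<^esub> v.ev s"
        using v.corner[OF ts_mid[OF M aM]] by blast
      have "\<not> p dvd s"
      proof
        assume "p dvd s"
        then obtain t where "s = p * t" by blast
        then have "v.corner_dvd I p (V v * (c * a * d) * V v)"
          unfolding v.corner_dvd_def using cg_mono[OF s JI] by blast
        then show False using cd by blast
      qed
      have sum: "adm (ideal_sum A I)" by (rule adm_sum[OF A I])
      have "a \<in> ideal_sum A I" using a(1) by (rule subsetD[OF ideal_sum_left[OF I'(1)]])
      then have "c * a * d \<in> ideal_sum A I" by (rule ts_mid[OF admD(1)[OF sum]])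
      then have "V v * (c * a * d) * V v \<in> ideal_sum A I" by (rule ts_mid[OF admD(1)[OF sum]])
      moreover have "?J \<subseteq> ideal_sum A I" using JI ideal_sum_right[OF admD(1)[OF A], of I] by (rule subset_trans)
      ultimately have "v.ev s \<in> ideal_sum A I" using v.corner_mem[OF admD(1)[OF sum] _ s] by blast
      with \<open>\<not> p dvd s\<close> show ?thesis by blast
    qed
    show "A \<subseteq> P \<or> B \<subseteq> P"
    proof (rule ccontr)
      assume "\<not> (A \<subseteq> P \<or> B \<subseteq> P)"
      then obtain s t where s: "v.ev s \<in> ideal_sum A I" "\<not> p dvd s" and t: "v.ev t \<in> ideal_sum B I" "\<not> p dvd t"
        using witness[OF A] witness[OF B] by blast
      from s(1) t(1) obtain a i b j where *: "v.ev s = a + i" "v.ev t = b + j" "a \<in> A" "b \<in> B" "i \<in> P" "j \<in> P"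
        using IP unfolding ideal_sum_def by blast
      have "v.ev s * v.ev t = a * b + (a + i) * j + i * b" by (simp add: * algebra_simps)
      also have "\<dots> \<in> P"
        using AB[rule_format, OF *(3,4)] by (intro ts_add[OF P'(1)] ts_lmult[OF P'(1) *(6)] ts_rmult[OF P'(1) *(5)])
      finally have "v.ev (s * t) \<in> P" unfolding cg_mem[OF P'(1) cg_mono[OF v.ev_ev[of s t] P'(2)]] .
      then have "p dvd s * t" unfolding evP .
      then show False using s(2) t(2) prime_elem_dvd_multD[OF p(1)] by blast
    qed
  qed
  \<comment> \<open>A diagonal idempotent of \<open>P\<close> outside \<open>I\<close> could be
    conjugated into the corner, where diagonal elements are scalar multiples of \<open>V v\<close>.
    The scalar is nonzero, so \<open>V v\<close> would lie in \<open>P\<close>.\<close>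
  have DP: "DId \<inter> P = DId \<inter> I"
  proof (rule ccontr)
    assume "DId \<inter> P \<noteq> DId \<inter> I"
    then obtain d where d: "d \<in> DId" "d \<in> P" "d \<notin> I" using IP by blast
    obtain a where a: "V v * a * d \<notin> I" using irr_corner(1)[OF irr VId live DId_M[OF d(1)] d(3)] by blast
    have "V v * (V v * a) * d \<notin> I"
    proof -
      have "V v * (V v * a) * d \<approx> V v * a * d"
        using cT_rmult[OF v.VV, of "a * d"] by (simp add: mult.assoc)
      then show ?thesis using a cg_mem[OF I'(1) cg_mono[OF _ I'(2)]] by blast
    qed
    from mnl_witness[OF I'(1,2) ts_rmult[OF M V_M[OF v.v_verts]] this]
    obtain q w r where q: "wlk q w" "wlk r w" "V v * mnl q w r * d \<notin> I" by blast
    have qv: "awalk v q w"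
    proof (rule ccontr)
      assume "\<not> awalk v q w"
      then have "V v * re q * V w \<in> T" using q(1) V_re0 v.v_verts by (metis wlk_def)
      then have "V v * re q * V w \<in> I" using I'(2) by blast
      then have "V v * re q * V w * (gho r * d) \<in> I" by (rule ts_rmult[OF I'(1)])
      then show False using q(3) by (simp add: mnl_def mult.assoc)
    qed
    let ?e = "mnl q w r * d * mnl r w q"
    have Vmnl: "V v * mnl q w r \<approx> mnl q w r"
      using cT_rmult[OF V_re[OF qv], of "gho r"] by (simp add: mnl_def mult.assoc)
    have mnlV: "mnl r w q * V v \<approx> mnl r w q"
      using cT_lmult[OF gho_V[OF qv], of "re r"] by (simp add: mnl_def mult.assoc)
    have eP: "?e \<in> P" by (rule ts_mid[OF P'(1) d(2)])
    have eI: "?e \<notin> I"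
    proof
      assume "?e \<in> I"
      then have "?e * (mnl q w r * d) \<in> I" by (rule ts_rmult[OF I'(1)])
      then have "mnl q w r * d \<in> I"
        using cg_mem[OF I'(1) cg_mono[OF DId_left_unit[OF d(1) q(1,2)] I'(2)]] by blast
      then have "V v * (mnl q w r * d) \<in> I" by (rule ts_lmult[OF I'(1)])
      then show False using q(3) by (simp add: mult.assoc)
    qed
    obtain c where c: "V v * ?e * V v \<approx>\<^bsub>?J\<^esub> sc c * V v"
      using v.corner_D[OF D_conj[OF DId_D[OF d(1)] q(1,2)]] by blast
    have "V v * ?e * V v = (V v * mnl q w r) * d * (mnl r w q * V v)" by (simp only: mult.assoc)
    also have "\<dots> \<approx> mnl q w r * d * mnl r w q" by (rule cT_mult[OF cT_rmult[OF Vmnl] mnlV])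
    finally have e: "V v * ?e * V v \<approx> ?e" .
    have "V v * ?e * V v \<in> P" by (rule ts_mid[OF P'(1) eP])
    then have "sc c * V v \<in> P" using cg_mem[OF P'(1) cg_mono[OF c]] JI IP by blast
    moreover have "c \<noteq> 0"
    proof
      assume "c = 0"
      then have "V v * ?e * V v \<in> I" using c JI by (auto simp: cg_zero)
      then show False using eI cg_mem[OF I'(1) cg_mono[OF e I'(2)]] by blast
    qed
    ultimately have "V v \<in> P" using sc_mem[OF P'(1)] by blast
    then show False using liveP by blast
  qed
  have JP: "diag_ideal P = ?J" using DP by (simp add: diag_ideal_def)
  have XLP: "exitless P v" by (rule exitless_cong[OF I P DP[symmetric] v(1)])
  define Q where "Q = pw P (Suc m)"
  have Q: "adm Q" unfolding Q_def by (rule pw_adm[OF P])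
  note Q' = admD[OF Q]
  have JQ: "?J \<subseteq> Q" unfolding Q_def using diag_ideal_pw[OF P, of m] JP by simp
  have evpow: "v.ev (p ^ Suc n) \<in> pw P (Suc n)" for n
  proof (induction n)
    case 0
    then show ?case using evP[of p] by simp
  next
    case (Suc n)
    have "v.ev (p ^ Suc n) * v.ev p \<in> pr (pw P (Suc n)) P" using Suc evP[of p] by (intro pr_mult) simp_all
    then have "v.ev (p ^ Suc n) * v.ev p \<in> pw P (Suc (Suc n))" by simp
    moreover have "v.ev (p ^ Suc n) * v.ev p \<approx> v.ev (p ^ Suc n * p)" by (rule v.ev_ev)
    ultimately have "v.ev (p ^ Suc n * p) \<in> pw P (Suc (Suc n))"
      using pw_adm[OF P, of "Suc n"] cg_mem[OF admD(1) cg_mono[OF _ admD(2)]] by blast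
    then show ?case by (simp only: power_Suc2)
  qed
  \<comment> \<open>By \<open>irr_structure\<close>, beyond the common diagonal ideal only the
    corner has to be compared, and there membership in \<open>I\<close> means divisibility by
    \<open>p ^ k\<close>.\<close>
  have "I \<subseteq> Q"
  proof -
    have "V v * z * V v \<in> Q" if z: "z \<in> I" for z
    proof -
      have "z \<in> M" using z I'(3) by blast
      then obtain n s where s: "v.C ^ n * (V v * z * V v) \<approx>\<^bsub>?J\<^esub> v.ev s" using v.corner[of z] by blast
      have "V v * z * V v \<in> I" by (rule ts_mid[OF I'(1) z])
      then have "p ^ k dvd s" using v.corner_mem[OF I'(1) JI s] fk by blast
      then obtain t where "s = t * p ^ Suc m" by (auto simp: m dvd_def mult.commute)
      then have "v.ev s \<in> Q" using ts_lmult[OF Q'(1) evpow[of m, folded Q_def]] by (simp only: v.ev_mult)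
      then show ?thesis using v.corner_mem[OF Q'(1) JQ s] by blast
    qed
    then have "?J \<union> {V v * z * V v | z. z \<in> I} \<subseteq> Q" using JQ by blast
    from gen_least[OF Q'(1) this] irr_structure[OF irr v(1)] show ?thesis by blast
  qed
  moreover have "Q \<subseteq> I"
  proof -
    \<comment> \<open>\<open>P\<close> is prime, hence irreducible, so \<open>irr_structure\<close>
      generates it by \<open>?J\<close> and the value of \<open>p\<close>. Multiplying generators
      then keeps the powers of \<open>P\<close> inside the ideals \<open>R n\<close>.\<close>
    define R where "R n = gen_ideal (?J \<union> {v.ev (p ^ n)})" for n
    have R: "adm (R n)" for n unfolding R_def using J' v.ev_M by (intro adm_gen) auto
    have JR: "?J \<subseteq> R n" and evR: "v.ev (p ^ n) \<in> R n" for n unfolding R_def by (auto intro: gen_base)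
    have PR: "P \<subseteq> R 1"
    proof -
      have "V v * z * V v \<in> R 1" if z: "z \<in> P" for z
      proof -
        have "z \<in> M" using z P'(3) by blast
        then obtain n s where s: "v.C ^ n * (V v * z * V v) \<approx>\<^bsub>?J\<^esub> v.ev s" using v.corner[of z] by blast
        have "V v * z * V v \<in> P" by (rule ts_mid[OF P'(1) z])
        moreover have "?J \<subseteq> P" using JI IP by blast
        ultimately have "p dvd s" using v.corner_mem[OF P'(1) _ s] evP by blast
        then obtain t where "s = t * p ^ 1" by (auto simp: dvd_def mult.commute)
        then have "v.ev s \<in> R 1" using ts_lmult[OF admD(1)[OF R] evR] by (simp only: v.ev_mult)
        then show ?thesis using v.corner_mem[OF admD(1)[OF R] JR s] by blast
      qed
      then have "diag_ideal P \<union> {V v * z * V v | z. z \<in> P} \<subseteq> R 1" using JR JP by blast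
      from gen_least[OF admD(1)[OF R] this] irr_structure[OF prm_irr[OF prmP] XLP] show ?thesis by blast
    qed
    have pwR: "pw P (Suc n) \<subseteq> R (Suc n)" for n
    proof (induction n)
      case 0
      then show ?case using PR by simp
    next
      case (Suc n)
      have "a * b \<in> R (Suc (Suc n))" if ab: "a \<in> pw P (Suc n)" "b \<in> P" for a b
      proof (rule gen_mult[OF admD(1)[OF R]])
        show "a \<in> gen_ideal (?J \<union> {v.ev (p ^ Suc n)})" using ab Suc unfolding R_def by blast
        show "b \<in> gen_ideal (?J \<union> {v.ev (p ^ 1)})" using ab PR unfolding R_def by blast
        fix x y c assume "x \<in> ?J \<union> {v.ev (p ^ Suc n)}" "y \<in> ?J \<union> {v.ev (p ^ 1)}"
        then consider "x \<in> R (Suc (Suc n))" | "y \<in> R (Suc (Suc n))" | "x = v.ev (p ^ Suc n) \<and> y = v.ev (p ^ 1)"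
          using JR by blast
        then show "x * c * y \<in> R (Suc (Suc n))"
        proof cases
          case 1
          then have "x * (c * y) \<in> R (Suc (Suc n))" by (rule ts_rmult[OF admD(1)[OF R]])
          then show ?thesis by (simp add: mult.assoc)
        next
          case 2
          then show ?thesis by (rule ts_lmult[OF admD(1)[OF R]])
        next
          case 3
          have "v.ev (p ^ Suc n * p ^ 1) \<in> R (Suc (Suc n))" using evR[of "Suc (Suc n)"] by (simp add: mult.commute)
          then show ?thesis using 3 v.ev_sandwich[OF admD(1)[OF R] JR] by blast
        qed
      qed
      then have "pr (pw P (Suc n)) P \<subseteq> R (Suc (Suc n))" by (rule pr_least[OF R])
      then show ?case by simp
    qed
    have "R (Suc m) \<subseteq> I" unfolding R_def using JI fk[of "p ^ Suc m"] m by (intro gen_least[OF I'(1)]) simp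
    then show ?thesis using pwR[of m] unfolding Q_def by blast
  qed
  ultimately have "I = Q" by blast
  then show ?thesis using prmP unfolding Q_def by blast
qed

theorem irreducible_iff:
  assumes "adm I" "I \<noteq> M"
  shows "sirr I \<longleftrightarrow> irr I" "irr I \<longleftrightarrow> (\<exists>P n. prm P \<and> n \<ge> 1 \<and> I = pw P n)"
proof -
  have 1: "irr I \<Longrightarrow> \<exists>P n. prm P \<and> n \<ge> 1 \<and> I = pw P n"
    using irr_prime_power[OF _ assms(2)] by (metis One_nat_def le_add1 plus_1_eq_Suc)
  have 2: "sirr I" if ex: "\<exists>P n. prm P \<and> n \<ge> 1 \<and> I = pw P n"
  proof -
    obtain P n where "prm P" "n \<ge> 1" "I = pw P n" using ex by blast
    then show ?thesis using prime_power_sirr[of P "n - 1"] by simp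
  qed
  show "sirr I \<longleftrightarrow> irr I" using 1 2 sirr_irr by blast
  show "irr I \<longleftrightarrow> (\<exists>P n. prm P \<and> n \<ge> 1 \<and> I = pw P n)" using 1 2 sirr_irr by blast
qed

end

section \<open>Quotients of free algebras\<close>

lemma sum_single_keys: "(\<Sum>w\<in>Poly_Mapping.keys p. Poly_Mapping.single w (Poly_Mapping.lookup p w)) = p"
proof (rule poly_mapping_eqI)
  fix k
  have "Poly_Mapping.lookup (\<Sum>w\<in>Poly_Mapping.keys p. Poly_Mapping.single w (Poly_Mapping.lookup p w)) k =
      (\<Sum>w\<in>Poly_Mapping.keys p. if w = k then Poly_Mapping.lookup p w else 0)"
    unfolding lookup_sum by (rule sum.cong) (auto simp: lookup_single when_def)
  also have "\<dots> = Poly_Mapping.lookup p k"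
    by (simp add: in_keys_iff)
  finally show "Poly_Mapping.lookup (\<Sum>w\<in>Poly_Mapping.keys p. Poly_Mapping.single w (Poly_Mapping.lookup p w)) k =
      Poly_Mapping.lookup p k" .
qed

lemma single_0_central: "Poly_Mapping.single 0 c * p = p * (Poly_Mapping.single 0 c :: 'a::monoid_add \<Rightarrow>\<^sub>0 'k::field)"
proof -
  let ?S = "\<Sum>w\<in>Poly_Mapping.keys p. Poly_Mapping.single w (Poly_Mapping.lookup p w)"
  have "Poly_Mapping.single 0 c * ?S = ?S * Poly_Mapping.single 0 c"
    by (simp add: sum_distrib_left sum_distrib_right mult_single mult.commute)
  then show ?thesis by (simp only: sum_single_keys)
qed

lemma two_sided_ideal_iff:
  "two_sided_ideal J R \<longleftrightarrow> J \<subseteq> carrier R \<and> \<zero>\<^bsub>R\<^esub> \<in> J \<and> (\<forall>x\<in>J. \<forall>y\<in>J. x \<oplus>\<^bsub>R\<^esub> y \<in> J) \<and>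
     (\<forall>x\<in>J. \<ominus>\<^bsub>R\<^esub> x \<in> J) \<and> (\<forall>a\<in>J. \<forall>x\<in>carrier R. x \<otimes>\<^bsub>R\<^esub> a \<in> J \<and> a \<otimes>\<^bsub>R\<^esub> x \<in> J)"
  unfolding two_sided_ideal_def two_sided_ideal_axioms_def additive_subgroup_def subgroup_def a_inv_def
  by auto

definition fcar :: "'a set \<Rightarrow> ('a word \<Rightarrow>\<^sub>0 'k::field) set" where
  "fcar X = {p. \<forall>w \<in> Poly_Mapping.keys p. letters w \<noteq> [] \<and> set (letters w) \<subseteq> X}"

text \<open>Dividing out this ideal leaves the unital free algebra on \<open>X\<close>. Hence every
  element is a member of \<open>fcar X\<close> plus a constant plus an outer part.\<close>

definition outer :: "'a set \<Rightarrow> ('a word \<Rightarrow>\<^sub>0 'k::field) set" where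
  "outer X = {p. \<forall>w \<in> Poly_Mapping.keys p. \<not> set (letters w) \<subseteq> X}"

lemma free_algebra_simps [simp]:
  "carrier (free_algebra TYPE('k::field) X) = fcar X"
  "x \<otimes>\<^bsub>free_algebra TYPE('k) X\<^esub> y = x * y"
  "x \<oplus>\<^bsub>free_algebra TYPE('k) X\<^esub> y = x + y"
  "\<zero>\<^bsub>free_algebra TYPE('k) X\<^esub> = 0"
  by (simp_all add: free_algebra_def fcar_def)

lemma keys_uminus' [simp]: "Poly_Mapping.keys (- p :: 'a \<Rightarrow>\<^sub>0 'k::ab_group_add) = Poly_Mapping.keys p"
  by (auto simp: in_keys_iff)

lemma letters_plus [simp]: "letters (u + w) = letters u @ letters w"
  by (simp add: plus_word_def)

lemma letters_0 [simp]: "letters 0 = []"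
  by (simp add: zero_word_def)

lemma fcar_zero: "0 \<in> fcar X"
  and fcar_add: "p \<in> fcar X \<Longrightarrow> q \<in> fcar X \<Longrightarrow> p + q \<in> fcar X"
  and fcar_uminus: "p \<in> fcar X \<Longrightarrow> - p \<in> fcar X"
  using keys_add[of p q] by (fastforce simp: fcar_def)+

lemma fcar_sum: "(\<And>i. i \<in> S \<Longrightarrow> f i \<in> fcar X) \<Longrightarrow> sum f S \<in> fcar X"
  by (induction S rule: infinite_finite_induct) (auto simp: fcar_zero fcar_add)

lemma fcar_diff: "p \<in> fcar X \<Longrightarrow> q \<in> fcar X \<Longrightarrow> p - q \<in> fcar X"
  using fcar_add[of p X "- q"] fcar_uminus[of q X] by simp

lemma fcar_mult:
  assumes "p \<in> fcar X" "q \<in> fcar X" shows "p * q \<in> fcar X"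
  unfolding fcar_def
proof (intro CollectI ballI)
  fix w assume "w \<in> Poly_Mapping.keys (p * q)"
  then obtain a b where "w = a + b" "a \<in> Poly_Mapping.keys p" "b \<in> Poly_Mapping.keys q" using keys_mult[of p q] by blast
  then show "letters w \<noteq> [] \<and> set (letters w) \<subseteq> X" using assms by (auto simp: fcar_def)
qed

lemma fcar_scale:
  assumes "p \<in> fcar X" shows "scale c p \<in> fcar X"
  unfolding fcar_def
proof (intro CollectI ballI)
  fix w assume "w \<in> Poly_Mapping.keys (scale c p)"
  then obtain a b where "w = a + b" "a \<in> Poly_Mapping.keys (Poly_Mapping.single 0 c :: 'a word \<Rightarrow>\<^sub>0 'b)" "b \<in> Poly_Mapping.keys p"
    using keys_mult[of "Poly_Mapping.single 0 c" p] unfolding scale_def by blast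
  then have "w = 0 + b" "b \<in> Poly_Mapping.keys p" by (auto split: if_splits)
  then show "letters w \<noteq> [] \<and> set (letters w) \<subseteq> X" using assms by (auto simp: fcar_def)
qed

lemma two_sided_outer: "two_sided (outer X :: ('a word \<Rightarrow>\<^sub>0 'k::field) set)"
proof (rule two_sidedI)
  show "(0 :: 'a word \<Rightarrow>\<^sub>0 'k) \<in> outer X" by (simp add: outer_def)
  fix p q :: "'a word \<Rightarrow>\<^sub>0 'k"
  show "p \<in> outer X \<Longrightarrow> q \<in> outer X \<Longrightarrow> p + q \<in> outer X" using keys_add[of p q] by (fastforce simp: outer_def)
  show "q * p \<in> outer X" if "p \<in> outer X" unfolding outer_def
  proof (intro CollectI ballI)
    fix w assume "w \<in> Poly_Mapping.keys (q * p)"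
    then obtain a b where "w = a + b" "b \<in> Poly_Mapping.keys p" using keys_mult[of q p] by blast
    then show "\<not> set (letters w) \<subseteq> X" using that by (auto simp: outer_def)
  qed
  show "p * q \<in> outer X" if "p \<in> outer X" unfolding outer_def
  proof (intro CollectI ballI)
    fix w assume "w \<in> Poly_Mapping.keys (p * q)"
    then obtain a b where "w = a + b" "a \<in> Poly_Mapping.keys p" using keys_mult[of p q] by blast
    then show "\<not> set (letters w) \<subseteq> X" using that by (auto simp: outer_def)
  qed
qed

lemma fcar_outer: "p \<in> fcar X \<Longrightarrow> p \<in> outer X \<Longrightarrow> p = 0"
  unfolding keys_eq_empty[symmetric] by (auto simp: fcar_def outer_def)

lemma fcar_outer_eq: "p \<in> fcar X \<Longrightarrow> q \<in> fcar X \<Longrightarrow> p - q \<in> outer X \<Longrightarrow> p = q"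
  using fcar_outer[OF fcar_diff] by fastforce

lemma poly_mapping_decomp:
  obtains f c z where "p = f + Poly_Mapping.single 0 c + z" "f \<in> fcar X" "z \<in> outer X"
proof -
  let ?s = "\<lambda>w. Poly_Mapping.single w (Poly_Mapping.lookup p w)"
  let ?K = "Poly_Mapping.keys p"
  let ?A = "{w \<in> ?K. letters w \<noteq> [] \<and> set (letters w) \<subseteq> X}"
  let ?B = "{w \<in> ?K. letters w = []}" and ?C = "{w \<in> ?K. \<not> set (letters w) \<subseteq> X}"
  have "p = sum ?s (?A \<union> ?B \<union> ?C)"
  proof -
    have "?A \<union> ?B \<union> ?C = ?K" by auto
    then show ?thesis by (simp only: sum_single_keys)
  qed
  also have "\<dots> = sum ?s (?A \<union> ?B) + sum ?s ?C" by (rule sum.union_disjoint) auto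
  also have "sum ?s (?A \<union> ?B) = sum ?s ?A + sum ?s ?B" by (rule sum.union_disjoint) auto
  also have "sum ?s ?B = Poly_Mapping.single 0 (Poly_Mapping.lookup p 0)"
  proof (cases "0 \<in> ?K")
    case True
    have eq: "w = 0" if "letters w = []" for w :: "'a word"
      using that by (cases w) (simp add: zero_word_def)
    have "?B = {0}" using True by (auto intro: eq)
    then show ?thesis by simp
  next
    case False
    have eq: "w = 0" if "letters w = []" for w :: "'a word"
      using that by (cases w) (simp add: zero_word_def)
    have "?B = {}" using False by (auto dest: eq)
    then show ?thesis using False unfolding \<open>?B = {}\<close> by (simp add: in_keys_iff)
  qed
  finally have "p = sum ?s ?A + Poly_Mapping.single 0 (Poly_Mapping.lookup p 0) + sum ?s ?C" .
  moreover have "sum ?s ?A \<in> fcar X" by (rule fcar_sum) (auto simp: fcar_def)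
  moreover have "sum ?s ?C \<in> outer X" by (rule ts_sum[OF two_sided_outer]) (simp add: outer_def)
  ultimately show ?thesis using that by blast
qed

definition lift_ideal :: "'a set \<Rightarrow> ('a word \<Rightarrow>\<^sub>0 'k::field) set \<Rightarrow> ('a word \<Rightarrow>\<^sub>0 'k) set" where
  "lift_ideal X A = ideal_sum A (outer X)"

text \<open>An ambient factor splits into a member of \<open>fcar X\<close>, a constant and an outer
  part; closure under \<open>scale\<close> takes care of the constant.\<close>

lemma two_sided_lift:
  assumes "A \<subseteq> fcar X" "0 \<in> A" "\<And>x y. x \<in> A \<Longrightarrow> y \<in> A \<Longrightarrow> x + y \<in> A"
    "\<And>x f. x \<in> A \<Longrightarrow> f \<in> fcar X \<Longrightarrow> f * x \<in> A" "\<And>x f. x \<in> A \<Longrightarrow> f \<in> fcar X \<Longrightarrow> x * f \<in> A"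
    "\<And>x c. x \<in> A \<Longrightarrow> scale c x \<in> A"
  shows "two_sided (lift_ideal X A :: ('a word \<Rightarrow>\<^sub>0 'k::field) set)"
proof (rule two_sidedI)
  note Z = two_sided_outer[of X]
  show "0 \<in> lift_ideal X A"
    unfolding lift_ideal_def ideal_sum_def using assms(2) ts_zero[OF Z] by (intro CollectI exI[of _ 0]) simp
  fix x y assume "x \<in> lift_ideal X A" "y \<in> lift_ideal X A"
  then obtain a z b z' where "x = a + z" "y = b + z'" "a \<in> A" "b \<in> A" "z \<in> outer X" "z' \<in> outer X"
    unfolding lift_ideal_def ideal_sum_def by blast
  then have "x + y = (a + b) + (z + z')" "a + b \<in> A" "z + z' \<in> outer X"
    using assms(3) ts_add[OF Z] by (simp_all add: algebra_simps)
  then show "x + y \<in> lift_ideal X A" unfolding lift_ideal_def ideal_sum_def by blast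
next
  note Z = two_sided_outer[of X]
  fix u x :: "'a word \<Rightarrow>\<^sub>0 'k" assume "x \<in> lift_ideal X A"
  then obtain a z where x: "x = a + z" "a \<in> A" "z \<in> outer X" unfolding lift_ideal_def ideal_sum_def by blast
  obtain f c z' where u: "u = f + Poly_Mapping.single 0 c + z'" "f \<in> fcar X" "z' \<in> outer X"
    using poly_mapping_decomp by blast
  have "u * x = (f * a + scale c a) + (z' * a + u * z)"
    by (simp add: u(1) x(1) scale_def algebra_simps)
  moreover have "f * a + scale c a \<in> A" using assms(3,4,6) x u by blast
  moreover have "z' * a + u * z \<in> outer X" by (intro ts_add[OF Z] ts_rmult[OF Z u(3)] ts_lmult[OF Z x(3)])
  ultimately show "u * x \<in> lift_ideal X A" unfolding lift_ideal_def ideal_sum_def by blast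
  have "x * u = (a * f + scale c a) + (a * z' + z * u)"
    by (simp add: u(1) x(1) scale_def algebra_simps single_0_central)
  moreover have "a * f + scale c a \<in> A" using assms(3,5,6) x u by blast
  moreover have "a * z' + z * u \<in> outer X" by (intro ts_add[OF Z] ts_lmult[OF Z u(3)] ts_rmult[OF Z x(3)])
  ultimately show "x * u \<in> lift_ideal X A" unfolding lift_ideal_def ideal_sum_def by blast
qed

lemma two_sided_lift_fcar: "two_sided (lift_ideal X (fcar X))"
  by (rule two_sided_lift) (auto intro: fcar_zero fcar_add fcar_mult fcar_scale)

lemma abelian_group_free_algebra: "abelian_group (free_algebra TYPE('k::field) X)"
proof (rule abelian_groupI)
  fix x :: "'a word \<Rightarrow>\<^sub>0 'k" assume "x \<in> carrier (free_algebra TYPE('k) X)"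
  then show "\<exists>y\<in>carrier (free_algebra TYPE('k) X). y \<oplus>\<^bsub>free_algebra TYPE('k) X\<^esub> x = \<zero>\<^bsub>free_algebra TYPE('k) X\<^esub>"
    using fcar_uminus by (intro bexI[of _ "- x"]) auto
qed (auto simp: fcar_zero fcar_add add.assoc add.commute)

lemma a_inv_free_algebra: "x \<in> fcar X \<Longrightarrow> a_inv (free_algebra TYPE('k::field) X) x = - x"
  using abelian_group.minus_equality[OF abelian_group_free_algebra[of X], of "- x" x] fcar_uminus by auto

lemma two_sided_ideal_free_algebra:
  "two_sided_ideal J (free_algebra TYPE('k::field) X) \<longleftrightarrow>
     J \<subseteq> fcar X \<and> 0 \<in> J \<and> (\<forall>x\<in>J. \<forall>y\<in>J. x + y \<in> J) \<and> (\<forall>x\<in>J. - x \<in> J) \<and>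
     (\<forall>a\<in>J. \<forall>x\<in>fcar X. x * a \<in> J \<and> a * x \<in> J)"
proof (cases "J \<subseteq> fcar X")
  case True
  then have "(\<forall>x\<in>J. \<ominus>\<^bsub>free_algebra TYPE('k) X\<^esub> x \<in> J) \<longleftrightarrow> (\<forall>x\<in>J. - x \<in> J)"
    by (intro ball_cong refl) (simp add: a_inv_free_algebra subset_iff)
  then show ?thesis by (simp add: two_sided_ideal_iff)
qed (simp add: two_sided_ideal_iff)

locale algebra_quotient =
  fixes X :: "'a set" and N :: "('a word \<Rightarrow>\<^sub>0 'k::field) set"
  assumes N: "two_sided_ideal N (free_algebra TYPE('k) X)"
    and N_scale: "p \<in> N \<Longrightarrow> scale c p \<in> N"
begin

abbreviation "F \<equiv> free_algebra TYPE('k) X"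
abbreviation "L \<equiv> F Quot N"

lemma N_sub: "N \<subseteq> fcar X" and N_zero: "0 \<in> N" and N_add: "x \<in> N \<Longrightarrow> y \<in> N \<Longrightarrow> x + y \<in> N"
  and N_uminus: "x \<in> N \<Longrightarrow> - x \<in> N"
  and N_lmult: "x \<in> N \<Longrightarrow> a \<in> fcar X \<Longrightarrow> a * x \<in> N" and N_rmult: "x \<in> N \<Longrightarrow> a \<in> fcar X \<Longrightarrow> x * a \<in> N"
  using N by (simp_all add: two_sided_ideal_free_algebra)

lemma N_diff: "x \<in> N \<Longrightarrow> y \<in> N \<Longrightarrow> x - y \<in> N"
  using N_add[of x "- y"] N_uminus[of y] by simp

lemma two_sided_T: "two_sided (lift_ideal X N)"
  by (rule two_sided_lift) (auto intro: N_zero N_add N_lmult N_rmult N_scale N_sub[THEN subsetD])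

lemma N_le_M: "lift_ideal X N \<subseteq> lift_ideal X (fcar X)"
  unfolding lift_ideal_def ideal_sum_def using N_sub by blast

text \<open>\<open>fcar X\<close> meets \<open>outer X\<close> only in 0, so the outer part of such
  an \<open>x\<close> vanishes.\<close>

lemma fcar_T: "x \<in> fcar X \<Longrightarrow> x \<in> lift_ideal X N \<Longrightarrow> x \<in> N"
proof -
  assume x: "x \<in> fcar X" "x \<in> lift_ideal X N"
  then obtain n z where "x = n + z" "n \<in> N" "z \<in> outer X" unfolding lift_ideal_def ideal_sum_def by blast
  then have "x = n" using x(1) N_sub by (intro fcar_outer_eq) auto
  with \<open>n \<in> N\<close> show ?thesis by simp
qed

definition "cs a = N +>\<^bsub>F\<^esub> a"

lemma cs_eq: "cs a = {n + a | n. n \<in> N}"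
  by (auto simp: cs_def a_r_coset_def')

lemma cs_self: "a \<in> cs a"
  unfolding cs_eq using N_zero by force

lemma cs_iff: "cs a = cs b \<longleftrightarrow> a - b \<in> N"
proof
  assume "cs a = cs b"
  then have "a \<in> cs b" using cs_self[of a] by simp
  then show "a - b \<in> N" by (auto simp: cs_eq)
next
  assume ab: "a - b \<in> N"
  show "cs a = cs b"
  proof (intro equalityI subsetI)
    fix x assume "x \<in> cs a"
    then obtain n where "x = n + a" "n \<in> N" by (auto simp: cs_eq)
    then have "x = (n + (a - b)) + b" "n + (a - b) \<in> N" using ab N_add by auto
    then show "x \<in> cs b" unfolding cs_eq by blast
  next
    fix x assume "x \<in> cs b"
    then obtain n where "x = n + b" "n \<in> N" by (auto simp: cs_eq)
    then have "x = (n - (a - b)) + a" "n - (a - b) \<in> N" using ab N_diff by auto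
    then show "x \<in> cs a" unfolding cs_eq by blast
  qed
qed

lemma carrier_L: "carrier L = cs ` fcar X"
  by (auto simp: FactRing_def A_RCOSETS_def' cs_def)

lemma zero_L: "\<zero>\<^bsub>L\<^esub> = cs 0"
  by (simp add: FactRing_def cs_eq)

lemma add_L: "cs a \<oplus>\<^bsub>L\<^esub> cs b = cs (a + b)"
proof -
  have "cs a \<oplus>\<^bsub>L\<^esub> cs b = {x + y | x y. x \<in> cs a \<and> y \<in> cs b}"
    by (auto simp: FactRing_def set_add_def')
  also have "\<dots> = cs (a + b)"
  proof (intro equalityI subsetI)
    fix x assume "x \<in> {x + y | x y. x \<in> cs a \<and> y \<in> cs b}"
    then obtain n m where nm: "n \<in> N" "m \<in> N" and "x = (n + a) + (m + b)" unfolding cs_eq by blast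
    then have "x = (n + m) + (a + b)" by (simp add: algebra_simps)
    then show "x \<in> cs (a + b)" unfolding cs_eq using N_add[OF nm] by blast
  next
    fix x assume "x \<in> cs (a + b)"
    then obtain n where n: "n \<in> N" "x = n + (a + b)" unfolding cs_eq by blast
    then have "x = (n + a) + b" by (simp add: algebra_simps)
    moreover have "n + a \<in> cs a" unfolding cs_eq using n(1) by blast
    ultimately show "x \<in> {x + y | x y. x \<in> cs a \<and> y \<in> cs b}" using cs_self[of b] by blast
  qed
  finally show ?thesis .
qed

text \<open>The quotient record multiplies cosets by a union over representatives, all of which give
  the same coset.\<close>

lemma mult_L:
  assumes "a \<in> fcar X" "b \<in> fcar X" shows "cs a \<otimes>\<^bsub>L\<^esub> cs b = cs (a * b)"
proof -
  have ne: "cs c \<noteq> {}" for c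
    using cs_self[of c] by (cases "cs c = {}") simp_all
  have *: "cs ((n + a) * (m + b)) = cs (a * b)" if "n \<in> N" "m \<in> N" for n m
  proof -
    have "(n + a) * (m + b) - a * b = n * (m + b) + a * m" by (simp add: algebra_simps)
    moreover have "n * (m + b) \<in> N" using that assms N_sub by (intro N_rmult fcar_add) auto
    moreover have "a * m \<in> N" using that assms by (intro N_lmult)
    ultimately show ?thesis unfolding cs_iff using N_add by simp
  qed
  have "cs (x * y) = cs (a * b)" if xy: "x \<in> cs a" "y \<in> cs b" for x y
  proof -
    from xy(1) obtain n where n: "n \<in> N" "x = n + a" by (auto simp: cs_eq)
    from xy(2) obtain m where m: "m \<in> N" "y = m + b" by (auto simp: cs_eq)
    show ?thesis unfolding n(2) m(2) by (rule *[OF n(1) m(1)])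
  qed
  then have "(\<Union>x\<in>cs a. \<Union>y\<in>cs b. cs (x * y)) = (\<Union>x\<in>cs a. \<Union>y\<in>cs b. cs (a * b))" by simp
  also have "\<dots> = cs (a * b)"
    using ne[of a] ne[of b] by (simp only: UN_constant if_False)
  finally have "(\<Union>x\<in>cs a. \<Union>y\<in>cs b. cs (x * y)) = cs (a * b)" .
  then show ?thesis by (simp add: FactRing_def rcoset_mult_def cs_def)
qed

lemma abelian_group_L: "abelian_group L"
proof (rule abelian_groupI)
  fix x assume "x \<in> carrier L"
  then obtain a where a: "x = cs a" "a \<in> fcar X" by (auto simp: carrier_L)
  then show "\<exists>y\<in>carrier L. y \<oplus>\<^bsub>L\<^esub> x = \<zero>\<^bsub>L\<^esub>"
    by (intro bexI[of _ "cs (- a)"]) (auto simp: carrier_L add_L zero_L fcar_uminus)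
qed (auto simp: carrier_L add_L zero_L fcar_zero fcar_add algebra_simps)

lemma a_inv_L: "a \<in> fcar X \<Longrightarrow> a_inv L (cs a) = cs (- a)"
  by (rule abelian_group.minus_equality[OF abelian_group_L]) (auto simp: carrier_L add_L zero_L fcar_uminus)

lemma ideal_L:
  assumes "two_sided_ideal A L"
  shows "A \<subseteq> cs ` fcar X" "cs 0 \<in> A" "cs a \<in> A \<Longrightarrow> cs b \<in> A \<Longrightarrow> cs (a + b) \<in> A"
    "cs a \<in> A \<Longrightarrow> a \<in> fcar X \<Longrightarrow> b \<in> fcar X \<Longrightarrow> cs (a * b) \<in> A \<and> cs (b * a) \<in> A"
  using assms[unfolded two_sided_ideal_iff carrier_L zero_L] by (simp_all flip: mult_L add_L)

end

section \<open>Ideals of the quotient and their preimages\<close>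

locale s_unital_quotient = algebra_quotient +
  assumes local_unit: "x \<in> fcar X \<Longrightarrow> \<exists>u\<in>fcar X. u * x - x \<in> N"
begin

text \<open>Together with \<open>down\<close> this gives mutually inverse maps between the ideals of
  \<open>L\<close> and the two-sided ideals lying between the lifts of \<open>N\<close> and
  \<open>fcar X\<close>.\<close>

definition "up A = lift_ideal X {a \<in> fcar X. cs a \<in> A}"
definition "down I = cs ` (I \<inter> fcar X)"

lemma upI: "a \<in> fcar X \<Longrightarrow> cs a \<in> A \<Longrightarrow> z \<in> outer X \<Longrightarrow> a + z \<in> up A"
  unfolding up_def lift_ideal_def ideal_sum_def by blast

lemma upE:
  assumes "x \<in> up A"
  obtains a z where "x = a + z" "a \<in> fcar X" "cs a \<in> A" "z \<in> outer X"
  using assms unfolding up_def lift_ideal_def ideal_sum_def by blast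

lemma fcar_up: "a \<in> fcar X \<Longrightarrow> a \<in> up A \<longleftrightarrow> cs a \<in> A"
proof
  assume a: "a \<in> fcar X" "a \<in> up A"
  from a(2) obtain b z where b: "a = b + z" "b \<in> fcar X" "cs b \<in> A" "z \<in> outer X" by (rule upE)
  then have "a = b" using a(1) by (intro fcar_outer_eq) auto
  with b(3) show "cs a \<in> A" by simp
next
  assume "a \<in> fcar X" "cs a \<in> A"
  from upI[OF this ts_zero[OF two_sided_outer]] show "a \<in> up A" by simp
qed

lemma up_mono: "A \<subseteq> B \<Longrightarrow> up A \<subseteq> up B"
  unfolding up_def lift_ideal_def ideal_sum_def by blast

lemma up_subset: "A \<subseteq> carrier L \<Longrightarrow> up A \<subseteq> up B \<longleftrightarrow> A \<subseteq> B"
  using up_mono fcar_up unfolding carrier_L by blast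

lemma up_inj: "A \<subseteq> carrier L \<Longrightarrow> B \<subseteq> carrier L \<Longrightarrow> up A = up B \<longleftrightarrow> A = B"
  by (simp add: set_eq_subset up_subset)

text \<open>The \<open>fcar X\<close> part of an element of a lift is unique, so its two
  decompositions share it.\<close>

lemma up_Int: "up (A \<inter> B) = up A \<inter> up B"
proof
  show "up (A \<inter> B) \<subseteq> up A \<inter> up B" by (simp add: up_mono)
  show "up A \<inter> up B \<subseteq> up (A \<inter> B)"
  proof
    fix x assume "x \<in> up A \<inter> up B"
    then have "x \<in> up A" "x \<in> up B" by auto
    from this(1) obtain a z where a: "x = a + z" "a \<in> fcar X" "cs a \<in> A" "z \<in> outer X" by (rule upE)
    from \<open>x \<in> up B\<close> obtain b z' where b: "x = b + z'" "b \<in> fcar X" "cs b \<in> B" "z' \<in> outer X" by (rule upE)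
    have "a - b = z' - z" using a(1) b(1) by (simp add: algebra_simps)
    then have "a - b \<in> outer X" using ts_diff[OF two_sided_outer b(4) a(4)] by simp
    then have "a = b" using a(2) b(2) by (intro fcar_outer_eq)
    then have "cs a \<in> A \<inter> B" using a(3) b(3) by simp
    then show "x \<in> up (A \<inter> B)" unfolding a(1) using a(2,4) by (intro upI)
  qed
qed

lemma up_carrier: "up (carrier L) = lift_ideal X (fcar X)"
proof -
  have "{a \<in> fcar X. cs a \<in> carrier L} = fcar X" by (auto simp: carrier_L)
  then show ?thesis by (simp add: up_def)
qed

lemma up_le: "up A \<subseteq> lift_ideal X (fcar X)"
  unfolding up_def lift_ideal_def ideal_sum_def by blast

lemma le_up: "cs 0 \<in> A \<Longrightarrow> lift_ideal X N \<subseteq> up A"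
proof
  fix x assume A: "cs 0 \<in> A" and "x \<in> lift_ideal X N"
  then obtain n z where x: "x = n + z" "n \<in> N" "z \<in> outer X" unfolding lift_ideal_def ideal_sum_def by blast
  then have "cs n = cs 0" by (simp add: cs_iff)
  then show "x \<in> up A" unfolding x(1) using x A N_sub by (intro upI) auto
qed

text \<open>The local units make every ring ideal of the quotient closed under scalars.\<close>

lemma two_sided_up:
  assumes A: "two_sided_ideal A L" shows "two_sided (up A)"
  unfolding up_def
proof (rule two_sided_lift, goal_cases)
  case (6 x c)
  then have x: "x \<in> fcar X" "cs x \<in> A" by auto
  obtain u where u: "u \<in> fcar X" "u * x - x \<in> N" using local_unit[OF x(1)] by blast
  have "scale c u * x - scale c x = scale c (u * x - x)" by (simp add: scale_def algebra_simps)
  then have "cs (scale c u * x) = cs (scale c x)" unfolding cs_iff using N_scale[OF u(2)] by simp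
  moreover have "cs (scale c u * x) \<in> A" using ideal_L(4)[OF A x(2) x(1) fcar_scale[OF u(1)]] by blast
  ultimately show ?case using fcar_scale[OF x(1)] by simp
qed (use ideal_L[OF A] fcar_zero fcar_add fcar_mult in auto)

text \<open>\<open>I\<close> contains both \<open>N\<close> and \<open>outer X\<close>, so it is
  determined by the cosets of its members in \<open>fcar X\<close>.\<close>

lemma up_down:
  assumes I: "two_sided I" "lift_ideal X N \<subseteq> I" "I \<subseteq> lift_ideal X (fcar X)"
  shows "up (down I) = I"
proof -
  have out: "outer X \<subseteq> I"
    using I(2) ideal_sum_right[of N "outer X"] N_zero unfolding lift_ideal_def ideal_sum_def by force
  have NI: "N \<subseteq> I"
    using I(2) ideal_sum_left[OF two_sided_outer, of N X] unfolding lift_ideal_def by blast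
  show ?thesis
  proof (intro equalityI subsetI)
    fix x assume "x \<in> up (down I)"
    then obtain a z where a: "x = a + z" "a \<in> fcar X" "cs a \<in> down I" "z \<in> outer X" by (rule upE)
    then obtain b where b: "cs a = cs b" "b \<in> I" by (auto simp: down_def)
    then have "a - b \<in> I" using NI by (auto simp: cs_iff)
    from ts_add[OF I(1) this b(2)] have "a \<in> I" by simp
    then show "x \<in> I" unfolding a(1) using a(4) out by (intro ts_add[OF I(1)]) auto
  next
    fix x assume x: "x \<in> I"
    then obtain a z where a: "x = a + z" "a \<in> fcar X" "z \<in> outer X"
      using I(3) unfolding lift_ideal_def ideal_sum_def by blast
    have "x - z \<in> I" using x a(3) out by (intro ts_diff[OF I(1)]) auto
    then have "cs a \<in> down I" using a by (auto simp: down_def)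
    then show "x \<in> up (down I)" unfolding a(1) using a(2,3) by (intro upI)
  qed
qed

lemma two_sided_ideal_down:
  assumes I: "two_sided I"
  shows "two_sided_ideal (down I) L"
  unfolding two_sided_ideal_iff
proof (intro conjI ballI)
  show "down I \<subseteq> carrier L" by (auto simp: down_def carrier_L)
  show "\<zero>\<^bsub>L\<^esub> \<in> down I" unfolding zero_L down_def using ts_zero[OF I] fcar_zero by blast
next
  fix x y assume "x \<in> down I" "y \<in> down I"
  then obtain a b where ab: "x = cs a" "y = cs b" "a \<in> I" "a \<in> fcar X" "b \<in> I" "b \<in> fcar X" by (auto simp: down_def)
  then show "x \<oplus>\<^bsub>L\<^esub> y \<in> down I" using ts_add[OF I ab(3,5)] fcar_add[OF ab(4,6)] by (auto simp: add_L down_def)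
next
  fix x assume "x \<in> down I"
  then obtain a where a: "x = cs a" "a \<in> I" "a \<in> fcar X" by (auto simp: down_def)
  then show "\<ominus>\<^bsub>L\<^esub> x \<in> down I" using ts_uminus[OF I a(2)] fcar_uminus[OF a(3)] by (auto simp: a_inv_L down_def)
next
  fix x y assume "x \<in> down I" "y \<in> carrier L"
  then obtain a b where ab: "x = cs a" "y = cs b" "a \<in> I" "a \<in> fcar X" "b \<in> fcar X" by (auto simp: down_def carrier_L)
  then show "y \<otimes>\<^bsub>L\<^esub> x \<in> down I" and "x \<otimes>\<^bsub>L\<^esub> y \<in> down I"
    using ts_lmult[OF I ab(3), of b] ts_rmult[OF I ab(3), of b] fcar_mult[OF ab(4,5)] fcar_mult[OF ab(5,4)]
    by (auto simp: mult_L down_def)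
qed

lemma ideal_prod_carrier:
  assumes "A \<subseteq> carrier L" "B \<subseteq> carrier L" shows "A \<cdot>\<^bsub>L\<^esub> B \<subseteq> carrier L"
proof
  fix x assume "x \<in> A \<cdot>\<^bsub>L\<^esub> B"
  then show "x \<in> carrier L"
  proof induction
    case (prod i j)
    then obtain a b where "i = cs a" "j = cs b" "a \<in> fcar X" "b \<in> fcar X" using assms unfolding carrier_L by blast
    then show ?case by (auto simp: mult_L carrier_L fcar_mult)
  next
    case (sum s t)
    then show ?case by (auto simp: add_L carrier_L fcar_add)
  qed
qed

text \<open>Products of preimages need not reach all of \<open>N\<close> and \<open>outer X\<close>;
  the lift of \<open>N\<close> on the right-hand side supplies them.\<close>

lemma up_ideal_prod:
  assumes A: "A \<subseteq> carrier L" "cs 0 \<in> A" and B: "B \<subseteq> carrier L" "cs 0 \<in> B"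
  shows "up (A \<cdot>\<^bsub>L\<^esub> B) = asp (lift_ideal X N \<union> {a * b | a b. a \<in> up A \<and> b \<in> up B})" (is "_ = asp ?S")
proof (intro equalityI subsetI)
  have z: "cs 0 \<in> A \<cdot>\<^bsub>L\<^esub> B" using ideal_prod.prod[OF A(2) B(2), of L] by (simp add: mult_L fcar_zero)
  fix x assume "x \<in> asp ?S"
  then show "x \<in> up (A \<cdot>\<^bsub>L\<^esub> B)"
  proof (rule asp_least)
    have "0 \<in> lift_ideal X N" using ts_zero[OF two_sided_T] .
    then show "0 \<in> up (A \<cdot>\<^bsub>L\<^esub> B)" using le_up[OF z] by blast
  next
    fix x y assume xy: "x \<in> up (A \<cdot>\<^bsub>L\<^esub> B)" "y \<in> up (A \<cdot>\<^bsub>L\<^esub> B)"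
    from xy(1) obtain a s where a: "x = a + s" "a \<in> fcar X" "cs a \<in> A \<cdot>\<^bsub>L\<^esub> B" "s \<in> outer X" by (rule upE)
    from xy(2) obtain b t where b: "y = b + t" "b \<in> fcar X" "cs b \<in> A \<cdot>\<^bsub>L\<^esub> B" "t \<in> outer X" by (rule upE)
    have "x + y = (a + b) + (s + t)" using a(1) b(1) by (simp add: algebra_simps)
    moreover have "cs (a + b) \<in> A \<cdot>\<^bsub>L\<^esub> B" using ideal_prod.sum[OF a(3) b(3)] by (simp add: add_L)
    ultimately show "x + y \<in> up (A \<cdot>\<^bsub>L\<^esub> B)"
      using upI[OF fcar_add[OF a(2) b(2)] _ ts_add[OF two_sided_outer a(4) b(4)]] by simp
  next
    have "x * y \<in> up (A \<cdot>\<^bsub>L\<^esub> B)" if xA: "x \<in> up A" and yB: "y \<in> up B" for x y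
    proof -
      from xA obtain a s where a: "x = a + s" "a \<in> fcar X" "cs a \<in> A" "s \<in> outer X" by (rule upE)
      from yB obtain b t where b: "y = b + t" "b \<in> fcar X" "cs b \<in> B" "t \<in> outer X" by (rule upE)
      have "x * y = a * b + (a * t + s * y)" using a(1) b(1) by (simp add: algebra_simps)
      moreover have "cs (a * b) \<in> A \<cdot>\<^bsub>L\<^esub> B" using ideal_prod.prod[OF a(3) b(3), of L] a b by (simp add: mult_L)
      moreover have "a * t + s * y \<in> outer X"
        by (rule ts_add[OF two_sided_outer ts_lmult[OF two_sided_outer b(4)] ts_rmult[OF two_sided_outer a(4)]])
      ultimately show ?thesis using upI[OF fcar_mult[OF a(2) b(2)]] by simp
    qed
    then show "?S \<subseteq> up (A \<cdot>\<^bsub>L\<^esub> B)" using le_up[OF z] by blast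
  qed
next
  have NS: "n \<in> asp ?S" if "n \<in> N" for n
    using ideal_sum_left[OF two_sided_outer, of N X] that unfolding lift_ideal_def by (intro asp_base) blast
  have cgS: "a \<in> asp ?S" if ab: "cs a = cs b" and b: "b \<in> asp ?S" for a b
    using asp_add[OF NS b, of "a - b"] ab by (simp add: cs_iff)
  have "\<exists>a. a \<in> fcar X \<and> x = cs a \<and> a \<in> asp ?S" if "x \<in> A \<cdot>\<^bsub>L\<^esub> B" for x
    using that
  proof induction
    case (prod i j)
    then obtain a b where ab: "i = cs a" "j = cs b" "a \<in> fcar X" "b \<in> fcar X" using A B unfolding carrier_L by blast
    then have "a \<in> up A" "b \<in> up B" using prod by (auto simp: fcar_up)
    then have "a * b \<in> asp ?S" by (intro asp_base) blast
    then show ?case using ab by (intro exI[of _ "a * b"]) (simp add: mult_L fcar_mult)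
  next
    case (sum s t)
    then obtain a b where ab: "s = cs a" "t = cs b" "a \<in> fcar X" "b \<in> fcar X" "a \<in> asp ?S" "b \<in> asp ?S" by blast
    then show ?case by (intro exI[of _ "a + b"]) (simp add: add_L fcar_add asp_add)
  qed
  then have fc: "a \<in> asp ?S" if "cs a \<in> A \<cdot>\<^bsub>L\<^esub> B" for a
    using that cgS[of a] by blast
  have out: "z \<in> asp ?S" if "z \<in> outer X" for z
    using that N_zero unfolding lift_ideal_def ideal_sum_def by (intro asp_base) force
  fix x assume "x \<in> up (A \<cdot>\<^bsub>L\<^esub> B)"
  then obtain a z where a: "x = a + z" "a \<in> fcar X" "cs a \<in> A \<cdot>\<^bsub>L\<^esub> B" "z \<in> outer X" by (rule upE)
  show "x \<in> asp ?S" unfolding a(1) by (rule asp_add[OF fc[OF a(3)] out[OF a(4)]])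
qed

end

section \<open>Leavitt path algebras\<close>

lemma relation_ideal:
  assumes S: "S \<subseteq> fcar X"
  shows "two_sided_ideal (relation_ideal TYPE('k::field) X S) (free_algebra TYPE('k) X)"
    and "p \<in> relation_ideal TYPE('k) X S \<Longrightarrow> scale c p \<in> relation_ideal TYPE('k) X S"
    and "S \<subseteq> relation_ideal TYPE('k) X S"
proof -
  \<comment> \<open>The whole carrier is one of the intersected ideals, which keeps the intersection
    inside the carrier.\<close>
  have "fcar X \<in> {J. two_sided_ideal J (free_algebra TYPE('k) X) \<and> (\<forall>c. \<forall>p\<in>J. scale c p \<in> J) \<and> S \<subseteq> J}"
    using S by (simp add: two_sided_ideal_free_algebra fcar_zero fcar_add fcar_uminus fcar_mult fcar_scale)
  then have "relation_ideal TYPE('k) X S \<subseteq> fcar X" unfolding relation_ideal_def by blast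
  then show "two_sided_ideal (relation_ideal TYPE('k) X S) (free_algebra TYPE('k) X)"
    unfolding two_sided_ideal_free_algebra by (simp add: relation_ideal_def two_sided_ideal_free_algebra)
qed (auto simp: relation_ideal_def)

lemma gen_fcar: "x \<in> X \<Longrightarrow> gen x \<in> fcar X"
  by (simp add: fcar_def gen_def)

lemma single_prod_gen:
  "Poly_Mapping.single w (c :: 'k::field) = Poly_Mapping.single 0 c * prod_list (map gen (letters w))"
proof -
  have "Poly_Mapping.single (Word ls) (1 :: 'k) = prod_list (map gen ls)" for ls :: "'a list"
  proof (induction ls)
    case (Cons x ls)
    have "Poly_Mapping.single (Word (x # ls)) (1 :: 'k) = gen x * Poly_Mapping.single (Word ls) 1"
      by (simp add: gen_def mult_single plus_word_def)
    with Cons show ?case by simp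
  qed (simp add: zero_word_def[symmetric])
  from this[of "letters w"] have "prod_list (map gen (letters w)) = Poly_Mapping.single w (1 :: 'k)" by simp
  then show ?thesis by (simp add: mult_single)
qed

lemma lpa_gens_iff [simp]:
  "Vertex v \<in> lpa_gens E \<longleftrightarrow> v \<in> verts E" "Edge e \<in> lpa_gens E \<longleftrightarrow> e \<in> arcs E"
  "Ghost e \<in> lpa_gens E \<longleftrightarrow> e \<in> arcs E"
  by (auto simp: lpa_gens_def)

lemma lpa_relsD:
  assumes "lpa_rels E \<subseteq> T"
  shows "v \<in> verts E \<Longrightarrow> gen (Vertex v) * gen (Vertex v) - gen (Vertex v) \<in> T"
    and "v \<in> verts E \<Longrightarrow> w \<in> verts E \<Longrightarrow> v \<noteq> w \<Longrightarrow> gen (Vertex v) * gen (Vertex w) \<in> T"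
    and "e \<in> arcs E \<Longrightarrow> gen (Vertex (tail E e)) * gen (Edge e) - gen (Edge e) \<in> T"
    and "e \<in> arcs E \<Longrightarrow> gen (Edge e) * gen (Vertex (head E e)) - gen (Edge e) \<in> T"
    and "e \<in> arcs E \<Longrightarrow> gen (Vertex (head E e)) * gen (Ghost e) - gen (Ghost e) \<in> T"
    and "e \<in> arcs E \<Longrightarrow> gen (Ghost e) * gen (Vertex (tail E e)) - gen (Ghost e) \<in> T"
    and "e \<in> arcs E \<Longrightarrow> gen (Ghost e) * gen (Edge e) - gen (Vertex (head E e)) \<in> T"
    and "e \<in> arcs E \<Longrightarrow> f \<in> arcs E \<Longrightarrow> e \<noteq> f \<Longrightarrow> gen (Ghost e) * gen (Edge f) \<in> T"
proof -
  have ball1: "(\<forall>x\<in>{f e | e. P e}. Q x) \<longleftrightarrow> (\<forall>e. P e \<longrightarrow> Q (f e))" for f :: "'x \<Rightarrow> 'y" and P Q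
    by blast
  have ball2: "(\<forall>x\<in>{f e g | e g. P e g}. Q x) \<longleftrightarrow> (\<forall>e g. P e g \<longrightarrow> Q (f e g))" for f :: "'x \<Rightarrow> 'z \<Rightarrow> 'y" and P Q
    by blast
  note R = assms[unfolded lpa_rels_def subset_eq ball_Un ball1 ball2]
  show "v \<in> verts E \<Longrightarrow> gen (Vertex v) * gen (Vertex v) - gen (Vertex v) \<in> T"
    and "v \<in> verts E \<Longrightarrow> w \<in> verts E \<Longrightarrow> v \<noteq> w \<Longrightarrow> gen (Vertex v) * gen (Vertex w) \<in> T"
    and "e \<in> arcs E \<Longrightarrow> gen (Vertex (tail E e)) * gen (Edge e) - gen (Edge e) \<in> T"
    and "e \<in> arcs E \<Longrightarrow> gen (Edge e) * gen (Vertex (head E e)) - gen (Edge e) \<in> T"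
    and "e \<in> arcs E \<Longrightarrow> gen (Vertex (head E e)) * gen (Ghost e) - gen (Ghost e) \<in> T"
    and "e \<in> arcs E \<Longrightarrow> gen (Ghost e) * gen (Vertex (tail E e)) - gen (Ghost e) \<in> T"
    and "e \<in> arcs E \<Longrightarrow> gen (Ghost e) * gen (Edge e) - gen (Vertex (head E e)) \<in> T"
    and "e \<in> arcs E \<Longrightarrow> f \<in> arcs E \<Longrightarrow> e \<noteq> f \<Longrightarrow> gen (Ghost e) * gen (Edge f) \<in> T"
    using R by simp_all
qed

context wf_digraph
begin

lemma lpa_rels_fcar: "(lpa_rels G :: (('a, 'b) lpa_gen word \<Rightarrow>\<^sub>0 'k::field) set) \<subseteq> fcar (lpa_gens G)"
  unfolding lpa_rels_def
  by (auto simp: regular_vertex_def intro!: fcar_diff fcar_mult fcar_sum gen_fcar)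

end

section \<open>Monomials span the Leavitt path algebra\<close>

locale lpa = wf_digraph E for E :: "('v, 'e) pre_digraph" +
  fixes K :: "'k::field itself"
begin

abbreviation "X \<equiv> lpa_gens E"
abbreviation N :: "(('v, 'e) lpa_gen word \<Rightarrow>\<^sub>0 'k) set" where "N \<equiv> relation_ideal TYPE('k) X (lpa_rels E)"
abbreviation "T \<equiv> lift_ideal X N"
abbreviation M :: "(('v, 'e) lpa_gen word \<Rightarrow>\<^sub>0 'k) set" where "M \<equiv> lift_ideal X (fcar X)"
abbreviation V :: "'v \<Rightarrow> ('v, 'e) lpa_gen word \<Rightarrow>\<^sub>0 'k" where "V v \<equiv> gen (Vertex v)"
abbreviation ed :: "'e \<Rightarrow> ('v, 'e) lpa_gen word \<Rightarrow>\<^sub>0 'k" where "ed e \<equiv> gen (Edge e)"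
abbreviation gh :: "'e \<Rightarrow> ('v, 'e) lpa_gen word \<Rightarrow>\<^sub>0 'k" where "gh e \<equiv> gen (Ghost e)"
abbreviation sc :: "'k \<Rightarrow> ('v, 'e) lpa_gen word \<Rightarrow>\<^sub>0 'k" where "sc c \<equiv> Poly_Mapping.single 0 c"

sublocale algebra_quotient X N
proof (rule algebra_quotient.intro)
  show "two_sided_ideal N (free_algebra TYPE('k) X)" by (rule relation_ideal(1)[OF lpa_rels_fcar])
  show "scale c p \<in> N" if "p \<in> N" for p c using that by (rule relation_ideal(2)[OF lpa_rels_fcar])
qed

lemma N_T: "N \<subseteq> T" and outer_T: "outer X \<subseteq> T"
proof -
  show "N \<subseteq> T" unfolding lift_ideal_def by (rule ideal_sum_left[OF two_sided_outer])
  show "outer X \<subseteq> T" unfolding lift_ideal_def ideal_sum_def using N_zero by force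
qed

lemma rels_le_T: "lpa_rels E \<subseteq> T"
  using relation_ideal(3)[OF lpa_rels_fcar] N_T by (rule subset_trans)

sublocale leavitt_relations E V ed gh sc T
proof
  show "sc 1 = 1" by simp
  show "sc (a + b) = sc a + sc b" for a b by (rule single_add)
  show "sc (a * b) = sc a * sc b" for a b by (simp add: mult_single)
  show "sc k * x = x * sc k" for k x by (rule single_0_central)
  show "two_sided T" by (rule two_sided_T)
qed (unfold cg_def, (fact lpa_relsD[OF rels_le_T])+)

abbreviation "Span \<equiv> asp (T \<union> Mons)"

lemma mnl_A: "wlk p w \<Longrightarrow> wlk q w \<Longrightarrow> mnl p w q \<in> Span"
  unfolding Mons_def
  by (intro asp_base UnI2 CollectI exI[of _ 1] exI[of _ p] exI[of _ w] exI[of _ q]) (simp add: sc_one)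

lemma A_cg: "x \<approx>\<^bsub>T\<^esub> y \<Longrightarrow> y \<in> Span \<Longrightarrow> x \<in> Span"
  by (rule asp_cg[OF T])

lemma A_T: "x \<in> T \<Longrightarrow> x \<in> Span"
  by (simp add: asp_base)

lemma A_sc: "x \<in> Span \<Longrightarrow> sc k * x \<in> Span"
proof (rule asp_lmult)
  fix y assume "y \<in> T \<union> Mons"
  then show "sc k * y \<in> Span"
  proof
    assume "y \<in> T"
    then show ?thesis by (intro A_T ts_lmult[OF T])
  next
    assume "y \<in> Mons"
    then obtain c p w q where y: "y = sc c * mnl p w q" "wlk p w" "wlk q w" unfolding Mons_def by blast
    then have "sc k * y = sc (k * c) * mnl p w q" by (simp only: sc_mult mult.assoc)
    then show ?thesis using y unfolding Mons_def by (intro asp_base) blast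
  qed
qed

lemma wlk_verts: "wlk p w \<Longrightarrow> w \<in> verts E"
  by (auto simp: wlk_def dest: awalk_last_in_verts)

text \<open>A generator on the left fixes the monomial, lengthens or shortens \<open>p\<close>, or
  kills it. Only a ghost edge meeting an empty \<open>p\<close> passes through and lengthens
  \<open>q\<close>.\<close>

lemma gen_mnl_A:
  assumes x: "x \<in> X" and p: "wlk p w" and q: "wlk q w"
  shows "gen x * mnl p w q \<in> Span"
proof -
  obtain u where u: "awalk u p w" using p by (auto simp: wlk_def)
  note w = wlk_verts[OF p]
  show ?thesis
  proof (cases x)
    case (Vertex v)
    then have v: "v \<in> verts E" using x by simp
    show ?thesis
    proof (cases "v = u")
      case True
      have "V v * mnl p w q \<approx>\<^bsub>T\<^esub> mnl p w q"
        using cT_rmult[OF V_re[OF u], of "gho q"] by (simp add: True mnl_def mult.assoc)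
      then show ?thesis unfolding Vertex by (rule A_cg[OF _ mnl_A[OF p q]])
    next
      case False
      have "V v * mnl p w q \<in> T"
        using ts_rmult[OF T V_re0[OF u v False], of "gho q"] by (simp add: mnl_def mult.assoc)
      then show ?thesis unfolding Vertex by (rule A_T)
    qed
  next
    case (Edge e)
    then have e: "e \<in> arcs E" using x by simp
    show ?thesis
    proof (cases "head E e = u")
      case True
      have "ed e * mnl p w q = mnl (e # p) w q" by (simp add: mnl_def mult.assoc)
      moreover have "wlk (e # p) w" using u e True by (auto simp: wlk_def awalk_Cons_iff)
      ultimately show ?thesis using mnl_A q Edge by simp
    next
      case False
      have "ed e * V (head E e) * (re p * V w * gho q) \<in> T"
        using ts_mid[OF T V_re0[OF u head_in_verts[OF e] False], of "ed e" "gho q"] by (simp add: mult.assoc)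
      moreover have "ed e * V (head E e) * (re p * V w * gho q) \<approx>\<^bsub>T\<^esub> ed e * mnl p w q"
        unfolding mnl_def by (rule cT_rmult[OF rel_eV[OF e]])
      ultimately have "ed e * mnl p w q \<in> T" using cT_mem by blast
      then show ?thesis unfolding Edge by (rule A_T)
    qed
  next
    case (Ghost e)
    then have e: "e \<in> arcs E" using x by simp
    show ?thesis
    proof (cases p)
      case Nil
      show ?thesis
      proof (cases "w = tail E e")
        case True
        have 1: "gh e * mnl p w q \<approx>\<^bsub>T\<^esub> gh e * gho q"
          using cT_rmult[OF rel_gV[OF e], of "gho q"] by (simp add: True Nil mnl_def mult.assoc)
        \<comment> \<open>Ghosts multiply in reverse order, so \<open>e*\<close> on the left of
          \<open>q*\<close> extends \<open>q\<close> at its end.\<close>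
        have 2: "gh e * gho q \<approx>\<^bsub>T\<^esub> mnl [] (head E e) (q @ [e])"
          using cT_rmult[OF cT_sym[OF rel_Vg[OF e]], of "gho q"] by (simp add: mnl_def mult.assoc)
        obtain u' where "awalk u' q (tail E e)" using q True by (auto simp: wlk_def)
        moreover have "awalk (tail E e) [e] (head E e)" using e by (simp add: awalk_Cons_iff awalk_Nil_iff)
        ultimately have 3: "wlk (q @ [e]) (head E e)" unfolding wlk_def walk_app by blast
        have 4: "wlk [] (head E e)" using e by (simp add: wlk_def awalk_Nil_iff)
        show ?thesis unfolding Ghost by (rule A_cg[OF cT_trans[OF 1 2] mnl_A[OF 4 3]])
      next
        case False
        have "gh e * V (tail E e) * V w * gho q \<in> T"
          using ts_mid[OF T rel_VV0[OF tail_in_verts[OF e] w], of "gh e" "gho q"] False by (simp add: mult.assoc)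
        moreover have "gh e * V (tail E e) * (V w * gho q) \<approx>\<^bsub>T\<^esub> gh e * (V w * gho q)"
          by (rule cT_rmult[OF rel_gV[OF e]])
        ultimately have "gh e * mnl p w q \<in> T" using cT_mem by (simp add: Nil mnl_def mult.assoc)
        then show ?thesis unfolding Ghost by (rule A_T)
      qed
    next
      case (Cons f p')
      then have f: "f \<in> arcs E" and p': "awalk (head E f) p' w" using u by (auto simp: awalk_Cons_iff)
      have eq: "gh e * mnl p w q = gh e * ed f * (re p' * V w * gho q)" by (simp add: Cons mnl_def mult.assoc)
      show ?thesis
      proof (cases "e = f")
        case True
        have 1: "gh e * mnl p w q \<approx>\<^bsub>T\<^esub> V (head E e) * (re p' * V w * gho q)"
          unfolding eq using cT_rmult[OF rel_ge[OF e]] True by simp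
        have 2: "V (head E e) * (re p' * V w * gho q) \<approx>\<^bsub>T\<^esub> mnl p' w q"
          using cT_rmult[OF V_re[OF p'], of "gho q"] True by (simp add: mnl_def mult.assoc)
        have 3: "wlk p' w" using p' by (auto simp: wlk_def)
        show ?thesis unfolding Ghost by (rule A_cg[OF cT_trans[OF 1 2] mnl_A[OF 3 q]])
      next
        case False
        have "gh e * mnl p w q \<in> T" unfolding eq by (rule ts_rmult[OF T rel_ge0[OF e f False]])
        then show ?thesis unfolding Ghost by (rule A_T)
      qed
    qed
  qed
qed

lemma gen_A_mult:
  assumes "x \<in> X" "y \<in> Span" shows "gen x * y \<in> Span"
  using assms(2)
proof (rule asp_lmult)
  fix y assume "y \<in> T \<union> Mons"
  then show "gen x * y \<in> Span"
  proof
    assume "y \<in> T"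
    then show ?thesis by (intro A_T ts_lmult[OF T])
  next
    assume "y \<in> Mons"
    then obtain c p w q where y: "y = sc c * mnl p w q" "wlk p w" "wlk q w" unfolding Mons_def by blast
    have "gen x * y = sc c * (gen x * mnl p w q)" by (simp add: y(1) mult.assoc[symmetric] sc_central[of c "gen x"])
    then show ?thesis using A_sc[OF gen_mnl_A[OF assms(1) y(2,3)]] by simp
  qed
qed

text \<open>An edge or ghost edge equals itself times a vertex, so \<open>gen_A_mult\<close> applies
  to a vertex monomial.\<close>

lemma gen_A: assumes "x \<in> X" shows "gen x \<in> Span"
proof (cases x)
  case (Vertex v)
  then have "wlk [] v" using assms by (simp add: wlk_def awalk_simps)
  then show ?thesis using mnl_A[of "[]" v "[]"] Vertex by (simp add: mnl_def)
next
  case (Edge e)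
  then have e: "e \<in> arcs E" using assms by simp
  then have "V (head E e) \<in> Span" using mnl_A[of "[]" "head E e" "[]"] by (simp add: mnl_def wlk_def awalk_simps)
  from gen_A_mult[OF assms this] show ?thesis using A_cg[OF cT_sym[OF rel_eV[OF e]]] Edge by simp
next
  case (Ghost e)
  then have e: "e \<in> arcs E" using assms by simp
  then have "V (tail E e) \<in> Span" using mnl_A[of "[]" "tail E e" "[]"] by (simp add: mnl_def wlk_def awalk_simps)
  from gen_A_mult[OF assms this] show ?thesis using A_cg[OF cT_sym[OF rel_gV[OF e]]] Ghost by simp
qed

lemma prod_gen_A: "ls \<noteq> [] \<Longrightarrow> set ls \<subseteq> X \<Longrightarrow> prod_list (map gen ls) \<in> Span"
  by (induction ls rule: list_nonempty_induct) (auto intro: gen_A gen_A_mult)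

lemma fcar_A: assumes "f \<in> fcar X" shows "f \<in> Span"
proof -
  have "Poly_Mapping.single w (Poly_Mapping.lookup f w) \<in> Span" if "w \<in> Poly_Mapping.keys f" for w
    unfolding single_prod_gen[of w] using that assms by (intro A_sc prod_gen_A) (auto simp: fcar_def)
  then have "(\<Sum>w\<in>Poly_Mapping.keys f. Poly_Mapping.single w (Poly_Mapping.lookup f w)) \<in> Span"
    by (rule asp_sum)
  then show ?thesis by (simp only: sum_single_keys)
qed

lemma fcar_M: "fcar X \<subseteq> M"
  unfolding lift_ideal_def by (rule ideal_sum_left[OF two_sided_outer])

lemma V_fcar: "v \<in> verts E \<Longrightarrow> V v \<in> fcar X"
  by (simp add: gen_fcar)

sublocale leavitt_family E V ed gh sc T M
proof
  show M: "two_sided M" by (rule two_sided_lift_fcar)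
  show TM: "T \<subseteq> M" by (rule N_le_M)
  show "M = Span"
  proof (intro equalityI subsetI)
    fix x assume "x \<in> M"
    then obtain f z where "x = f + z" "f \<in> fcar X" "z \<in> outer X" unfolding lift_ideal_def ideal_sum_def by blast
    then show "x \<in> Span" using fcar_A A_T outer_T by (auto intro!: asp_add)
  next
    fix x assume "x \<in> Span"
    then show "x \<in> M"
    proof (rule asp_least)
      have "sc k * mnl p w q \<in> M" if "wlk p w" for k p w q
      proof -
        have "V w \<in> M" using V_fcar[OF wlk_verts[OF that]] fcar_M by blast
        then show ?thesis unfolding mnl_def using M by (intro ts_lmult[OF M, of "re p * V w * gho q"] ts_mid[OF M])
      qed
      then show "T \<union> Mons \<subseteq> M" using TM by (auto simp: Mons_def)
    qed (use ts_zero[OF M] ts_add[OF M] in auto)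
  qed
qed

text \<open>The vertices are diagonal idempotents which together with \<open>T\<close> generate all
  monomials, so the local units already constructed apply. The unit found lies in \<open>M\<close>,
  and dropping its outer part moves it to \<open>fcar X\<close>.\<close>

sublocale s_unital_quotient X N
proof
  fix x :: "('v, 'e) lpa_gen word \<Rightarrow>\<^sub>0 'k" assume x: "x \<in> fcar X"
  let ?G = "gen_ideal (T \<union> V ` verts E)"
  have "Mons \<subseteq> ?G"
  proof
    fix y assume "y \<in> Mons"
    then obtain c p w q where y: "y = sc c * mnl p w q" "wlk p w" unfolding Mons_def by blast
    have "V w \<in> ?G" using wlk_verts[OF y(2)] by (intro gen_base) blast
    from ts_mid[OF two_sided_gen this, of "sc c * re p" "gho q"] show "y \<in> ?G"
      by (simp add: y(1) mnl_def mult.assoc)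
  qed
  moreover have "T \<subseteq> ?G" by (rule subsetI, rule gen_base) simp
  ultimately have *: "T \<union> Mons \<subseteq> ?G" by simp
  have xG: "x \<in> ?G"
    by (rule asp_least[OF fcar_A[OF x] ts_zero[OF two_sided_gen] ts_add[OF two_sided_gen] *])
  have "V ` verts E \<subseteq> DId" using V_DId by blast
  from s_unital_left[OF this xG xG] obtain u where u: "u \<in> ?G" "u * x \<approx>\<^bsub>T\<^esub> x" by blast
  have "?G \<subseteq> M" using T_le_M V_M by (intro gen_least[OF M]) blast
  then obtain f z where f: "u = f + z" "f \<in> fcar X" "z \<in> outer X"
    using u(1) unfolding lift_ideal_def ideal_sum_def by blast
  have "z * x \<in> T" using ts_rmult[OF two_sided_outer f(3)] outer_T by (rule subsetD[rotated])
  with u(2) have "(u * x - x) - z * x \<in> T" unfolding cg_def by (rule ts_diff[OF T])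
  moreover have "(u * x - x) - z * x = f * x - x" by (simp add: f(1) algebra_simps)
  ultimately have fx: "f * x - x \<in> T" by simp
  have "f * x - x \<in> N" by (rule fcar_T[OF fcar_diff[OF fcar_mult[OF f(2) x] x] fx])
  then show "\<exists>u\<in>fcar X. u * x - x \<in> N" using f(2) by (rule bexI)
qed

section \<open>Transfer of irreducibility, primeness and powers to the algebra\<close>

lemma L_eq: "leavitt_path_algebra TYPE('k) E = L"
  by (simp add: leavitt_path_algebra_def presented_algebra_def)

lemma ideal_carrier: "two_sided_ideal A L \<Longrightarrow> A \<subseteq> carrier L"
  using ideal_L(1) by (simp add: carrier_L)

lemma adm_up: "two_sided_ideal A L \<Longrightarrow> adm (up A)"
  unfolding adm_def using two_sided_up le_up ideal_L(2) up_le by blast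

lemma ex_up: "adm J \<Longrightarrow> \<exists>A. two_sided_ideal A L \<and> up A = J"
  unfolding adm_def using two_sided_ideal_down up_down by blast

text \<open>Every admissible ideal is the preimage of an ideal of \<open>L\<close>, so statements
  about pairs of ideals can be moved together with their quantifiers.\<close>

lemma all_ideals:
  "(\<forall>A B. two_sided_ideal A L \<longrightarrow> two_sided_ideal B L \<longrightarrow> Q (up A) (up B)) \<longleftrightarrow>
     (\<forall>A B. adm A \<longrightarrow> adm B \<longrightarrow> Q A B)"
proof (intro iffI allI impI)
  fix A B assume *: "\<forall>A B. two_sided_ideal A L \<longrightarrow> two_sided_ideal B L \<longrightarrow> Q (up A) (up B)" and "adm A" "adm B"
  then obtain A' B' where "two_sided_ideal A' L" "up A' = A" "two_sided_ideal B' L" "up B' = B"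
    using ex_up[of A] ex_up[of B] by auto
  with * show "Q A B" by auto
qed (simp add: adm_up)

lemma up_eq_M: "two_sided_ideal A L \<Longrightarrow> up A = M \<longleftrightarrow> A = carrier L"
  unfolding up_carrier[symmetric] by (rule up_inj[OF ideal_carrier subset_refl])

lemma irreducible_up:
  assumes I: "two_sided_ideal I L" shows "irreducible_ideal I L \<longleftrightarrow> irr (up I)"
proof -
  have *: "(A \<inter> B = I \<longrightarrow> A = I \<or> B = I) \<longleftrightarrow> (up A \<inter> up B = up I \<longrightarrow> up A = up I \<or> up B = up I)"
    if A: "two_sided_ideal A L" and B: "two_sided_ideal B L" for A B
  proof -
    have "A \<inter> B \<subseteq> carrier L" using ideal_carrier[OF A] by blast
    then show ?thesis
      using A B I unfolding up_Int[symmetric] by (simp add: up_inj ideal_carrier)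
  qed
  have "irreducible_ideal I L \<longleftrightarrow> (\<forall>A B. two_sided_ideal A L \<longrightarrow> two_sided_ideal B L \<longrightarrow>
      A \<inter> B = I \<longrightarrow> A = I \<or> B = I)"
    unfolding irreducible_ideal_def using I by (simp only: simp_thms)
  also have "\<dots> \<longleftrightarrow> (\<forall>A B. two_sided_ideal A L \<longrightarrow> two_sided_ideal B L \<longrightarrow>
      up A \<inter> up B = up I \<longrightarrow> up A = up I \<or> up B = up I)"
    by (intro all_cong1 imp_cong[OF refl]) (rule *)
  also have "\<dots> \<longleftrightarrow> (\<forall>A B. adm A \<longrightarrow> adm B \<longrightarrow> A \<inter> B = up I \<longrightarrow> A = up I \<or> B = up I)"
    by (rule all_ideals[of "\<lambda>A B. A \<inter> B = up I \<longrightarrow> A = up I \<or> B = up I"])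
  also have "\<dots> \<longleftrightarrow> irr (up I)"
    unfolding irr_def using adm_up[OF I] by (simp only: simp_thms)
  finally show ?thesis .
qed

lemma strongly_irreducible_up:
  assumes I: "two_sided_ideal I L" shows "strongly_irreducible_ideal I L \<longleftrightarrow> sirr (up I)"
proof -
  have *: "(A \<inter> B \<subseteq> I \<longrightarrow> A \<subseteq> I \<or> B \<subseteq> I) \<longleftrightarrow> (up A \<inter> up B \<subseteq> up I \<longrightarrow> up A \<subseteq> up I \<or> up B \<subseteq> up I)"
    if A: "two_sided_ideal A L" and B: "two_sided_ideal B L" for A B
  proof -
    have "A \<inter> B \<subseteq> carrier L" using ideal_carrier[OF A] by blast
    then show ?thesis
      using A B I unfolding up_Int[symmetric] by (simp add: up_subset ideal_carrier)
  qed
  have "strongly_irreducible_ideal I L \<longleftrightarrow> (\<forall>A B. two_sided_ideal A L \<longrightarrow> two_sided_ideal B L \<longrightarrow>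
      A \<inter> B \<subseteq> I \<longrightarrow> A \<subseteq> I \<or> B \<subseteq> I)"
    unfolding strongly_irreducible_ideal_def using I by (simp only: simp_thms)
  also have "\<dots> \<longleftrightarrow> (\<forall>A B. two_sided_ideal A L \<longrightarrow> two_sided_ideal B L \<longrightarrow>
      up A \<inter> up B \<subseteq> up I \<longrightarrow> up A \<subseteq> up I \<or> up B \<subseteq> up I)"
    by (intro all_cong1 imp_cong[OF refl]) (rule *)
  also have "\<dots> \<longleftrightarrow> (\<forall>A B. adm A \<longrightarrow> adm B \<longrightarrow> A \<inter> B \<subseteq> up I \<longrightarrow> A \<subseteq> up I \<or> B \<subseteq> up I)"
    by (rule all_ideals[of "\<lambda>A B. A \<inter> B \<subseteq> up I \<longrightarrow> A \<subseteq> up I \<or> B \<subseteq> up I"])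
  also have "\<dots> \<longleftrightarrow> sirr (up I)"
    unfolding sirr_def using adm_up[OF I] by (simp only: simp_thms)
  finally show ?thesis .
qed

text \<open>\<open>up P\<close> is additively closed and contains \<open>T\<close>, so only the
  products themselves have to be tested.\<close>

lemma ideal_prod_subset_up:
  assumes A: "two_sided_ideal A L" and B: "two_sided_ideal B L" and P: "two_sided_ideal P L"
  shows "A \<cdot>\<^bsub>L\<^esub> B \<subseteq> P \<longleftrightarrow> (\<forall>a\<in>up A. \<forall>b\<in>up B. a * b \<in> up P)"
proof -
  note P' = adm_up[OF P, unfolded adm_def]
  have "A \<cdot>\<^bsub>L\<^esub> B \<subseteq> P \<longleftrightarrow> up (A \<cdot>\<^bsub>L\<^esub> B) \<subseteq> up P"
    using up_subset[OF ideal_prod_carrier[OF ideal_carrier[OF A] ideal_carrier[OF B]]] by simp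
  also have "up (A \<cdot>\<^bsub>L\<^esub> B) = asp (T \<union> {a * b | a b. a \<in> up A \<and> b \<in> up B})" (is "_ = asp ?S")
    by (rule up_ideal_prod[OF ideal_carrier[OF A] ideal_L(2)[OF A] ideal_carrier[OF B] ideal_L(2)[OF B]])
  also have "asp ?S \<subseteq> up P \<longleftrightarrow> ?S \<subseteq> up P"
  proof
    show "asp ?S \<subseteq> up P \<Longrightarrow> ?S \<subseteq> up P" by (rule subsetI, erule subsetD, rule asp_base)
    assume S: "?S \<subseteq> up P"
    have ts: "two_sided (up P)" using P' by simp
    show "asp ?S \<subseteq> up P"
      by (rule subsetI, erule asp_least[OF _ ts_zero[OF ts] ts_add[OF ts] S])
  qed
  also have "?S \<subseteq> up P \<longleftrightarrow> (\<forall>a\<in>up A. \<forall>b\<in>up B. a * b \<in> up P)" using P' by blast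
  finally show ?thesis .
qed

lemma prime_up:
  assumes P: "two_sided_ideal P L" shows "prime_ideal P L \<longleftrightarrow> prm (up P)"
proof -
  have *: "(A \<cdot>\<^bsub>L\<^esub> B \<subseteq> P \<longrightarrow> A \<subseteq> P \<or> B \<subseteq> P) \<longleftrightarrow>
      ((\<forall>a\<in>up A. \<forall>b\<in>up B. a * b \<in> up P) \<longrightarrow> up A \<subseteq> up P \<or> up B \<subseteq> up P)"
    if A: "two_sided_ideal A L" and B: "two_sided_ideal B L" for A B
    using A B P by (simp add: ideal_prod_subset_up up_subset ideal_carrier)
  have "prime_ideal P L \<longleftrightarrow> up P \<noteq> M \<and> (\<forall>A B. two_sided_ideal A L \<longrightarrow> two_sided_ideal B L \<longrightarrow>
      A \<cdot>\<^bsub>L\<^esub> B \<subseteq> P \<longrightarrow> A \<subseteq> P \<or> B \<subseteq> P)"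
    unfolding prime_ideal_def proper_ideal_def up_eq_M[OF P] using P by (simp only: simp_thms)
  also have "(\<forall>A B. two_sided_ideal A L \<longrightarrow> two_sided_ideal B L \<longrightarrow>
      A \<cdot>\<^bsub>L\<^esub> B \<subseteq> P \<longrightarrow> A \<subseteq> P \<or> B \<subseteq> P) \<longleftrightarrow>
    (\<forall>A B. two_sided_ideal A L \<longrightarrow> two_sided_ideal B L \<longrightarrow>
      (\<forall>a\<in>up A. \<forall>b\<in>up B. a * b \<in> up P) \<longrightarrow> up A \<subseteq> up P \<or> up B \<subseteq> up P)"
    by (intro all_cong1 imp_cong[OF refl]) (rule *)
  also have "\<dots> \<longleftrightarrow> (\<forall>A B. adm A \<longrightarrow> adm B \<longrightarrow> (\<forall>a\<in>A. \<forall>b\<in>B. a * b \<in> up P) \<longrightarrow> A \<subseteq> up P \<or> B \<subseteq> up P)"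
    by (rule all_ideals[of "\<lambda>A B. (\<forall>a\<in>A. \<forall>b\<in>B. a * b \<in> up P) \<longrightarrow> A \<subseteq> up P \<or> B \<subseteq> up P"])
  also have "up P \<noteq> M \<and> \<dots> \<longleftrightarrow> prm (up P)"
    unfolding prm_def using adm_up[OF P] by (simp only: simp_thms)
  finally show ?thesis .
qed

text \<open>The facts on the carrier and the zero coset are carried through the induction because
  \<open>up_ideal_prod\<close> needs them for the next factor.\<close>

lemma ideal_power_up:
  assumes P: "two_sided_ideal P L"
  shows "ideal_power L P (Suc n) \<subseteq> carrier L \<and> cs 0 \<in> ideal_power L P (Suc n) \<and>
    up (ideal_power L P (Suc n)) = pw (up P) (Suc n)"
proof (induction n)
  case 0
  then show ?case using ideal_carrier[OF P] ideal_L(2)[OF P] by simp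
next
  case (Suc n)
  let ?Q = "ideal_power L P (Suc n)"
  have Q: "?Q \<subseteq> carrier L" "cs 0 \<in> ?Q" "up ?Q = pw (up P) (Suc n)" using Suc.IH by auto
  note P' = ideal_carrier[OF P] ideal_L(2)[OF P]
  have "cs 0 \<in> ?Q \<cdot>\<^bsub>L\<^esub> P"
    using ideal_prod.prod[OF Q(2) P'(2), of L] by (simp add: mult_L fcar_zero)
  moreover have "up (?Q \<cdot>\<^bsub>L\<^esub> P) = pr (pw (up P) (Suc n)) (up P)"
    unfolding up_ideal_prod[OF Q(1,2) P'] Q(3) pr_def ..
  ultimately show ?case using ideal_prod_carrier[OF Q(1) P'(1)] by simp
qed

lemma prime_power_up:
  assumes I: "two_sided_ideal I L"
  shows "(\<exists>P n. prime_ideal P L \<and> n \<ge> 1 \<and> I = ideal_power L P n) \<longleftrightarrow> (\<exists>P n. prm P \<and> n \<ge> 1 \<and> up I = pw P n)"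
proof -
  have *: "I = ideal_power L P (Suc n) \<longleftrightarrow> up I = pw (up P) (Suc n)" if P: "two_sided_ideal P L" for P n
    using ideal_power_up[OF P, of n] up_inj[OF ideal_carrier[OF I], of "ideal_power L P (Suc n)"] by simp
  show ?thesis
  proof
    assume "\<exists>P n. prime_ideal P L \<and> n \<ge> 1 \<and> I = ideal_power L P n"
    then obtain P n where P: "prime_ideal P L" "n \<ge> 1" "I = ideal_power L P n" by blast
    then obtain m where m: "n = Suc m" by (cases n) auto
    have P': "two_sided_ideal P L" using P(1) by (simp add: prime_ideal_def proper_ideal_def)
    show "\<exists>P n. prm P \<and> n \<ge> 1 \<and> up I = pw P n"
      using P prime_up[OF P'] *[OF P', of m] unfolding m by blast
  next
    assume "\<exists>P n. prm P \<and> n \<ge> 1 \<and> up I = pw P n"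
    then obtain Q n where Q: "prm Q" "n \<ge> 1" "up I = pw Q n" by blast
    then obtain m where m: "n = Suc m" by (cases n) auto
    obtain P where P: "two_sided_ideal P L" "up P = Q" using ex_up[of Q] Q(1) by (auto simp: prm_def)
    have "prime_ideal P L" using prime_up[OF P(1)] P(2) Q(1) by simp
    moreover have "I = ideal_power L P n" using *[OF P(1), of m] P(2) Q(3) m by simp
    ultimately show "\<exists>P n. prime_ideal P L \<and> n \<ge> 1 \<and> I = ideal_power L P n" using Q(2) by blast
  qed
qed

end

theorem theorem3p5:
  fixes E :: "('v, 'e) pre_digraph"
    and I :: "(('v, 'e) lpa_gen word \<Rightarrow>\<^sub>0 'k::field) set set"
  defines "L \<equiv> leavitt_path_algebra TYPE('k) E"
  assumes "wf_digraph E"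
    and "proper_ideal I L"
  shows "(strongly_irreducible_ideal I L \<longleftrightarrow> irreducible_ideal I L) \<and>
         (irreducible_ideal I L \<longleftrightarrow>
            (\<exists>P n. prime_ideal P L \<and> n \<ge> 1 \<and> I = ideal_power L P n))"
proof -
  interpret lpa E "TYPE('k)" using assms(2) by (simp add: lpa_def)
  have I: "two_sided_ideal I (free_algebra TYPE('k) X Quot N)" "I \<noteq> carrier (free_algebra TYPE('k) X Quot N)"
    using assms(3) by (simp_all add: proper_ideal_def L_def L_eq)
  have "up I \<noteq> M" using up_eq_M[OF I(1)] I(2) by simp
  note * = irreducible_iff[OF adm_up[OF I(1)] this]
  show ?thesis
    unfolding L_def L_eq strongly_irreducible_up[OF I(1)] irreducible_up[OF I(1)] prime_power_up[OF I(1)]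
    using * by blast
qed

end
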